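(* Let $k$ be a field. The enriched simplicial presheaf $\mathrm{sSet}_{\mathrm{Sm}/k}(-,\mathbb{A}^1)$ represented by the affine line is objectwise contractible, i.e. for every object $U$ of $\mathrm{Sm}/k$ the simplicial set $\mathrm{sSet}_{\mathrm{Sm}/k}(U,\mathbb{A}^1)$ is contractible.
   Context: $\mathrm{Sm}/k$ is the category of smooth and separated schemes of finite type over the field $k$; products are over $k$. Let $\Delta_k^p=\mathrm{Spec}\, k[X_0,\dots,X_p]/(1-\sum X_i)$ be the algebraic cosimplicial object. $\mathrm{Sm}/k$ is regarded as a simplicial category via $\mathrm{sSet}_{\mathrm{Sm}/k}(U,V)_n=\mathrm{Hom}_{\mathrm{Sm}/k}(U\times\Delta_k^n,V)$, with simplicial structure maps induced by those of $\Delta_k^\bullet$ and composition $(g,f)\mapsto g\circ(f,\mathrm{pr}_2)$ in each degree. An enriched simplicial presheaf is a simplicial (i.e. $\mathrm{sSet}$-enriched) functor $(\mathrm{Sm}/k)^{\mathrm{op}}\to\mathrm{sSet}$, where $\mathrm{sSet}$ is enriched over itself by $\mathrm{sSet}_{\mathrm{sSet}}(A,B)_n=\mathrm{Hom}_{\mathrm{sSet}}(A\times\Delta^n,B)$; the one represented by $V\in\mathrm{Sm}/k$ is $U\mapsto\mathrm{sSet}_{\mathrm{Sm}/k}(U,V)$. A simplicial set is contractible if its map to the point is a weak equivalence. *)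

theory Defs
  imports "HOL-Homology.Homology" "HOL-Algebra.Algebra" "HOL-Combinatorics.Permutations"
begin

no_notation var (\<open>X\<index>\<close>)  \<comment> \<open>frees \<open>X\<close> as a variable name\<close>

section \<open>Locally ringed spaces\<close>

record ('p, 's) ringed_space =
  pts :: "'p topology"
  sec :: "'p set \<Rightarrow> 's ring"
  res :: "'p set \<Rightarrow> 'p set \<Rightarrow> 's \<Rightarrow> 's"  \<comment> \<open>\<open>res X U V\<close> is the restriction from \<open>U\<close> to \<open>V\<close>\<close>

definition presheaf_of_rings :: "('p, 's) ringed_space \<Rightarrow> bool" where
  "presheaf_of_rings X \<longleftrightarrow>
     (\<forall>U. openin (pts X) U \<longrightarrow> cring (sec X U)) \<and>
     (\<forall>U V. openin (pts X) U \<and> openin (pts X) V \<and> V \<subseteq> U \<longrightarrow>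
        res X U V \<in> ring_hom (sec X U) (sec X V)) \<and>
     (\<forall>U. openin (pts X) U \<longrightarrow> (\<forall>s\<in>carrier (sec X U). res X U U s = s)) \<and>
     (\<forall>U V W. openin (pts X) U \<and> openin (pts X) V \<and> openin (pts X) W \<and> W \<subseteq> V \<and> V \<subseteq> U \<longrightarrow>
        (\<forall>s\<in>carrier (sec X U). res X V W (res X U V s) = res X U W s))"

definition sheaf_of_rings :: "('p, 's) ringed_space \<Rightarrow> bool" where
  "sheaf_of_rings X \<longleftrightarrow> presheaf_of_rings X \<and>
     (\<forall>\<U> s. (\<forall>U\<in>\<U>. openin (pts X) U \<and> s U \<in> carrier (sec X U)) \<and>
        (\<forall>U\<in>\<U>. \<forall>V\<in>\<U>. res X U (U \<inter> V) (s U) = res X V (U \<inter> V) (s V)) \<longrightarrow>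
        (\<exists>!t. t \<in> carrier (sec X (\<Union>\<U>)) \<and> (\<forall>U\<in>\<U>. res X (\<Union>\<U>) U t = s U)))"

definition germ :: "('p, 's) ringed_space \<Rightarrow> 'p \<Rightarrow> 'p set \<Rightarrow> 's \<Rightarrow> ('p set \<times> 's) set" where
  "germ X x U s = {(V, t). openin (pts X) V \<and> x \<in> V \<and> t \<in> carrier (sec X V) \<and>
     (\<exists>W. openin (pts X) W \<and> x \<in> W \<and> W \<subseteq> U \<inter> V \<and> res X U W s = res X V W t)}"

text \<open>As for \<^const>\<open>rcoset_mult\<close>, an operation on classes is the union of the classes obtained from
  all representatives; these classes are all equal.\<close>

definition stalk :: "('p, 's) ringed_space \<Rightarrow> 'p \<Rightarrow> ('p set \<times> 's) set ring" where
  "stalk X x =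
     \<lparr>carrier = {germ X x U s | U s. openin (pts X) U \<and> x \<in> U \<and> s \<in> carrier (sec X U)},
      monoid.mult = (\<lambda>a b. \<Union>(U, s)\<in>a. \<Union>(V, t)\<in>b.
        germ X x (U \<inter> V) (res X U (U \<inter> V) s \<otimes>\<^bsub>sec X (U \<inter> V)\<^esub> res X V (U \<inter> V) t)),
      one = germ X x (topspace (pts X)) \<one>\<^bsub>sec X (topspace (pts X))\<^esub>,
      zero = germ X x (topspace (pts X)) \<zero>\<^bsub>sec X (topspace (pts X))\<^esub>,
      add = (\<lambda>a b. \<Union>(U, s)\<in>a. \<Union>(V, t)\<in>b.
        germ X x (U \<inter> V) (res X U (U \<inter> V) s \<oplus>\<^bsub>sec X (U \<inter> V)\<^esub> res X V (U \<inter> V) t))\<rparr>"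

definition local_ring :: "('a, 'm) ring_scheme \<Rightarrow> bool" where
  "local_ring R \<longleftrightarrow> cring R \<and> (\<exists>!\<mm>. maximalideal \<mm> R)"

definition locally_ringed_space :: "('p, 's) ringed_space \<Rightarrow> bool" where
  "locally_ringed_space X \<longleftrightarrow>
     sheaf_of_rings X \<and> (\<forall>x\<in>topspace (pts X). local_ring (stalk X x))"

text \<open>A morphism \<open>X \<rightarrow> Y\<close> is a continuous map with ring homomorphisms
  \<open>O\<^sub>Y(V) \<rightarrow> O\<^sub>X(f\<^sup>-\<^sup>1 V)\<close>. All functions are extensional, so that equality of
  morphisms is equality in HOL.\<close>

record ('p, 's, 'q, 't) rs_mor =
  on_pts :: "'p \<Rightarrow> 'q"
  on_sec :: "'q set \<Rightarrow> 't \<Rightarrow> 's"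

definition preim :: "('p, 's) ringed_space \<Rightarrow> ('p, 's, 'q, 't) rs_mor \<Rightarrow> 'q set \<Rightarrow> 'p set" where
  "preim X f V = {x \<in> topspace (pts X). on_pts f x \<in> V}"

definition stalk_map ::
  "('p, 's) ringed_space \<Rightarrow> ('p, 's, 'q, 't) rs_mor \<Rightarrow> 'p \<Rightarrow> ('q set \<times> 't) set \<Rightarrow> ('p set \<times> 's) set" where
  "stalk_map X f x c = (\<Union>(V, t)\<in>c. germ X x (preim X f V) (on_sec f V t))"

definition lrs_hom ::
  "('p, 's) ringed_space \<Rightarrow> ('q, 't) ringed_space \<Rightarrow> ('p, 's, 'q, 't) rs_mor set" where
  "lrs_hom X Y = {f.
     continuous_map (pts X) (pts Y) (on_pts f) \<and>
     on_pts f \<in> extensional (topspace (pts X)) \<and>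
     on_sec f \<in> extensional {V. openin (pts Y) V} \<and>
     (\<forall>V. openin (pts Y) V \<longrightarrow>
        on_sec f V \<in> ring_hom (sec Y V) (sec X (preim X f V)) \<inter> extensional (carrier (sec Y V))) \<and>
     (\<forall>V W. openin (pts Y) V \<and> openin (pts Y) W \<and> W \<subseteq> V \<longrightarrow>
        (\<forall>t\<in>carrier (sec Y V).
           on_sec f W (res Y V W t) = res X (preim X f V) (preim X f W) (on_sec f V t))) \<and>
     (\<forall>x\<in>topspace (pts X). \<forall>\<nn> \<mm>.
        maximalideal \<nn> (stalk Y (on_pts f x)) \<and> maximalideal \<mm> (stalk X x) \<longrightarrow>
          stalk_map X f x ` \<nn> \<subseteq> \<mm>)}"

definition rs_id :: "('p, 's) ringed_space \<Rightarrow> ('p, 's, 'p, 's) rs_mor" where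
  "rs_id X = \<lparr>on_pts = (\<lambda>x\<in>topspace (pts X). x),
     on_sec = (\<lambda>U\<in>{U. openin (pts X) U}. \<lambda>s\<in>carrier (sec X U). s)\<rparr>"

text \<open>\<open>rs_comp X Y Z g f\<close> is the composite of \<open>f : X \<rightarrow> Y\<close> and \<open>g : Y \<rightarrow> Z\<close>.\<close>

definition rs_comp ::
  "('p, 's) ringed_space \<Rightarrow> ('q, 't) ringed_space \<Rightarrow> ('u, 'v) ringed_space \<Rightarrow>
   ('q, 't, 'u, 'v) rs_mor \<Rightarrow> ('p, 's, 'q, 't) rs_mor \<Rightarrow> ('p, 's, 'u, 'v) rs_mor" where
  "rs_comp X Y Z g f = \<lparr>on_pts = compose (topspace (pts X)) (on_pts g) (on_pts f),
     on_sec = (\<lambda>V\<in>{V. openin (pts Z) V}.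
       compose (carrier (sec Z V)) (on_sec f (preim Y g V)) (on_sec g V))\<rparr>"

definition lrs_isomorphic :: "('p, 's) ringed_space \<Rightarrow> ('q, 't) ringed_space \<Rightarrow> bool" where
  "lrs_isomorphic X Y \<longleftrightarrow> (\<exists>f\<in>lrs_hom X Y. \<exists>g\<in>lrs_hom Y X.
     rs_comp X Y X g f = rs_id X \<and> rs_comp Y X Y f g = rs_id Y)"

definition open_subspace :: "('p, 's) ringed_space \<Rightarrow> 'p set \<Rightarrow> ('p, 's) ringed_space" where
  "open_subspace X U = X\<lparr>pts := subtopology (pts X) U\<rparr>"

definition closed_immersion ::
  "('p, 's) ringed_space \<Rightarrow> ('q, 't) ringed_space \<Rightarrow> ('p, 's, 'q, 't) rs_mor \<Rightarrow> bool" where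
  "closed_immersion X Y f \<longleftrightarrow> f \<in> lrs_hom X Y \<and>
     embedding_map (pts X) (pts Y) (on_pts f) \<and>
     closedin (pts Y) (on_pts f ` topspace (pts X)) \<and>
     (\<forall>x\<in>topspace (pts X).
        stalk_map X f x ` carrier (stalk Y (on_pts f x)) = carrier (stalk X x))"


section \<open>Affine schemes and schemes\<close>

text \<open>The class of the fraction \<open>fst x / snd x\<close> in the localization of \<open>A\<close> at \<open>S\<close>.\<close>

definition fraction :: "('a, 'm) ring_scheme \<Rightarrow> 'a set \<Rightarrow> 'a \<times> 'a \<Rightarrow> ('a \<times> 'a) set" where
  "fraction A S x = {y \<in> carrier A \<times> S.
     \<exists>h\<in>S. h \<otimes>\<^bsub>A\<^esub> (fst x \<otimes>\<^bsub>A\<^esub> snd y \<ominus>\<^bsub>A\<^esub> fst y \<otimes>\<^bsub>A\<^esub> snd x) = \<zero>\<^bsub>A\<^esub>}"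

definition localization :: "('a, 'm) ring_scheme \<Rightarrow> 'a set \<Rightarrow> ('a \<times> 'a) set ring" where
  "localization A S =
     \<lparr>carrier = fraction A S ` (carrier A \<times> S),
      monoid.mult = (\<lambda>x y. \<Union>(a, f)\<in>x. \<Union>(b, g)\<in>y. fraction A S (a \<otimes>\<^bsub>A\<^esub> b, f \<otimes>\<^bsub>A\<^esub> g)),
      one = fraction A S (\<one>\<^bsub>A\<^esub>, \<one>\<^bsub>A\<^esub>),
      zero = fraction A S (\<zero>\<^bsub>A\<^esub>, \<one>\<^bsub>A\<^esub>),
      add = (\<lambda>x y. \<Union>(a, f)\<in>x. \<Union>(b, g)\<in>y.
        fraction A S (a \<otimes>\<^bsub>A\<^esub> g \<oplus>\<^bsub>A\<^esub> b \<otimes>\<^bsub>A\<^esub> f, f \<otimes>\<^bsub>A\<^esub> g))\<rparr>"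

abbreviation stalk_ring :: "('a, 'm) ring_scheme \<Rightarrow> 'a set \<Rightarrow> ('a \<times> 'a) set ring" where
  "stalk_ring A \<pp> \<equiv> localization A (carrier A - \<pp>)"

definition zariski :: "('a, 'm) ring_scheme \<Rightarrow> 'a set topology" where
  "zariski A = topology (\<lambda>U. \<exists>I \<subseteq> carrier A. U = {\<pp>. primeideal \<pp> A \<and> \<not> I \<subseteq> \<pp>})"

text \<open>Sections over \<open>U\<close> are the functions \<open>s\<close> with \<open>s \<pp>\<close> in the local ring at \<open>\<pp>\<close> that are
  locally given by a single fraction.\<close>

definition spec_sections :: "('a, 'm) ring_scheme \<Rightarrow> 'a set set \<Rightarrow> ('a set \<Rightarrow> ('a \<times> 'a) set) set" where
  "spec_sections A U = {s \<in> (\<Pi>\<^sub>E \<pp>\<in>U. carrier (stalk_ring A \<pp>)).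
     \<forall>\<pp>\<in>U. \<exists>V a f. openin (zariski A) V \<and> \<pp> \<in> V \<and> V \<subseteq> U \<and> a \<in> carrier A \<and> f \<in> carrier A \<and>
       (\<forall>\<qq>\<in>V. f \<notin> \<qq> \<and> s \<qq> = fraction A (carrier A - \<qq>) (a, f))}"

definition Spec :: "('a, 'm) ring_scheme \<Rightarrow> ('a set, 'a set \<Rightarrow> ('a \<times> 'a) set) ringed_space" where
  "Spec A =
     \<lparr>pts = zariski A,
      sec = (\<lambda>U.
        \<lparr>carrier = spec_sections A U,
         monoid.mult = (\<lambda>s t. \<lambda>\<pp>\<in>U. s \<pp> \<otimes>\<^bsub>stalk_ring A \<pp>\<^esub> t \<pp>),
         one = (\<lambda>\<pp>\<in>U. \<one>\<^bsub>stalk_ring A \<pp>\<^esub>),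
         zero = (\<lambda>\<pp>\<in>U. \<zero>\<^bsub>stalk_ring A \<pp>\<^esub>),
         add = (\<lambda>s t. \<lambda>\<pp>\<in>U. s \<pp> \<oplus>\<^bsub>stalk_ring A \<pp>\<^esub> t \<pp>)\<rparr>),
      res = (\<lambda>U V s. restrict s V)\<rparr>"

text \<open>The morphism \<open>Spec B \<rightarrow> Spec A\<close> induced by a ring homomorphism \<open>\<phi> : A \<rightarrow> B\<close>.\<close>

definition Spec_map ::
  "('a, 'm) ring_scheme \<Rightarrow> ('b, 'n) ring_scheme \<Rightarrow> ('a \<Rightarrow> 'b) \<Rightarrow>
   ('b set, 'b set \<Rightarrow> ('b \<times> 'b) set, 'a set, 'a set \<Rightarrow> ('a \<times> 'a) set) rs_mor" where
  "Spec_map A B \<phi> =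
     (let contract = (\<lambda>\<pp>. {a \<in> carrier A. \<phi> a \<in> \<pp>}) in
      \<lparr>on_pts = (\<lambda>\<pp>\<in>{\<pp>. primeideal \<pp> B}. contract \<pp>),
       on_sec = (\<lambda>V\<in>{V. openin (zariski A) V}. \<lambda>s\<in>spec_sections A V.
         \<lambda>\<pp>\<in>{\<pp>. primeideal \<pp> B \<and> contract \<pp> \<in> V}.
           \<Union>(a, f)\<in>s (contract \<pp>). fraction B (carrier B - \<pp>) (\<phi> a, \<phi> f))\<rparr>)"

text \<open>If \<open>U\<close> is isomorphic to \<open>Spec A\<close>, then \<open>A\<close> is isomorphic to the ring of sections over \<open>U\<close>.
  Hence rings on the type of sections are the only ones that matter here.\<close>

definition affine_open :: "('p, 's) ringed_space \<Rightarrow> 'p set \<Rightarrow> bool" where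
  "affine_open X U \<longleftrightarrow> openin (pts X) U \<and>
     (\<exists>A :: 's ring. cring A \<and> lrs_isomorphic (open_subspace X U) (Spec A))"

definition scheme :: "('p, 's) ringed_space \<Rightarrow> bool" where
  "scheme X \<longleftrightarrow> locally_ringed_space X \<and>
     (\<forall>x\<in>topspace (pts X). \<exists>U. x \<in> U \<and> affine_open X U)"


section \<open>Schemes over a field\<close>

record ('p, 's, 'k) kscheme =
  und :: "('p, 's) ringed_space"
  str :: "('p, 's, 'k set, 'k set \<Rightarrow> ('k \<times> 'k) set) rs_mor"  \<comment> \<open>the morphism to \<open>Spec k\<close>\<close>

definition is_kscheme :: "'k ring \<Rightarrow> ('p, 's, 'k) kscheme \<Rightarrow> bool" where
  "is_kscheme K X \<longleftrightarrow> scheme (und X) \<and> str X \<in> lrs_hom (und X) (Spec K)"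

abbreviation kcomp ::
  "('p, 's, 'k) kscheme \<Rightarrow> ('q, 't, 'k) kscheme \<Rightarrow> ('u, 'v, 'k) kscheme \<Rightarrow>
   ('q, 't, 'u, 'v) rs_mor \<Rightarrow> ('p, 's, 'q, 't) rs_mor \<Rightarrow> ('p, 's, 'u, 'v) rs_mor" where
  "kcomp X Y Z g f \<equiv> rs_comp (und X) (und Y) (und Z) g f"

definition khom ::
  "'k ring \<Rightarrow> ('p, 's, 'k) kscheme \<Rightarrow> ('q, 't, 'k) kscheme \<Rightarrow> ('p, 's, 'q, 't) rs_mor set" where
  "khom K X Y = {f \<in> lrs_hom (und X) (und Y).
     rs_comp (und X) (und Y) (Spec K) (str Y) f = str X}"

text \<open>The \<open>k\<close>-scheme \<open>Spec A\<close> for a \<open>k\<close>-algebra with structure map \<open>\<phi> : k \<rightarrow> A\<close>.\<close>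

definition kSpec ::
  "'k ring \<Rightarrow> ('a, 'm) ring_scheme \<Rightarrow> ('k \<Rightarrow> 'a) \<Rightarrow> ('a set, 'a set \<Rightarrow> ('a \<times> 'a) set, 'k) kscheme" where
  "kSpec K A \<phi> = \<lparr>und = Spec A, str = Spec_map K A \<phi>\<rparr>"

record ('u, 'v, 'p, 's, 'q, 't, 'k) kspan =
  apex :: "('u, 'v, 'k) kscheme"
  pr1 :: "('u, 'v, 'p, 's) rs_mor"
  pr2 :: "('u, 'v, 'q, 't) rs_mor"

text \<open>Fibre products over \<open>Spec k\<close>. HOL cannot quantify over types inside a formula, so the test
  objects \<open>T\<close> are the \<open>k\<close>-schemes on the same types as the product. The types \<open>'u\<close> and \<open>'v\<close> play
  the role of a universe. If \<open>X\<close> and \<open>Y\<close> are of finite type over \<open>k\<close>, then the set of points of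
  \<open>X \<times> Y\<close> and each of its rings of sections have cardinality at most that of \<open>'k list\<close>. So whenever
  \<open>'k list\<close> embeds in \<open>'u\<close> and in \<open>'v\<close>, the product of \<open>X\<close> and \<open>Y\<close> in the usual sense has copies
  on these types, and the definition describes precisely these.\<close>

definition is_kproduct ::
  "'k ring \<Rightarrow> ('p, 's, 'k) kscheme \<Rightarrow> ('q, 't, 'k) kscheme \<Rightarrow>
   ('u, 'v, 'p, 's, 'q, 't, 'k) kspan \<Rightarrow> bool" where
  "is_kproduct K X Y P \<longleftrightarrow> is_kscheme K (apex P) \<and>
     pr1 P \<in> khom K (apex P) X \<and> pr2 P \<in> khom K (apex P) Y \<and>
     (\<forall>T :: ('u, 'v, 'k) kscheme. is_kscheme K T \<longrightarrow>
        (\<forall>f\<in>khom K T X. \<forall>g\<in>khom K T Y.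
           \<exists>!h. h \<in> khom K T (apex P) \<and>
             kcomp T (apex P) X (pr1 P) h = f \<and> kcomp T (apex P) Y (pr2 P) h = g))"

definition pairing ::
  "'k ring \<Rightarrow> ('p, 's, 'k) kscheme \<Rightarrow> ('q, 't, 'k) kscheme \<Rightarrow>
   ('u, 'v, 'p, 's, 'q, 't, 'k) kspan \<Rightarrow> ('c, 'd, 'k) kscheme \<Rightarrow>
   ('c, 'd, 'p, 's) rs_mor \<Rightarrow> ('c, 'd, 'q, 't) rs_mor \<Rightarrow> ('c, 'd, 'u, 'v) rs_mor" where
  "pairing K X Y P T f g = (THE h. h \<in> khom K T (apex P) \<and>
     kcomp T (apex P) X (pr1 P) h = f \<and> kcomp T (apex P) Y (pr2 P) h = g)"

definition separated :: "'k ring \<Rightarrow> ('p, 's, 'k) kscheme \<Rightarrow> bool" where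
  "separated K X \<longleftrightarrow> (\<exists>P :: ('p, 's, 'p, 's, 'p, 's, 'k) kspan. is_kproduct K X X P \<and>
     closed_immersion (und X) (und (apex P)) (pairing K X X P X (rs_id (und X)) (rs_id (und X))))"

text \<open>The image of a scalar \<open>c\<close> in the ring of sections over \<open>U\<close>.\<close>

definition scalar :: "'k ring \<Rightarrow> ('p, 's, 'k) kscheme \<Rightarrow> 'p set \<Rightarrow> 'k \<Rightarrow> 's" where
  "scalar K X U c = res (und X) (topspace (pts (und X))) U
     (on_sec (str X) (topspace (zariski K))
       (\<lambda>\<pp>\<in>topspace (zariski K). fraction K (carrier K - \<pp>) (c, \<one>\<^bsub>K\<^esub>)))"

definition finite_type :: "'k ring \<Rightarrow> ('p, 's, 'k) kscheme \<Rightarrow> bool" where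
  "finite_type K X \<longleftrightarrow> (\<exists>\<U>. finite \<U> \<and> \<Union>\<U> = topspace (pts (und X)) \<and>
     (\<forall>U\<in>\<U>. affine_open (und X) U \<and>
        (\<exists>G. finite G \<and> G \<subseteq> carrier (sec (und X) U) \<and>
           carrier (sec (und X) U) =
             generate_ring (sec (und X) U) (scalar K X U ` carrier K \<union> G))))"


section \<open>Polynomial rings and smoothness\<close>

definition mpoly_ring :: "'k ring \<Rightarrow> nat set \<Rightarrow> (nat multiset \<Rightarrow> 'k) ring" where
  "mpoly_ring K I =
     \<lparr>carrier = ring.indexed_pset K I (carrier K),
      monoid.mult = (\<lambda>f g m. \<Oplus>\<^bsub>K\<^esub>a\<in>{a. a \<subseteq># m}. f a \<otimes>\<^bsub>K\<^esub> g (m - a)),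
      one = ring.indexed_const K \<one>\<^bsub>K\<^esub>,
      zero = ring.indexed_const K \<zero>\<^bsub>K\<^esub>,
      add = ring.indexed_padd K\<rparr>"

text \<open>The value in \<open>S\<close> of a polynomial \<open>f\<close> over \<open>k\<close> at \<open>v\<close>, with coefficients mapped by \<open>\<phi>\<close>.\<close>

definition mpoly_eval ::
  "'k ring \<Rightarrow> ('a, 'm) ring_scheme \<Rightarrow> ('k \<Rightarrow> 'a) \<Rightarrow> (nat \<Rightarrow> 'a) \<Rightarrow> (nat multiset \<Rightarrow> 'k) \<Rightarrow> 'a" where
  "mpoly_eval K S \<phi> v f = (\<Oplus>\<^bsub>S\<^esub>m\<in>{m. f m \<noteq> \<zero>\<^bsub>K\<^esub>}.
     \<phi> (f m) \<otimes>\<^bsub>S\<^esub> (\<Otimes>\<^bsub>S\<^esub>i\<in>set_mset m. v i [^]\<^bsub>S\<^esub> count m i))"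

definition mpoly_deriv :: "'k ring \<Rightarrow> nat \<Rightarrow> (nat multiset \<Rightarrow> 'k) \<Rightarrow> (nat multiset \<Rightarrow> 'k)" where
  "mpoly_deriv K j f = (\<lambda>m. [Suc (count m j)] \<cdot>\<^bsub>K\<^esub> f (add_mset j m))"

definition ring_det :: "('a, 'm) ring_scheme \<Rightarrow> nat \<Rightarrow> (nat \<Rightarrow> nat \<Rightarrow> 'a) \<Rightarrow> 'a" where
  "ring_det R c M = (\<Oplus>\<^bsub>R\<^esub>\<sigma>\<in>{\<sigma>. \<sigma> permutes {..<c}}.
     (if evenperm \<sigma> then \<one>\<^bsub>R\<^esub> else \<ominus>\<^bsub>R\<^esub> \<one>\<^bsub>R\<^esub>) \<otimes>\<^bsub>R\<^esub> (\<Otimes>\<^bsub>R\<^esub>i\<in>{..<c}. M i (\<sigma> i)))"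

text \<open>\<open>X\<close> is smooth if every point has an affine open neighbourhood whose ring of sections is a
  standard smooth algebra \<open>k[X\<^sub>0, \<dots>, X\<^sub>n\<^sub>-\<^sub>1] / (f\<^sub>0, \<dots>, f\<^sub>c\<^sub>-\<^sub>1)\<close> with \<open>c \<le> n\<close>, that is, the
  determinant of the \<open>\<partial>f\<^sub>i/\<partial>X\<^sub>j\<close> with \<open>i, j < c\<close> is invertible in the quotient.\<close>

definition smooth :: "'k ring \<Rightarrow> ('p, 's, 'k) kscheme \<Rightarrow> bool" where
  "smooth K X \<longleftrightarrow> (\<forall>x\<in>topspace (pts (und X)). \<exists>U. x \<in> U \<and> affine_open (und X) U \<and>
     (\<exists>n c f \<psi>. let R = mpoly_ring K {..<n}; S = sec (und X) U in
        c \<le> n \<and> f ` {..<c} \<subseteq> carrier R \<and>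
        \<psi> \<in> ring_hom R S \<and> \<psi> ` carrier R = carrier S \<and>
        (\<forall>a\<in>carrier K. \<psi> (ring.indexed_const K a) = scalar K X U a) \<and>
        a_kernel R S \<psi> = genideal R (f ` {..<c}) \<and>
        \<psi> (ring_det R c (\<lambda>i j. mpoly_deriv K j (f i))) \<in> Units S))"

definition Sm :: "'k ring \<Rightarrow> ('p, 's, 'k) kscheme set" where
  "Sm K = {X. is_kscheme K X \<and> smooth K X \<and> separated K X \<and> finite_type K X}"

definition affine_line ::
  "'k ring \<Rightarrow> ((nat multiset \<Rightarrow> 'k) set,
     (nat multiset \<Rightarrow> 'k) set \<Rightarrow> ((nat multiset \<Rightarrow> 'k) \<times> (nat multiset \<Rightarrow> 'k)) set, 'k) kscheme" where
  "affine_line K = kSpec K (mpoly_ring K {0}) (ring.indexed_const K)"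


section \<open>Simplicial sets\<close>

definition simplex_cat :: "nat \<Rightarrow> nat \<Rightarrow> (nat \<Rightarrow> nat) set" where
  "simplex_cat m n = {\<theta> \<in> {..m} \<rightarrow>\<^sub>E {..n}. mono_on {..m} \<theta>}"

record 'a sset =
  simplices :: "nat \<Rightarrow> 'a set"
  act :: "nat \<Rightarrow> nat \<Rightarrow> (nat \<Rightarrow> nat) \<Rightarrow> 'a \<Rightarrow> 'a"  \<comment> \<open>\<open>act X m n \<theta> : X\<^sub>n \<rightarrow> X\<^sub>m\<close> for \<open>\<theta> : [m] \<rightarrow> [n]\<close>\<close>

definition simplicial_set :: "'a sset \<Rightarrow> bool" where
  "simplicial_set X \<longleftrightarrow>
     (\<forall>m n. \<forall>\<theta>\<in>simplex_cat m n. \<forall>x\<in>simplices X n. act X m n \<theta> x \<in> simplices X m) \<and>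
     (\<forall>n. \<forall>x\<in>simplices X n. act X n n (\<lambda>i\<in>{..n}. i) x = x) \<and>
     (\<forall>l m n. \<forall>\<eta>\<in>simplex_cat l m. \<forall>\<theta>\<in>simplex_cat m n. \<forall>x\<in>simplices X n.
        act X l m \<eta> (act X m n \<theta> x) = act X l n (compose {..l} \<theta> \<eta>) x)"

definition simplicial_map :: "'a sset \<Rightarrow> 'b sset \<Rightarrow> (nat \<Rightarrow> 'a \<Rightarrow> 'b) \<Rightarrow> bool" where
  "simplicial_map X Y f \<longleftrightarrow> simplicial_set X \<and> simplicial_set Y \<and>
     (\<forall>n. \<forall>x\<in>simplices X n. f n x \<in> simplices Y n) \<and>
     (\<forall>m n. \<forall>\<theta>\<in>simplex_cat m n. \<forall>x\<in>simplices X n. f m (act X m n \<theta> x) = act Y m n \<theta> (f n x))"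

definition point_sset :: "unit sset" where
  "point_sset = \<lparr>simplices = (\<lambda>n. UNIV), act = (\<lambda>m n \<theta> x. x)\<rparr>"

text \<open>The geometric realization: the quotient of the disjoint union of one topological \<open>n\<close>-simplex
  for each \<open>x \<in> X\<^sub>n\<close> by the relation generated by \<open>(\<theta>\<^sup>* x, t) \<sim> (x, \<theta>\<^sub>* t)\<close>.\<close>

type_synonym 'a cell_point = "(nat \<times> 'a) \<times> (nat \<Rightarrow> real)"

definition cells :: "'a sset \<Rightarrow> 'a cell_point topology" where
  "cells X = sum_topology (\<lambda>(n, x). subtopology (powertop_real UNIV) (standard_simplex n))
     (SIGMA n:UNIV. simplices X n)"

definition simplex_push :: "nat \<Rightarrow> (nat \<Rightarrow> nat) \<Rightarrow> (nat \<Rightarrow> real) \<Rightarrow> nat \<Rightarrow> real" where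
  "simplex_push m \<theta> t = (\<lambda>i. \<Sum>j\<in>{j. j \<le> m \<and> \<theta> j = i}. t j)"

definition glue :: "'a sset \<Rightarrow> 'a cell_point rel" where
  "glue X = {(((m, act X m n \<theta> x), t), ((n, x), simplex_push m \<theta> t)) | m n \<theta> x t.
     \<theta> \<in> simplex_cat m n \<and> x \<in> simplices X n \<and> t \<in> standard_simplex m}"

definition real_class :: "'a sset \<Rightarrow> 'a cell_point \<Rightarrow> 'a cell_point set" where
  "real_class X d = (glue X \<union> (glue X)\<inverse>)\<^sup>* `` {d}"

definition realization :: "'a sset \<Rightarrow> 'a cell_point set topology" where
  "realization X = topology (\<lambda>V. V \<subseteq> real_class X ` topspace (cells X) \<and>
     openin (cells X) {d \<in> topspace (cells X). real_class X d \<in> V})"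

definition realization_map ::
  "'b sset \<Rightarrow> (nat \<Rightarrow> 'a \<Rightarrow> 'b) \<Rightarrow> 'a cell_point set \<Rightarrow> 'b cell_point set" where
  "realization_map Y f c = (\<Union>((n, x), t)\<in>c. real_class Y ((n, f n x), t))"


section \<open>Weak equivalences\<close>

definition cube :: "nat \<Rightarrow> (nat \<Rightarrow> real) topology" where
  "cube n = product_topology (\<lambda>i. top_of_set {0..1}) {..<n}"

definition cube_boundary :: "nat \<Rightarrow> (nat \<Rightarrow> real) set" where
  "cube_boundary n = {t \<in> topspace (cube n). \<exists>i<n. t i = 0 \<or> t i = 1}"

definition spheroids :: "nat \<Rightarrow> 'a topology \<Rightarrow> 'a \<Rightarrow> ((nat \<Rightarrow> real) \<Rightarrow> 'a) set" where
  "spheroids n X x = {g. continuous_map (cube n) X g \<and> g ` cube_boundary n \<subseteq> {x}}"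

definition spheroid_class ::
  "nat \<Rightarrow> 'a topology \<Rightarrow> 'a \<Rightarrow> ((nat \<Rightarrow> real) \<Rightarrow> 'a) \<Rightarrow> ((nat \<Rightarrow> real) \<Rightarrow> 'a) set" where
  "spheroid_class n X x g =
     {h. homotopic_with (\<lambda>u. u ` cube_boundary n \<subseteq> {x}) (cube n) X g h}"

definition homotopy_set :: "nat \<Rightarrow> 'a topology \<Rightarrow> 'a \<Rightarrow> ((nat \<Rightarrow> real) \<Rightarrow> 'a) set set" where
  "homotopy_set n X x = spheroid_class n X x ` spheroids n X x"

text \<open>A map inducing a bijection on path components and on all homotopy groups. The induced maps on
  homotopy groups are homomorphisms, so only the underlying sets are needed.\<close>

definition weak_homotopy_equivalence :: "'a topology \<Rightarrow> 'b topology \<Rightarrow> ('a \<Rightarrow> 'b) \<Rightarrow> bool" where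
  "weak_homotopy_equivalence X Y f \<longleftrightarrow> continuous_map X Y f \<and>
     bij_betw (\<lambda>C. \<Union>x\<in>C. path_component_of_set Y (f x))
       (path_components_of X) (path_components_of Y) \<and>
     (\<forall>n\<ge>1. \<forall>x\<in>topspace X.
        bij_betw (\<lambda>c. \<Union>g\<in>c. spheroid_class n Y (f x) (f \<circ> g))
          (homotopy_set n X x) (homotopy_set n Y (f x)))"

definition weak_equivalence :: "'a sset \<Rightarrow> 'b sset \<Rightarrow> (nat \<Rightarrow> 'a \<Rightarrow> 'b) \<Rightarrow> bool" where
  "weak_equivalence X Y f \<longleftrightarrow> simplicial_map X Y f \<and>
     weak_homotopy_equivalence (realization X) (realization Y) (realization_map Y f)"

definition contractible_sset :: "'a sset \<Rightarrow> bool" where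
  "contractible_sset X \<longleftrightarrow> weak_equivalence X point_sset (\<lambda>n x. ())"


section \<open>The algebraic cosimplicial object\<close>

definition simplex_ideal :: "'k ring \<Rightarrow> nat \<Rightarrow> (nat multiset \<Rightarrow> 'k) set" where
  "simplex_ideal K p = (let R = mpoly_ring K {..p} in
     cgenideal R (\<one>\<^bsub>R\<^esub> \<ominus>\<^bsub>R\<^esub> (\<Oplus>\<^bsub>R\<^esub>i\<in>{..p}. ring.indexed_var K i)))"

definition simplex_ring :: "'k ring \<Rightarrow> nat \<Rightarrow> (nat multiset \<Rightarrow> 'k) set ring" where
  "simplex_ring K p = mpoly_ring K {..p} Quot simplex_ideal K p"

definition simplex_class :: "'k ring \<Rightarrow> nat \<Rightarrow> (nat multiset \<Rightarrow> 'k) \<Rightarrow> (nat multiset \<Rightarrow> 'k) set" where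
  "simplex_class K p f = simplex_ideal K p +>\<^bsub>mpoly_ring K {..p}\<^esub> f"

type_synonym 'k simplex_pt = "(nat multiset \<Rightarrow> 'k) set set"
type_synonym 'k simplex_sec =
  "(nat multiset \<Rightarrow> 'k) set set \<Rightarrow> ((nat multiset \<Rightarrow> 'k) set \<times> (nat multiset \<Rightarrow> 'k) set) set"

definition alg_simplex :: "'k ring \<Rightarrow> nat \<Rightarrow> ('k simplex_pt, 'k simplex_sec, 'k) kscheme" where
  "alg_simplex K p = kSpec K (simplex_ring K p) (\<lambda>c. simplex_class K p (ring.indexed_const K c))"

text \<open>For \<open>\<theta> : [m] \<rightarrow> [n]\<close> the morphism \<open>\<Delta>\<^sub>k\<^sup>m \<rightarrow> \<Delta>\<^sub>k\<^sup>n\<close> sends the vertex \<open>j\<close> to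
  the vertex \<open>\<theta> j\<close>; the coordinate \<open>X\<^sub>i\<close> pulls back to the sum of the \<open>X\<^sub>j\<close> with \<open>\<theta> j = i\<close>.\<close>

definition simplex_ring_map ::
  "'k ring \<Rightarrow> nat \<Rightarrow> nat \<Rightarrow> (nat \<Rightarrow> nat) \<Rightarrow> (nat multiset \<Rightarrow> 'k) set \<Rightarrow> (nat multiset \<Rightarrow> 'k) set" where
  "simplex_ring_map K m n \<theta> c = (let S = simplex_ring K m in
     the_elem (mpoly_eval K S (\<lambda>a. simplex_class K m (ring.indexed_const K a))
       (\<lambda>i. \<Oplus>\<^bsub>S\<^esub>j\<in>{j. j \<le> m \<and> \<theta> j = i}. simplex_class K m (ring.indexed_var K j)) ` c))"

definition alg_simplex_map ::
  "'k ring \<Rightarrow> nat \<Rightarrow> nat \<Rightarrow> (nat \<Rightarrow> nat) \<Rightarrow>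
   ('k simplex_pt, 'k simplex_sec, 'k simplex_pt, 'k simplex_sec) rs_mor" where
  "alg_simplex_map K m n \<theta> =
     Spec_map (simplex_ring K n) (simplex_ring K m) (simplex_ring_map K m n \<theta>)"


section \<open>The simplicial category of smooth schemes and enriched presheaves\<close>

text \<open>Products are determined only up to unique isomorphism. The simplicial sets of morphisms are
  defined relative to a choice \<open>P U n\<close> of the products \<open>U \<times> \<Delta>\<^sub>k\<^sup>n\<close>.\<close>

type_synonym ('p, 's, 'k) simplex_products =
  "('p, 's, 'k) kscheme \<Rightarrow> nat \<Rightarrow> ('p, 's, 'p, 's, 'k simplex_pt, 'k simplex_sec, 'k) kspan"

definition simplex_product_choice :: "'k ring \<Rightarrow> ('p, 's, 'k) simplex_products \<Rightarrow> bool" where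
  "simplex_product_choice K P \<longleftrightarrow> (\<forall>U\<in>Sm K. \<forall>n. is_kproduct K U (alg_simplex K n) (P U n))"

definition times_simplex_map ::
  "'k ring \<Rightarrow> ('p, 's, 'k) simplex_products \<Rightarrow> ('p, 's, 'k) kscheme \<Rightarrow> nat \<Rightarrow> nat \<Rightarrow> (nat \<Rightarrow> nat) \<Rightarrow>
   ('p, 's, 'p, 's) rs_mor" where
  "times_simplex_map K P U m n \<theta> =
     pairing K U (alg_simplex K n) (P U n) (apex (P U m)) (pr1 (P U m))
       (kcomp (apex (P U m)) (alg_simplex K m) (alg_simplex K n)
          (alg_simplex_map K m n \<theta>) (pr2 (P U m)))"

definition sSet_Sm ::
  "'k ring \<Rightarrow> ('p, 's, 'k) simplex_products \<Rightarrow> ('p, 's, 'k) kscheme \<Rightarrow> ('q, 't, 'k) kscheme \<Rightarrow>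
   ('p, 's, 'q, 't) rs_mor sset" where
  "sSet_Sm K P U V =
     \<lparr>simplices = (\<lambda>n. khom K (apex (P U n)) V),
      act = (\<lambda>m n \<theta> f. kcomp (apex (P U m)) (apex (P U n)) V f (times_simplex_map K P U m n \<theta>))\<rparr>"

text \<open>The composite \<open>g \<circ> (f, pr\<^sub>2)\<close> of the \<open>n\<close>-simplices \<open>f : U \<times> \<Delta>\<^sub>k\<^sup>n \<rightarrow> V\<close> and
  \<open>g : V \<times> \<Delta>\<^sub>k\<^sup>n \<rightarrow> W\<close>.\<close>

definition sSet_Sm_comp ::
  "'k ring \<Rightarrow> ('p, 's, 'k) simplex_products \<Rightarrow>
   ('p, 's, 'k) kscheme \<Rightarrow> ('p, 's, 'k) kscheme \<Rightarrow> ('q, 't, 'k) kscheme \<Rightarrow> nat \<Rightarrow>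
   ('p, 's, 'q, 't) rs_mor \<Rightarrow> ('p, 's, 'p, 's) rs_mor \<Rightarrow> ('p, 's, 'q, 't) rs_mor" where
  "sSet_Sm_comp K P U V W n g f =
     kcomp (apex (P U n)) (apex (P V n)) W g
       (pairing K V (alg_simplex K n) (P V n) (apex (P U n)) f (pr2 (P U n)))"

text \<open>The data of an enriched simplicial presheaf \<open>F\<close>. An \<open>n\<close>-simplex \<open>f\<close> of \<open>sSet_Sm K P U V\<close> is
  sent to the map \<open>F V \<times> \<Delta>\<^sup>n \<rightarrow> F U\<close> that takes \<open>x \<in> (F V)\<^sub>m\<close> and \<open>\<alpha> : [m] \<rightarrow> [n]\<close> to
  \<open>on_homs F U V n f m x \<alpha>\<close>.\<close>

record ('p, 's, 'k, 'a) enriched_presheaf =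
  on_objs :: "('p, 's, 'k) kscheme \<Rightarrow> 'a sset"
  on_homs :: "('p, 's, 'k) kscheme \<Rightarrow> ('p, 's, 'k) kscheme \<Rightarrow> nat \<Rightarrow> ('p, 's, 'p, 's) rs_mor \<Rightarrow>
    nat \<Rightarrow> 'a \<Rightarrow> (nat \<Rightarrow> nat) \<Rightarrow> 'a"

definition represented_presheaf ::
  "'k ring \<Rightarrow> ('p, 's, 'k) simplex_products \<Rightarrow> ('q, 't, 'k) kscheme \<Rightarrow>
   ('p, 's, 'k, ('p, 's, 'q, 't) rs_mor) enriched_presheaf" where
  "represented_presheaf K P W =
     \<lparr>on_objs = (\<lambda>U. sSet_Sm K P U W),
      on_homs = (\<lambda>U V n f m g \<alpha>. sSet_Sm_comp K P U V W m g (act (sSet_Sm K P U V) m n \<alpha> f))\<rparr>"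

definition objectwise_contractible ::
  "'k ring \<Rightarrow> ('p, 's, 'k, 'a) enriched_presheaf \<Rightarrow> bool" where
  "objectwise_contractible K F \<longleftrightarrow> (\<forall>U\<in>Sm K. contractible_sset (on_objs F U))"

end

theory Submission
  imports Defs "HOL-Analysis.Abstract_Topological_Spaces"
begin

text \<open>A morphism from a scheme \<open>T\<close> to the affine line is a function on \<open>T\<close>. Hence an \<open>n\<close>-simplex
  \<open>f\<close> is a function on \<open>U \<times> \<Delta>\<^sup>n\<close>, and with coordinates \<open>x\<^sub>0, \<dots>, x\<^sub>n, y\<^sub>0, \<dots>, y\<^sub>n\<close> of
  \<open>\<Delta>\<^sup>2\<^sup>n\<^sup>+\<^sup>1\<close> the function \<open>\<Phi> f = (\<Sum> x\<^sub>i) \<cdot> f (x + y)\<close> is a \<open>(2n+1)\<close>-simplex. It restricts to \<open>f\<close>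
  on the face \<open>y = 0\<close> and to \<open>0\<close> on the face \<open>x = 0\<close>, and it is natural in all maps
  \<open>\<theta> : [m] \<rightarrow> [n]\<close>, which act on \<open>\<Delta>\<^sup>2\<^sup>m\<^sup>+\<^sup>1\<close> through \<open>\<theta>\<close> on both halves of the vertices. So
  \<open>(f, t) \<mapsto> (\<Phi> f, ((1 - s) t, s t))\<close> with \<open>0 \<le> s \<le> 1\<close> is a contraction of the geometric
  realization; unlike the usual homotopy \<open>(1 - s) f\<close> it needs no triangulation of prisms. The
  multiplication by \<open>\<Sum> x\<^sub>i\<close> is available because morphisms from a locally ringed space to an
  affine scheme correspond to ring homomorphisms on global sections.\<close>

section \<open>Local rings\<close>

text \<open>The map x + y from \<Delta>^(2n+1) to \<Delta>^n folds the two halves of the vertices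
  together. For n > 0 it is not monotone, so it is no operator of a general simplicial set. It
  exists here because the algebraic simplices are functorial in all maps between their vertex sets;
  hence the algebraic lemmas assume only \<open>\<theta> \<in> {..m} \<rightarrow> {..n}\<close>,
  and monotone maps return with the realization. The factor \<Sum> x_i is the coordinate of the
  vertex 0 pulled back from \<Delta>^1 along the map that sends the first half of the vertices to 0
  and the second half to 1. So \<Phi> f is the linear homotopy from f to 0, pulled back along
  \<Delta>^(2n+1) \<rightarrow> \<Delta>^n \<times> \<Delta>^1. The products with U are known only
  by their universal property. Their rings of functions are therefore never computed: it suffices
  that coordinates pull back along the second projection and that maps between the products act on
  functions by ring homomorphisms. Weak equivalences are defined by homotopy groups at all base
  points, whereas a contraction of the realization moves the base point; this calls for a separate
  argument on spheroids.\<close>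

lemma (in cring) nonunit_in_maximalideal:
  assumes a: "a \<in> carrier R" "a \<notin> Units R"
  obtains M where "maximalideal M R" "a \<in> M"
proof -
  let ?F = "{J. ideal J R \<and> a \<in> J \<and> \<one> \<notin> J}"
  have "PIdl a \<in> ?F"
  proof -
    have "\<one> \<notin> PIdl a"
    proof
      assume "\<one> \<in> PIdl a"
      then obtain x where "x \<in> carrier R" "\<one> = x \<otimes> a" unfolding cgenideal_def by blast
      then have "a \<in> Units R" using a m_comm unfolding Units_def by force
      then show False using a by blast
    qed
    then show ?thesis using cgenideal_ideal[OF a(1)] cgenideal_self[OF a(1)] by blast
  qed
  have "\<exists>M\<in>?F. \<forall>X\<in>?F. M \<subseteq> X \<longrightarrow> X = M"
  proof (rule subset_Zorn)
    fix C assume C: "subset.chain ?F C"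
    show "\<exists>U\<in>?F. \<forall>X\<in>C. X \<subseteq> U"
    proof (cases "C = {}")
      \<comment> \<open>The union of the empty chain is empty and hence no ideal, so
        \<open>PIdl a\<close> serves as the bound.\<close>
      case True then show ?thesis using \<open>PIdl a \<in> ?F\<close> by blast
    next
      case False
      have CF: "C \<subseteq> ?F" and tot: "\<And>X Y. X \<in> C \<Longrightarrow> Y \<in> C \<Longrightarrow> X \<subseteq> Y \<or> Y \<subseteq> X"
        using C unfolding subset.chain_def by auto
      have id: "ideal X R" if "X \<in> C" for X using CF that by blast
      have "ideal (\<Union>C) R"
      proof (rule idealI[OF ring_axioms])
        show "subgroup (\<Union>C) (add_monoid R)"
        proof (rule add.subgroupI)
          show "\<Union>C \<subseteq> carrier R"
          proof
            fix x assume "x \<in> \<Union>C"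
            then obtain Z where "Z \<in> C" "x \<in> Z" by blast
            then show "x \<in> carrier R" using ideal.Icarr[OF id] by blast
          qed
          show "\<Union>C \<noteq> {}" using False CF by blast
        next
          fix x assume "x \<in> \<Union>C"
          then obtain Z where "Z \<in> C" "x \<in> Z" by blast
          then show "\<ominus> x \<in> \<Union>C"
            using additive_subgroup.a_inv_closed[OF ideal.axioms(1)[OF id]] by blast
        next
          fix x y assume "x \<in> \<Union>C" "y \<in> \<Union>C"
          then obtain Z where "Z \<in> C" "x \<in> Z" "y \<in> Z" using tot by blast
          then show "x \<oplus> y \<in> \<Union>C"
            using additive_subgroup.a_closed[OF ideal.axioms(1)[OF id]] by blast
        qed
      next
        fix x y assume "x \<in> \<Union>C" "y \<in> carrier R"
        then obtain Z where Z: "Z \<in> C" "x \<in> Z" by blast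
        then show "y \<otimes> x \<in> \<Union>C" "x \<otimes> y \<in> \<Union>C"
          using ideal.I_l_closed[OF id[OF Z(1)] Z(2)] ideal.I_r_closed[OF id[OF Z(1)] Z(2)] \<open>y \<in> carrier R\<close> by blast+
      qed
      moreover have "a \<in> \<Union>C" "\<one> \<notin> \<Union>C" using False CF by blast+
      ultimately show ?thesis by blast
    qed
  qed
  then obtain M where M: "ideal M R" "a \<in> M" "\<one> \<notin> M" and mx: "\<And>X. X \<in> ?F \<Longrightarrow> M \<subseteq> X \<Longrightarrow> X = M" by blast
  have "maximalideal M R"
  proof (rule maximalidealI[OF M(1)])
    show "carrier R \<noteq> M" using M(3) by auto
    fix J assume J: "ideal J R" "M \<subseteq> J" "J \<subseteq> carrier R"
    \<comment> \<open>An ideal above \<open>M\<close> either lacks \<open>\<one>\<close> and belongs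
      to the family, or it is the whole ring.\<close>
    show "J = M \<or> J = carrier R"
      using mx[of J] J M(2) ideal.one_imp_carrier[OF J(1)] by blast
  qed
  then show thesis using M(2) that by blast
qed

lemma (in maximalideal) maximalideal_nonunits: "I \<subseteq> carrier R - Units R"
proof
  fix a assume a: "a \<in> I"
  have "a \<notin> Units R"
  proof
    assume "a \<in> Units R"
    then have "\<one> \<in> I" using I_l_closed[OF a, of "inv a"] by simp
    then show False using I_notcarr one_imp_carrier by blast
  qed
  then show "a \<in> carrier R - Units R" using a Icarr by blast
qed

text \<open>Every nonunit lies in some maximal ideal, and here there is only one. This turns the
  condition on maximal ideals in \<open>lrs_hom\<close> into a condition on units.\<close>

lemma local_ring_maximalideal_eq:
  assumes "local_ring R" "maximalideal M R" shows "M = carrier R - Units R"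
proof
  interpret cring R using assms by (simp add: local_ring_def)
  show "M \<subseteq> carrier R - Units R" using assms(2) by (rule maximalideal.maximalideal_nonunits)
  show "carrier R - Units R \<subseteq> M"
    using assms nonunit_in_maximalideal unfolding local_ring_def by (metis DiffE subsetI)
qed

lemma local_ring_nonunits: "local_ring R \<Longrightarrow> maximalideal (carrier R - Units R) R"
  using local_ring_maximalideal_eq unfolding local_ring_def by metis

text \<open>By commutativity multiples of nonunits are nonunits, so closure under addition makes the
  nonunits an ideal. A proper ideal contains no unit; hence this ideal is maximal and contains every
  other maximal ideal.\<close>

lemma local_ringI:
  fixes R (structure)
  assumes R: "cring R" and ne: "\<one> \<noteq> \<zero>"
    and add: "\<And>a b. a \<in> carrier R - Units R \<Longrightarrow> b \<in> carrier R - Units R \<Longrightarrow> a \<oplus> b \<notin> Units R"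
  shows "local_ring R"
proof -
  interpret cring R by fact
  let ?N = "carrier R - Units R"
  have mult: "x \<otimes> a \<in> ?N" if "a \<in> ?N" "x \<in> carrier R" for a x
    using that by (auto simp: m_comm dest: unit_factor)
  have id: "ideal ?N R"
  proof (rule idealI[OF ring_axioms])
    show "subgroup ?N (add_monoid R)"
    proof (rule add.subgroupI)
      have "\<zero> \<notin> Units R" using ne by (auto simp: Units_def)
      then show "?N \<noteq> {}" by blast
      fix a assume a: "a \<in> ?N"
      have "\<ominus> a = (\<ominus> \<one>) \<otimes> a" using a by (simp add: l_minus)
      then show "\<ominus> a \<in> ?N" using mult[OF a, of "\<ominus> \<one>"] by simp
    qed (use add in auto)
    fix a x assume ax: "a \<in> ?N" "x \<in> carrier R"
    show "x \<otimes> a \<in> ?N" by (rule mult[OF ax])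
    then show "a \<otimes> x \<in> ?N" using ax by (simp add: m_comm)
  qed
  have "maximalideal ?N R"
  proof (rule maximalidealI[OF id])
    show "carrier R \<noteq> ?N" using Units_one_closed by blast
    fix J assume J: "ideal J R" "?N \<subseteq> J" "J \<subseteq> carrier R"
    show "J = ?N \<or> J = carrier R"
    proof (cases "J \<inter> Units R = {}")
      case False
      then obtain u where u: "u \<in> J" "u \<in> Units R" by blast
      then have "\<one> \<in> J" using ideal.I_l_closed[OF J(1) u(1), of "inv u"] by simp
      then show ?thesis using ideal.one_imp_carrier[OF J(1)] by blast
    qed (use J in blast)
  qed
  moreover have "M = ?N" if "maximalideal M R" for M
    using maximalideal.maximalideal_nonunits[OF that] maximalideal.I_maximal[OF that id]
      maximalideal.I_notcarr[OF \<open>maximalideal ?N R\<close>] by blast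
  ultimately show ?thesis using R unfolding local_ring_def by blast
qed

lemma (in cring) unit_cancel:
  assumes "u \<in> Units R" "x \<in> carrier R" "y \<in> carrier R" "u \<otimes> x = u \<otimes> y" shows "x = y"
  using assms Units_l_cancel by blast

text \<open>Any three elements of a filtered colimit come from one of the rings, so it inherits the ring axioms.\<close>

lemma cring_if_locally_image:
  fixes S (structure)
  assumes img: "\<And>x y z. x \<in> carrier S \<Longrightarrow> y \<in> carrier S \<Longrightarrow> z \<in> carrier S \<Longrightarrow>
      \<exists>(R :: 'r ring) h. cring R \<and> h \<in> ring_hom R S \<and> h \<zero>\<^bsub>R\<^esub> = \<zero> \<and> {x, y, z} \<subseteq> h ` carrier R"
    and ne: "\<zero> \<in> carrier S"
  shows "cring S"
proof -
  have *: "x \<oplus> y \<in> carrier S \<and> x \<otimes> y \<in> carrier S \<and> x \<oplus> y = y \<oplus> x \<and> x \<otimes> y = y \<otimes> x \<and>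
      (x \<oplus> y) \<oplus> z = x \<oplus> (y \<oplus> z) \<and> (x \<otimes> y) \<otimes> z = x \<otimes> (y \<otimes> z) \<and> (x \<oplus> y) \<otimes> z = x \<otimes> z \<oplus> y \<otimes> z \<and>
      \<zero> \<oplus> x = x \<and> \<one> \<otimes> x = x \<and> \<one> \<in> carrier S \<and> (\<exists>x'\<in>carrier S. x' \<oplus> x = \<zero>)"
    if xyz: "x \<in> carrier S" "y \<in> carrier S" "z \<in> carrier S" for x y z
  proof -
    obtain R :: "'r ring" and h where R: "cring R" and h: "h \<in> ring_hom R S" and h0: "h \<zero>\<^bsub>R\<^esub> = \<zero>"
      and "{x, y, z} \<subseteq> h ` carrier R" using img[OF xyz] by blast
    then have "x \<in> h ` carrier R" "y \<in> h ` carrier R" "z \<in> h ` carrier R" by simp_all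
    then obtain a b c where abc: "a \<in> carrier R" "b \<in> carrier R" "c \<in> carrier R" "x = h a" "y = h b" "z = h c"
      by (elim imageE)
    interpret R: cring R by (rule R)
    note hs = ring_hom_add[OF h, symmetric] ring_hom_mult[OF h, symmetric] ring_hom_one[OF h, symmetric] h0[symmetric]
    have neg: "h (\<ominus>\<^bsub>R\<^esub> a) \<in> carrier S" "h (\<ominus>\<^bsub>R\<^esub> a) \<oplus> h a = \<zero>"
      using abc by (simp_all add: hs ring_hom_closed[OF h] R.l_neg)
    have "x \<oplus> y \<in> carrier S" "x \<otimes> y \<in> carrier S" "\<one> \<in> carrier S"
      using abc by (simp_all add: hs ring_hom_closed[OF h])
    moreover have "x \<oplus> y = y \<oplus> x" "x \<otimes> y = y \<otimes> x" "\<zero> \<oplus> x = x" "\<one> \<otimes> x = x"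
      using abc by (simp_all add: hs R.a_comm R.m_comm)
    moreover have "(x \<oplus> y) \<oplus> z = x \<oplus> (y \<oplus> z)" "(x \<otimes> y) \<otimes> z = x \<otimes> (y \<otimes> z)" "(x \<oplus> y) \<otimes> z = x \<otimes> z \<oplus> y \<otimes> z"
      using abc by (simp_all add: hs R.a_assoc R.m_assoc R.l_distr)
    ultimately show ?thesis using neg abc(4) by blast
  qed
  show ?thesis
  proof (rule cringI)
    show "abelian_group S" by (rule abelian_groupI) (use * ne in blast)+
    show "comm_monoid S" by (rule comm_monoidI) (use * ne in blast)+
  qed (use * in blast)
qed

section \<open>Stalks\<close>

locale ring_presheaf =
  fixes X :: "('p, 's) ringed_space"
  assumes presheaf: "presheaf_of_rings X"
begin

abbreviation opn :: "'p set \<Rightarrow> bool" where "opn U \<equiv> openin (pts X) U"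
abbreviation Sc :: "'p set \<Rightarrow> 's set" where "Sc U \<equiv> carrier (sec X U)"

lemma sec_cring: "opn U \<Longrightarrow> cring (sec X U)"
  using presheaf by (simp add: presheaf_of_rings_def)

lemma res_hom: "opn U \<Longrightarrow> opn V \<Longrightarrow> V \<subseteq> U \<Longrightarrow> res X U V \<in> ring_hom (sec X U) (sec X V)"
  using presheaf by (simp add: presheaf_of_rings_def)

lemma res_closed: "opn U \<Longrightarrow> opn V \<Longrightarrow> V \<subseteq> U \<Longrightarrow> s \<in> Sc U \<Longrightarrow> res X U V s \<in> Sc V"
  using res_hom ring_hom_closed by metis

lemma res_id: "opn U \<Longrightarrow> s \<in> Sc U \<Longrightarrow> res X U U s = s"
  using presheaf by (simp add: presheaf_of_rings_def)

lemma res_res: "opn U \<Longrightarrow> opn V \<Longrightarrow> opn W \<Longrightarrow> W \<subseteq> V \<Longrightarrow> V \<subseteq> U \<Longrightarrow> s \<in> Sc U \<Longrightarrow>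
    res X V W (res X U V s) = res X U W s"
  using presheaf by (simp add: presheaf_of_rings_def)

lemma germ_self: "opn U \<Longrightarrow> x \<in> U \<Longrightarrow> s \<in> Sc U \<Longrightarrow> (U, s) \<in> germ X x U s"
  unfolding germ_def by auto

lemma germ_eqI:
  assumes U: "opn U" "s \<in> Sc U" and V: "opn V" "t \<in> Sc V"
    and W: "opn W" "x \<in> W" "W \<subseteq> U \<inter> V" "res X U W s = res X V W t"
  shows "germ X x U s = germ X x V t"
proof -
  have sub: "germ X x U s \<subseteq> germ X x V t"
    if U: "opn U" "s \<in> Sc U" and V: "opn V" "t \<in> Sc V"
      and W: "opn W" "x \<in> W" "W \<subseteq> U \<inter> V" "res X U W s = res X V W t" for U V s t
  proof (clarsimp simp: germ_def)
    fix Y r Z assume Y: "opn Y" "x \<in> Y" "r \<in> Sc Y" and Z: "opn Z" "x \<in> Z" "Z \<subseteq> U" "Z \<subseteq> Y" "res X U Z s = res X Y Z r"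
    \<comment> \<open>On the intersection of the two neighbourhoods all three sections have the same
      restriction.\<close>
    let ?W = "W \<inter> Z"
    have oW: "opn ?W" using W Z by blast
    have "res X V ?W t = res X W ?W (res X V W t)" using W V oW by (subst res_res) auto
    also have "\<dots> = res X U ?W s" unfolding W(4)[symmetric] using W U oW by (subst res_res) auto
    also have "\<dots> = res X Z ?W (res X U Z s)" using Z U oW by (subst res_res) auto
    also have "\<dots> = res X Y ?W r" unfolding Z(5) using Z Y oW by (subst res_res) auto
    finally show "\<exists>W. opn W \<and> x \<in> W \<and> W \<subseteq> V \<and> W \<subseteq> Y \<and> res X V W t = res X Y W r"
      using oW W Z by blast
  qed
  show ?thesis using sub[OF U V W] sub[OF V U W(1,2)] W(3,4) by (simp add: Int_commute)
qed

lemma germ_eqE: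
  assumes "germ X x U s = germ X x V t" "opn V" "x \<in> V" "t \<in> Sc V"
  obtains W where "opn W" "x \<in> W" "W \<subseteq> U \<inter> V" "res X U W s = res X V W t"
proof -
  have "(V, t) \<in> germ X x U s" unfolding assms(1) by (rule germ_self[OF assms(2-4)])
  then obtain W where "opn W" "x \<in> W" "W \<subseteq> U \<inter> V" "res X U W s = res X V W t" by (auto simp: germ_def)
  then show thesis by (rule that)
qed

lemma germ_memE:
  assumes "(V, t) \<in> germ X x U s" "opn U" "s \<in> Sc U"
  shows "opn V" "x \<in> V" "t \<in> Sc V" "germ X x V t = germ X x U s"
proof -
  obtain W where a: "opn V" "x \<in> V" "t \<in> Sc V" "opn W" "x \<in> W" "W \<subseteq> U \<inter> V" "res X U W s = res X V W t"
    using assms(1) unfolding germ_def by blast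
  then show "opn V" "x \<in> V" "t \<in> Sc V" by simp_all
  show "germ X x V t = germ X x U s"
    using germ_eqI[OF assms(2,3) a(1,3-7)] by simp
qed

lemma germ_res:
  assumes "opn U" "opn V" "V \<subseteq> U" "x \<in> V" "s \<in> Sc U"
  shows "germ X x V (res X U V s) = germ X x U s"
  using assms by (intro germ_eqI[where W = V]) (auto simp: res_closed res_id)

lemma stalk_cases:
  assumes "a \<in> carrier (stalk X x)"
  obtains U s where "opn U" "x \<in> U" "s \<in> Sc U" "a = germ X x U s"
  using assms unfolding stalk_def by auto

lemma germ_closed: "opn U \<Longrightarrow> x \<in> U \<Longrightarrow> s \<in> Sc U \<Longrightarrow> germ X x U s \<in> carrier (stalk X x)"
  unfolding stalk_def by auto

text \<open>All representatives contribute the same class to the unions in \<^const>\<open>stalk\<close>.\<close>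

lemma germ_Union:
  assumes U: "opn U" "x \<in> U" "s \<in> Sc U" "t \<in> Sc U"
    and cong: "\<And>V W r r'. opn V \<Longrightarrow> opn W \<Longrightarrow> x \<in> V \<Longrightarrow> x \<in> W \<Longrightarrow> r \<in> Sc V \<Longrightarrow> r' \<in> Sc W \<Longrightarrow>
       germ X x V r = germ X x U s \<Longrightarrow> germ X x W r' = germ X x U t \<Longrightarrow> g (V, r) (W, r') = c"
  shows "(\<Union>(V, r)\<in>germ X x U s. \<Union>(W, r')\<in>germ X x U t. g (V, r) (W, r')) = c"
proof -
  have "g p p' = c" if "p \<in> germ X x U s" "p' \<in> germ X x U t" for p p'
    using that germ_memE[of _ _ x U s] germ_memE[of _ _ x U t] U cong by (cases p; cases p') metis
  moreover have "(U, s) \<in> germ X x U s" "(U, t) \<in> germ X x U t" using germ_self U by auto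
  ultimately show ?thesis by fast
qed

text \<open>Products and sums of germs need the same computation, so \<open>f\<close> stands for
  either operation and \<open>fr\<close> says that restriction preserves it. Both changes of
  representative become equalities on the small neighbourhood \<open>?N\<close>.\<close>

lemma germ_op_cong:
  assumes U: "opn U" "x \<in> U" "s \<in> Sc U" "t \<in> Sc U"
    and V: "opn V" "x \<in> V" "r \<in> Sc V" and W: "opn W" "x \<in> W" "r' \<in> Sc W"
    and eq: "germ X x V r = germ X x U s" "germ X x W r' = germ X x U t"
    and f: "\<And>U a b. opn U \<Longrightarrow> a \<in> Sc U \<Longrightarrow> b \<in> Sc U \<Longrightarrow> f U a b \<in> Sc U"
    and fr: "\<And>U V a b. opn U \<Longrightarrow> opn V \<Longrightarrow> V \<subseteq> U \<Longrightarrow> a \<in> Sc U \<Longrightarrow> b \<in> Sc U \<Longrightarrow>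
       res X U V (f U a b) = f V (res X U V a) (res X U V b)"
  shows "germ X x (V \<inter> W) (f (V \<inter> W) (res X V (V \<inter> W) r) (res X W (V \<inter> W) r')) = germ X x U (f U s t)"
proof -
  obtain Y where Y: "opn Y" "x \<in> Y" "Y \<subseteq> V \<inter> U" "res X V Y r = res X U Y s"
    using germ_eqE[OF eq(1) U(1-3)] by blast
  obtain Z where Z: "opn Z" "x \<in> Z" "Z \<subseteq> W \<inter> U" "res X W Z r' = res X U Z t"
    using germ_eqE[OF eq(2) U(1,2,4)] by blast
  let ?N = "Y \<inter> Z"
  have N: "opn ?N" "x \<in> ?N" "?N \<subseteq> V \<inter> W \<inter> U" using Y Z by auto
  have VW: "opn (V \<inter> W)" using V W by auto
  have "res X V ?N r = res X Y ?N (res X V Y r)" using Y V N by (subst res_res) auto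
  also have "\<dots> = res X U ?N s" unfolding Y(4) using Y U N by (subst res_res) auto
  finally have 1: "res X V ?N r = res X U ?N s" .
  have "res X W ?N r' = res X Z ?N (res X W Z r')" using Z W N by (subst res_res) auto
  also have "\<dots> = res X U ?N t" unfolding Z(4) using Z U N by (subst res_res) auto
  finally have 2: "res X W ?N r' = res X U ?N t" .
  have a: "res X V (V \<inter> W) r \<in> Sc (V \<inter> W)" "res X W (V \<inter> W) r' \<in> Sc (V \<inter> W)"
    using V W VW by (auto intro!: res_closed)
  show ?thesis
  proof (rule germ_eqI[OF VW f[OF VW a] U(1) f[OF U(1,3,4)] N])
    show "res X (V \<inter> W) ?N (f (V \<inter> W) (res X V (V \<inter> W) r) (res X W (V \<inter> W) r')) = res X U ?N (f U s t)"
      using N VW U V W a by (simp add: fr res_res 1 2)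
  qed
qed

lemma germ_mult:
  assumes "opn U" "x \<in> U" "s \<in> Sc U" "t \<in> Sc U"
  shows "germ X x U s \<otimes>\<^bsub>stalk X x\<^esub> germ X x U t = germ X x U (s \<otimes>\<^bsub>sec X U\<^esub> t)"
proof -
  have "(\<Union>(V, r)\<in>germ X x U s. \<Union>(W, r')\<in>germ X x U t.
      (\<lambda>(V, r) (W, r'). germ X x (V \<inter> W) (res X V (V \<inter> W) r \<otimes>\<^bsub>sec X (V \<inter> W)\<^esub> res X W (V \<inter> W) r')) (V, r) (W, r'))
    = germ X x U (s \<otimes>\<^bsub>sec X U\<^esub> t)"
    by (rule germ_Union[OF assms], simp, rule germ_op_cong[OF assms, where f = "\<lambda>U. (\<otimes>\<^bsub>sec X U\<^esub>)"])
      (auto simp: ring_hom_mult[OF res_hom] cring.cring_simprules(5)[OF sec_cring])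
  then show ?thesis by (simp add: stalk_def)
qed

lemma germ_add:
  assumes "opn U" "x \<in> U" "s \<in> Sc U" "t \<in> Sc U"
  shows "germ X x U s \<oplus>\<^bsub>stalk X x\<^esub> germ X x U t = germ X x U (s \<oplus>\<^bsub>sec X U\<^esub> t)"
proof -
  have "(\<Union>(V, r)\<in>germ X x U s. \<Union>(W, r')\<in>germ X x U t.
      (\<lambda>(V, r) (W, r'). germ X x (V \<inter> W) (res X V (V \<inter> W) r \<oplus>\<^bsub>sec X (V \<inter> W)\<^esub> res X W (V \<inter> W) r')) (V, r) (W, r'))
    = germ X x U (s \<oplus>\<^bsub>sec X U\<^esub> t)"
    by (rule germ_Union[OF assms], simp, rule germ_op_cong[OF assms, where f = "\<lambda>U. (\<oplus>\<^bsub>sec X U\<^esub>)"])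
      (auto simp: ring_hom_add[OF res_hom] cring.cring_simprules(1)[OF sec_cring])
  then show ?thesis by (simp add: stalk_def)
qed

lemma germ_one:
  assumes "opn U" "x \<in> U" shows "germ X x U \<one>\<^bsub>sec X U\<^esub> = \<one>\<^bsub>stalk X x\<^esub>"
proof -
  have U: "U \<subseteq> topspace (pts X)" using openin_subset assms by blast
  have "germ X x U (res X (topspace (pts X)) U \<one>\<^bsub>sec X (topspace (pts X))\<^esub>) = \<one>\<^bsub>stalk X x\<^esub>"
    using assms U cring.cring_simprules(6)[OF sec_cring] by (subst germ_res) (auto simp: stalk_def)
  then show ?thesis using ring_hom_one[OF res_hom[OF openin_topspace assms(1) U]] by simp
qed

lemma germ_zero:
  assumes "opn U" "x \<in> U" shows "germ X x U \<zero>\<^bsub>sec X U\<^esub> = \<zero>\<^bsub>stalk X x\<^esub>"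
proof -
  have U: "U \<subseteq> topspace (pts X)" using openin_subset assms by blast
  have r: "ring (sec X V)" if "opn V" for V using sec_cring[OF that] by (rule cring.axioms)
  have "germ X x U (res X (topspace (pts X)) U \<zero>\<^bsub>sec X (topspace (pts X))\<^esub>) = \<zero>\<^bsub>stalk X x\<^esub>"
    using assms U cring.cring_simprules(2)[OF sec_cring] by (subst germ_res) (auto simp: stalk_def)
  then show ?thesis using ring_hom_zero[OF res_hom[OF openin_topspace assms(1) U] r r] assms by simp
qed

lemma germ_hom: "opn U \<Longrightarrow> x \<in> U \<Longrightarrow> germ X x U \<in> ring_hom (sec X U) (stalk X x)"
  by (rule ring_hom_memI) (auto simp: germ_closed germ_mult germ_add germ_one)

lemma stalk_cring:
  assumes "x \<in> topspace (pts X)" shows "cring (stalk X x)"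
proof (rule cring_if_locally_image)
  show "\<zero>\<^bsub>stalk X x\<^esub> \<in> carrier (stalk X x)"
    using germ_zero[OF openin_topspace assms] germ_closed[OF openin_topspace assms]
      cring.cring_simprules(2)[OF sec_cring[OF openin_topspace]] by metis
  fix a b c assume "a \<in> carrier (stalk X x)" "b \<in> carrier (stalk X x)" "c \<in> carrier (stalk X x)"
  then obtain U V W r s t where U: "opn U" "x \<in> U" "r \<in> Sc U" "a = germ X x U r"
    and V: "opn V" "x \<in> V" "s \<in> Sc V" "b = germ X x V s" and W: "opn W" "x \<in> W" "t \<in> Sc W" "c = germ X x W t"
    by (metis stalk_cases)
  let ?N = "U \<inter> V \<inter> W"
  have N: "opn ?N" "x \<in> ?N" using U V W by auto
  have "a = germ X x ?N (res X U ?N r)" "b = germ X x ?N (res X V ?N s)" "c = germ X x ?N (res X W ?N t)"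
    using U(4) V(4) W(4) germ_res[of U ?N x r] germ_res[of V ?N x s] germ_res[of W ?N x t]
      U(1-3) V(1-3) W(1-3) N by auto
  moreover have "res X U ?N r \<in> Sc ?N" "res X V ?N s \<in> Sc ?N" "res X W ?N t \<in> Sc ?N"
    using U V W N by (auto intro!: res_closed)
  ultimately have "{a, b, c} \<subseteq> germ X x ?N ` Sc ?N" by blast
  then show "\<exists>(R :: 's ring) h. cring R \<and> h \<in> ring_hom R (stalk X x) \<and> h \<zero>\<^bsub>R\<^esub> = \<zero>\<^bsub>stalk X x\<^esub> \<and> {a, b, c} \<subseteq> h ` carrier R"
    using sec_cring[OF N(1)] germ_hom[OF N] germ_zero[OF N] by blast
qed

text \<open>An inverse germ is represented by a section, and an equation between germs already holds
  on a neighbourhood. Invertibility at a point thus spreads to a neighbourhood, which later gives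
  the continuity of morphisms to affine schemes.\<close>

lemma germ_Units_iff:
  assumes U: "opn U" "x \<in> U" "s \<in> Sc U"
  shows "germ X x U s \<in> Units (stalk X x) \<longleftrightarrow>
    (\<exists>W t. opn W \<and> x \<in> W \<and> W \<subseteq> U \<and> t \<in> Sc W \<and> res X U W s \<otimes>\<^bsub>sec X W\<^esub> t = \<one>\<^bsub>sec X W\<^esub>)"
proof
  have x: "x \<in> topspace (pts X)" using U openin_subset by blast
  interpret S: cring "stalk X x" by (rule stalk_cring[OF x])
  assume "germ X x U s \<in> Units (stalk X x)"
  then obtain b where "b \<in> carrier (stalk X x)" and b: "germ X x U s \<otimes>\<^bsub>stalk X x\<^esub> b = \<one>\<^bsub>stalk X x\<^esub>"
    by (meson S.Units_inv_closed S.Units_r_inv)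
  then obtain V t where V: "opn V" "x \<in> V" "t \<in> Sc V" "b = germ X x V t" by (metis stalk_cases)
  let ?N = "U \<inter> V"
  have N: "opn ?N" "x \<in> ?N" using U V by auto
  have c: "res X U ?N s \<in> Sc ?N" "res X V ?N t \<in> Sc ?N" using U V N by (auto intro!: res_closed)
  interpret N: cring "sec X ?N" by (rule sec_cring[OF N(1)])
  have "germ X x ?N (res X U ?N s \<otimes>\<^bsub>sec X ?N\<^esub> res X V ?N t) = germ X x ?N \<one>\<^bsub>sec X ?N\<^esub>"
    using germ_mult[OF N c] b V U N by (simp add: germ_res germ_one)
  then obtain W where W: "opn W" "x \<in> W" "W \<subseteq> ?N \<inter> ?N"
    "res X ?N W (res X U ?N s \<otimes>\<^bsub>sec X ?N\<^esub> res X V ?N t) = res X ?N W \<one>\<^bsub>sec X ?N\<^esub>"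
    using N by (auto elim!: germ_eqE)
  have h: "res X ?N W \<in> ring_hom (sec X ?N) (sec X W)" using W N by (intro res_hom) auto
  have "res X U W s \<otimes>\<^bsub>sec X W\<^esub> res X V W t = \<one>\<^bsub>sec X W\<^esub>"
    using W(4) ring_hom_mult[OF h c] ring_hom_one[OF h] W(1-3) U V N by (simp add: res_res)
  moreover have "res X V W t \<in> Sc W" using W V by (intro res_closed) auto
  ultimately show "\<exists>W t. opn W \<and> x \<in> W \<and> W \<subseteq> U \<and> t \<in> Sc W \<and> res X U W s \<otimes>\<^bsub>sec X W\<^esub> t = \<one>\<^bsub>sec X W\<^esub>"
    using W by blast
next
  have x: "x \<in> topspace (pts X)" using U openin_subset by blast
  interpret S: cring "stalk X x" by (rule stalk_cring[OF x])
  assume "\<exists>W t. opn W \<and> x \<in> W \<and> W \<subseteq> U \<and> t \<in> Sc W \<and> res X U W s \<otimes>\<^bsub>sec X W\<^esub> t = \<one>\<^bsub>sec X W\<^esub>"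
  then obtain W t where W: "opn W" "x \<in> W" "W \<subseteq> U" "t \<in> Sc W" "res X U W s \<otimes>\<^bsub>sec X W\<^esub> t = \<one>\<^bsub>sec X W\<^esub>" by blast
  have "germ X x U s \<otimes>\<^bsub>stalk X x\<^esub> germ X x W t = \<one>\<^bsub>stalk X x\<^esub>"
    using germ_mult[OF W(1,2) res_closed[OF U(1) W(1,3) U(3)] W(4)] W U by (simp add: germ_res germ_one)
  then show "germ X x U s \<in> Units (stalk X x)"
    using germ_closed[OF U] germ_closed[OF W(1,2,4)] S.m_comm unfolding Units_def
    by (intro CollectI conjI bexI[of _ "germ X x W t"]) auto
qed

end

locale ring_sheaf = ring_presheaf X for X :: "('p, 's) ringed_space" +
  assumes sheaf: "sheaf_of_rings X"
begin

text \<open>The families in \<^const>\<open>sheaf_of_rings\<close> are indexed by the open sets themselves.\<close>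

lemma glue_unique_index:
  assumes I: "\<And>i. i \<in> I \<Longrightarrow> opn (U i) \<and> s i \<in> Sc (U i)"
    and agree: "\<And>i j. i \<in> I \<Longrightarrow> j \<in> I \<Longrightarrow> res X (U i) (U i \<inter> U j) (s i) = res X (U j) (U i \<inter> U j) (s j)"
  shows "\<exists>!t. t \<in> Sc (\<Union>i\<in>I. U i) \<and> (\<forall>i\<in>I. res X (\<Union>i\<in>I. U i) (U i) t = s i)"
proof -
  \<comment> \<open>Several indices may have the same open set. Then \<open>agree\<close>, applied
    to two of them, says that their sections coincide, so the chosen index does not matter.\<close>
  define s' where "s' = (\<lambda>W. s (SOME i. i \<in> I \<and> U i = W))"
  have s': "s' (U i) = s i" if "i \<in> I" for i
  proof -
    let ?j = "SOME j. j \<in> I \<and> U j = U i"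
    have j: "?j \<in> I \<and> U ?j = U i" by (rule someI[of _ i]) (simp add: that)
    then show ?thesis using agree[of ?j i] that I[of i] I[of ?j] by (simp add: s'_def res_id)
  qed
  have "\<exists>!t. t \<in> Sc (\<Union>(U ` I)) \<and> (\<forall>W\<in>U ` I. res X (\<Union>(U ` I)) W t = s' W)"
    using sheaf unfolding sheaf_of_rings_def
    by (elim conjE allE[of _ "U ` I"] allE[of _ s'] impE) (auto simp: s' I intro: agree)
  then show ?thesis by (simp add: s')
qed

text \<open>Equal germs mean agreement on a neighbourhood of each point. Both sections then glue the
  same family, and gluing is unique.\<close>

lemma section_eqI:
  assumes U: "opn U" "s \<in> Sc U" "t \<in> Sc U" and eq: "\<And>x. x \<in> U \<Longrightarrow> germ X x U s = germ X x U t"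
  shows "s = t"
proof -
  have "\<exists>W. opn W \<and> x \<in> W \<and> W \<subseteq> U \<and> res X U W s = res X U W t" if x: "x \<in> U" for x
  proof -
    obtain W where "opn W" "x \<in> W" "W \<subseteq> U \<inter> U" "res X U W s = res X U W t"
      using germ_eqE[OF eq[OF x] U(1) x U(3)] .
    then show ?thesis by (intro exI[of _ W]) simp
  qed
  then obtain W where W: "\<And>x. x \<in> U \<Longrightarrow> opn (W x) \<and> x \<in> W x \<and> W x \<subseteq> U \<and> res X U (W x) s = res X U (W x) t"
    by metis
  have un: "(\<Union>x\<in>U. W x) = U" using W by blast
  have "\<exists>!r. r \<in> Sc (\<Union>x\<in>U. W x) \<and> (\<forall>x\<in>U. res X (\<Union>x\<in>U. W x) (W x) r = res X U (W x) s)"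
    using W U by (intro glue_unique_index) (auto simp: res_closed res_res openin_Int)
  moreover have "s \<in> Sc U \<and> (\<forall>x\<in>U. res X U (W x) s = res X U (W x) s)"
    and "t \<in> Sc U \<and> (\<forall>x\<in>U. res X U (W x) t = res X U (W x) s)" using W U by auto
  ultimately show ?thesis unfolding un by (elim ex1E) blast
qed

text \<open>Local sections with prescribed germs agree on overlaps by \<open>section_eqI\<close>, so
  they glue. The pullback of sections along a morphism to an affine scheme is constructed in this
  way from its values at the points.\<close>

lemma glue_germs:
  assumes U: "opn U"
    and loc: "\<And>x. x \<in> U \<Longrightarrow> \<exists>W s. opn W \<and> x \<in> W \<and> W \<subseteq> U \<and> s \<in> Sc W \<and> (\<forall>y\<in>W. germ X y W s = c y)"
  obtains t where "t \<in> Sc U" "\<And>x. x \<in> U \<Longrightarrow> germ X x U t = c x"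
proof -
  obtain W s where W: "\<And>x. x \<in> U \<Longrightarrow> opn (W x) \<and> x \<in> W x \<and> W x \<subseteq> U \<and> s x \<in> Sc (W x) \<and> (\<forall>y\<in>W x. germ X y (W x) (s x) = c y)"
    using loc by metis
  have un: "(\<Union>x\<in>U. W x) = U" using W by blast
  have "\<exists>!r. r \<in> Sc (\<Union>x\<in>U. W x) \<and> (\<forall>x\<in>U. res X (\<Union>x\<in>U. W x) (W x) r = s x)"
  proof (rule glue_unique_index)
    fix x y assume xy: "x \<in> U" "y \<in> U"
    then have o: "opn (W x)" "opn (W y)" "opn (W x \<inter> W y)" "s x \<in> Sc (W x)" "s y \<in> Sc (W y)"
      using W by auto
    show "res X (W x) (W x \<inter> W y) (s x) = res X (W y) (W x \<inter> W y) (s y)"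
    proof (rule section_eqI[OF o(3)])
      fix z assume "z \<in> W x \<inter> W y"
      then show "germ X z (W x \<inter> W y) (res X (W x) (W x \<inter> W y) (s x)) = germ X z (W x \<inter> W y) (res X (W y) (W x \<inter> W y) (s y))"
        using o W xy by (simp add: germ_res)
    qed (use o in \<open>auto intro: res_closed\<close>)
  qed (use W in auto)
  then obtain r where r: "r \<in> Sc U" "\<And>x. x \<in> U \<Longrightarrow> res X U (W x) r = s x" unfolding un by blast
  have "germ X x U r = c x" if "x \<in> U" for x
    using germ_res[of U "W x" x r] r W[OF that] U that by simp
  then show thesis using that r by blast
qed

end

section \<open>Localization\<close>

locale localization_ring = cring A for A (structure) +
  fixes S
  assumes S_carrier: "S \<subseteq> carrier A" and S_one: "\<one> \<in> S"
    and S_mult: "f \<in> S \<Longrightarrow> g \<in> S \<Longrightarrow> f \<otimes> g \<in> S"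
begin

abbreviation L where "L \<equiv> localization A S"
abbreviation fr where "fr a f \<equiv> fraction A S (a, f)"

lemma S_closed [simp]: "f \<in> S \<Longrightarrow> f \<in> carrier A"
  using S_carrier by blast

text \<open>Clearing the difference turns membership into an equation between products, which suits
  cancellation arguments.\<close>

lemma fraction_mem_iff:
  assumes "a \<in> carrier A" "f \<in> S"
  shows "(b, g) \<in> fr a f \<longleftrightarrow> b \<in> carrier A \<and> g \<in> S \<and> (\<exists>h\<in>S. h \<otimes> (a \<otimes> g) = h \<otimes> (b \<otimes> f))"
proof -
  have "h \<otimes> (a \<otimes> g \<ominus> b \<otimes> f) = \<zero> \<longleftrightarrow> h \<otimes> (a \<otimes> g) = h \<otimes> (b \<otimes> f)"
    if "h \<in> S" "b \<in> carrier A" "g \<in> S" for h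
  proof -
    have "h \<otimes> (a \<otimes> g \<ominus> b \<otimes> f) = h \<otimes> (a \<otimes> g) \<ominus> h \<otimes> (b \<otimes> f)"
      using that assms by (simp add: minus_eq r_distr r_minus)
    then show ?thesis using that assms by simp
  qed
  then show ?thesis unfolding fraction_def by auto
qed

lemma fraction_eqI:
  assumes [simp]: "a \<in> carrier A" "b \<in> carrier A" "f \<in> S" "g \<in> S" "h \<in> S"
    and eq: "h \<otimes> (a \<otimes> g) = h \<otimes> (b \<otimes> f)"
  shows "fr a f = fr b g"
proof -
  have sub: "fr a f \<subseteq> fr b g"
    if af [simp]: "a \<in> carrier A" "f \<in> S" and [simp]: "b \<in> carrier A" "g \<in> S" "h \<in> S"
      and eq: "h \<otimes> (a \<otimes> g) = h \<otimes> (b \<otimes> f)" for a b f g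
  proof
    fix p assume "p \<in> fr a f"
    then obtain c k h' where p: "p = (c, k)" and [simp]: "c \<in> carrier A" "k \<in> S" "h' \<in> S"
      and e: "h' \<otimes> (a \<otimes> k) = h' \<otimes> (c \<otimes> f)"
      using fraction_mem_iff[OF af] by (cases p) auto
    \<comment> \<open>Transitivity of the equality of fractions. Both given equations pass through
      \<open>a / f\<close>, so the multiplier needs the denominator \<open>f\<close> besides the two
      witnesses.\<close>
    have "(h \<otimes> h' \<otimes> f) \<otimes> (b \<otimes> k) = (h' \<otimes> k) \<otimes> (h \<otimes> (b \<otimes> f))" by (simp add: m_ac)
    also have "\<dots> = (h \<otimes> g) \<otimes> (h' \<otimes> (a \<otimes> k))" unfolding eq[symmetric] by (simp add: m_ac)
    also have "\<dots> = (h \<otimes> h' \<otimes> f) \<otimes> (c \<otimes> g)" unfolding e by (simp add: m_ac)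
    finally show "p \<in> fr b g" unfolding p by (subst fraction_mem_iff) (auto intro!: S_mult bexI[of _ "h \<otimes> h' \<otimes> f"])
  qed
  show ?thesis using sub[OF assms(1,3,2,4,5) eq] sub[OF assms(2,4,1,3,5) eq[symmetric]] by blast
qed

lemma fraction_self: "a \<in> carrier A \<Longrightarrow> f \<in> S \<Longrightarrow> (a, f) \<in> fr a f"
  by (subst fraction_mem_iff) (auto intro: S_one)

lemma fraction_memE:
  assumes "p \<in> fr a f" "a \<in> carrier A" "f \<in> S"
  obtains b g where "p = (b, g)" "b \<in> carrier A" "g \<in> S" "fr b g = fr a f"
proof -
  obtain b g h where *: "p = (b, g)" "b \<in> carrier A" "g \<in> S" "h \<in> S" "h \<otimes> (a \<otimes> g) = h \<otimes> (b \<otimes> f)"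
    using assms fraction_mem_iff[OF assms(2,3)] by (cases p) auto
  then show thesis using that fraction_eqI[of a b f g h] assms by metis
qed

lemma fraction_eqE:
  assumes "fr a f = fr b g" "a \<in> carrier A" "f \<in> S" "b \<in> carrier A" "g \<in> S"
  obtains h where "h \<in> S" "h \<otimes> (a \<otimes> g) = h \<otimes> (b \<otimes> f)"
  using fraction_self[OF assms(4,5)] unfolding assms(1)[symmetric] fraction_mem_iff[OF assms(2,3)] by blast

lemma fraction_scale: "h \<in> S \<Longrightarrow> a \<in> carrier A \<Longrightarrow> f \<in> S \<Longrightarrow> fr (h \<otimes> a) (h \<otimes> f) = fr a f"
  by (rule fraction_eqI[OF _ _ _ _ S_one]) (auto simp: m_ac intro: S_mult)

lemma L_cases:
  assumes "x \<in> carrier L" obtains a f where "a \<in> carrier A" "f \<in> S" "x = fr a f"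
  using assms unfolding localization_def by auto

lemma fraction_closed: "a \<in> carrier A \<Longrightarrow> f \<in> S \<Longrightarrow> fr a f \<in> carrier L"
  unfolding localization_def by auto

text \<open>The operations of \<open>localization\<close> are unions over all representatives. A
  class is nonempty, so a union of equal sets over it is that set.\<close>

lemma fraction_Union:
  assumes "a \<in> carrier A" "f \<in> S"
    and "\<And>b g. b \<in> carrier A \<Longrightarrow> g \<in> S \<Longrightarrow> fr b g = fr a f \<Longrightarrow> G b g = c"
  shows "(\<Union>(b, g)\<in>fr a f. G b g) = c"
proof -
  have "case_prod G p = c" if p: "p \<in> fr a f" for p
  proof -
    obtain b g where "p = (b, g)" "b \<in> carrier A" "g \<in> S" "fr b g = fr a f"
      using fraction_memE[OF p assms(1,2)] .
    then show ?thesis using assms(3) by simp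
  qed
  then show ?thesis using fraction_self[OF assms(1,2)] by fast
qed

lemma fraction_mult:
  assumes [simp]: "a \<in> carrier A" "f \<in> S" "b \<in> carrier A" "g \<in> S"
  shows "fr a f \<otimes>\<^bsub>L\<^esub> fr b g = fr (a \<otimes> b) (f \<otimes> g)"
proof -
  have "fr (a' \<otimes> b') (f' \<otimes> g') = fr (a \<otimes> b) (f \<otimes> g)"
    if [simp]: "a' \<in> carrier A" "f' \<in> S" "b' \<in> carrier A" "g' \<in> S" and e: "fr a' f' = fr a f" "fr b' g' = fr b g"
    for a' f' b' g'
  proof -
    obtain h where [simp]: "h \<in> S" and h: "h \<otimes> (a' \<otimes> f) = h \<otimes> (a \<otimes> f')"
      by (rule fraction_eqE[OF e(1)]) auto
    obtain k where [simp]: "k \<in> S" and k: "k \<otimes> (b' \<otimes> g) = k \<otimes> (b \<otimes> g')"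
      by (rule fraction_eqE[OF e(2)]) auto
    have "(h \<otimes> k) \<otimes> ((a' \<otimes> b') \<otimes> (f \<otimes> g)) = (h \<otimes> (a' \<otimes> f)) \<otimes> (k \<otimes> (b' \<otimes> g))" by (simp add: m_ac)
    also have "\<dots> = (h \<otimes> k) \<otimes> ((a \<otimes> b) \<otimes> (f' \<otimes> g'))" unfolding h k by (simp add: m_ac)
    finally show ?thesis by (intro fraction_eqI[of _ _ _ _ "h \<otimes> k"]) (auto intro: S_mult)
  qed
  then have "(\<Union>(a', f')\<in>fr a f. \<Union>(b', g')\<in>fr b g. fr (a' \<otimes> b') (f' \<otimes> g')) = fr (a \<otimes> b) (f \<otimes> g)"
    by (intro fraction_Union assms)
  then show ?thesis by (simp add: localization_def)
qed

lemma fraction_add: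
  assumes [simp]: "a \<in> carrier A" "f \<in> S" "b \<in> carrier A" "g \<in> S"
  shows "fr a f \<oplus>\<^bsub>L\<^esub> fr b g = fr (a \<otimes> g \<oplus> b \<otimes> f) (f \<otimes> g)"
proof -
  have "fr (a' \<otimes> g' \<oplus> b' \<otimes> f') (f' \<otimes> g') = fr (a \<otimes> g \<oplus> b \<otimes> f) (f \<otimes> g)"
    if [simp]: "a' \<in> carrier A" "f' \<in> S" "b' \<in> carrier A" "g' \<in> S" and e: "fr a' f' = fr a f" "fr b' g' = fr b g"
    for a' f' b' g'
  proof -
    obtain h where [simp]: "h \<in> S" and h: "h \<otimes> (a' \<otimes> f) = h \<otimes> (a \<otimes> f')"
      by (rule fraction_eqE[OF e(1)]) auto
    obtain k where [simp]: "k \<in> S" and k: "k \<otimes> (b' \<otimes> g) = k \<otimes> (b \<otimes> g')"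
      by (rule fraction_eqE[OF e(2)]) auto
    have "(h \<otimes> k) \<otimes> ((a' \<otimes> g' \<oplus> b' \<otimes> f') \<otimes> (f \<otimes> g))
        = (h \<otimes> (a' \<otimes> f)) \<otimes> (k \<otimes> g \<otimes> g') \<oplus> (k \<otimes> (b' \<otimes> g)) \<otimes> (h \<otimes> f \<otimes> f')" by (simp add: m_ac l_distr r_distr)
    also have "\<dots> = (h \<otimes> k) \<otimes> ((a \<otimes> g \<oplus> b \<otimes> f) \<otimes> (f' \<otimes> g'))" unfolding h k by (simp add: m_ac l_distr r_distr)
    finally show ?thesis by (intro fraction_eqI[of _ _ _ _ "h \<otimes> k"]) (auto intro: S_mult)
  qed
  then have "(\<Union>(a', f')\<in>fr a f. \<Union>(b', g')\<in>fr b g. fr (a' \<otimes> g' \<oplus> b' \<otimes> f') (f' \<otimes> g')) = fr (a \<otimes> g \<oplus> b \<otimes> f) (f \<otimes> g)"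
    by (intro fraction_Union assms)
  then show ?thesis by (simp add: localization_def)
qed

lemma fraction_one: "\<one>\<^bsub>L\<^esub> = fr \<one> \<one>" and fraction_zero: "\<zero>\<^bsub>L\<^esub> = fr \<zero> \<one>"
  by (simp_all add: localization_def)

lemma fraction_one_eq: "f \<in> S \<Longrightarrow> fr f f = \<one>\<^bsub>L\<^esub>"
  unfolding fraction_one using fraction_scale[of f \<one> \<one>] S_one by simp

lemma fraction_zero_eq: "f \<in> S \<Longrightarrow> fr \<zero> f = \<zero>\<^bsub>L\<^esub>"
  unfolding fraction_zero using fraction_scale[of f \<zero> \<one>] S_one by simp

lemma fraction_add_same:
  assumes [simp]: "a \<in> carrier A" "b \<in> carrier A" "f \<in> S" shows "fr a f \<oplus>\<^bsub>L\<^esub> fr b f = fr (a \<oplus> b) f"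
proof -
  have "fr a f \<oplus>\<^bsub>L\<^esub> fr b f = fr (f \<otimes> (a \<oplus> b)) (f \<otimes> f)"
    by (simp add: fraction_add r_distr m_comm)
  then show ?thesis by (simp add: fraction_scale)
qed

lemma localization_cring: "cring L"
proof (rule cringI)
  show "abelian_group L"
  proof (rule abelian_groupI)
    fix x y assume "x \<in> carrier L" "y \<in> carrier L"
    then obtain a f b g where [simp]: "a \<in> carrier A" "f \<in> S" "x = fr a f" "b \<in> carrier A" "g \<in> S" "y = fr b g"
      by (elim L_cases)
    show "x \<oplus>\<^bsub>L\<^esub> y \<in> carrier L" by (simp add: fraction_add fraction_closed S_mult)
    show "x \<oplus>\<^bsub>L\<^esub> y = y \<oplus>\<^bsub>L\<^esub> x" by (simp add: fraction_add m_comm a_comm)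
    show "\<zero>\<^bsub>L\<^esub> \<oplus>\<^bsub>L\<^esub> x = x" by (simp add: fraction_zero fraction_add S_one)
    have "fr (\<ominus> a) f \<oplus>\<^bsub>L\<^esub> x = \<zero>\<^bsub>L\<^esub>" by (simp add: fraction_add_same l_neg fraction_zero_eq)
    then show "\<exists>y\<in>carrier L. y \<oplus>\<^bsub>L\<^esub> x = \<zero>\<^bsub>L\<^esub>" by (intro bexI[of _ "fr (\<ominus> a) f"]) (simp_all add: fraction_closed)
    fix z assume "z \<in> carrier L"
    then obtain c h where [simp]: "c \<in> carrier A" "h \<in> S" "z = fr c h" by (elim L_cases)
    show "x \<oplus>\<^bsub>L\<^esub> y \<oplus>\<^bsub>L\<^esub> z = x \<oplus>\<^bsub>L\<^esub> (y \<oplus>\<^bsub>L\<^esub> z)"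
      by (simp add: fraction_add S_mult l_distr r_distr m_ac a_ac)
  qed (simp add: fraction_zero fraction_closed S_one)
  show "comm_monoid L"
  proof (rule comm_monoidI)
    fix x y assume "x \<in> carrier L" "y \<in> carrier L"
    then obtain a f b g where [simp]: "a \<in> carrier A" "f \<in> S" "x = fr a f" "b \<in> carrier A" "g \<in> S" "y = fr b g"
      by (elim L_cases)
    show "x \<otimes>\<^bsub>L\<^esub> y \<in> carrier L" by (simp add: fraction_mult fraction_closed S_mult)
    show "x \<otimes>\<^bsub>L\<^esub> y = y \<otimes>\<^bsub>L\<^esub> x" by (simp add: fraction_mult m_comm)
    show "\<one>\<^bsub>L\<^esub> \<otimes>\<^bsub>L\<^esub> x = x" by (simp add: fraction_one fraction_mult S_one)
    fix z assume "z \<in> carrier L"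
    then obtain c h where [simp]: "c \<in> carrier A" "h \<in> S" "z = fr c h" by (elim L_cases)
    show "x \<otimes>\<^bsub>L\<^esub> y \<otimes>\<^bsub>L\<^esub> z = x \<otimes>\<^bsub>L\<^esub> (y \<otimes>\<^bsub>L\<^esub> z)" by (simp add: fraction_mult S_mult m_ac)
  qed (simp add: fraction_one fraction_closed S_one)
  fix x y z assume "x \<in> carrier L" "y \<in> carrier L" "z \<in> carrier L"
  then obtain a f b g c h where [simp]: "a \<in> carrier A" "f \<in> S" "x = fr a f" "b \<in> carrier A" "g \<in> S" "y = fr b g"
      "c \<in> carrier A" "h \<in> S" "z = fr c h" by (elim L_cases)
  \<comment> \<open>Adding the two products yields one factor \<open>h\<close> too many in numerator
    and denominator. The fraction is written as a multiple by \<open>h\<close> so that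
    \<open>fraction_scale\<close> removes it.\<close>
  have "x \<otimes>\<^bsub>L\<^esub> z \<oplus>\<^bsub>L\<^esub> y \<otimes>\<^bsub>L\<^esub> z = fr (h \<otimes> ((a \<otimes> g \<oplus> b \<otimes> f) \<otimes> c)) (h \<otimes> (f \<otimes> g \<otimes> h))"
    by (simp add: fraction_add fraction_mult S_mult l_distr r_distr m_ac)
  then show "(x \<oplus>\<^bsub>L\<^esub> y) \<otimes>\<^bsub>L\<^esub> z = x \<otimes>\<^bsub>L\<^esub> z \<oplus>\<^bsub>L\<^esub> y \<otimes>\<^bsub>L\<^esub> z"
    by (simp add: fraction_add fraction_mult fraction_scale S_mult)
qed

end

lemma localization_at_prime:
  assumes "primeideal p A" shows "localization_ring A (carrier A - p)"
proof -
  interpret primeideal p A by fact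
  show ?thesis
    by unfold_locales (use I_notcarr one_imp_carrier I_prime in auto)
qed

text \<open>The inverse of \<open>a / f\<close> is \<open>f / a\<close>. Conversely, an inverse
  \<open>b / g\<close> gives some \<open>h\<close> outside \<open>p\<close> with
  \<open>h a b = h f g\<close>, and the right side avoids \<open>p\<close> because \<open>p\<close>
  is prime. So the nonunits are the fractions with numerator in \<open>p\<close>.\<close>

lemma (in cring) stalk_ring_Units_iff:
  assumes p: "primeideal p R" and [simp]: "a \<in> carrier R" and f: "f \<in> carrier R" "f \<notin> p"
  shows "fraction R (carrier R - p) (a, f) \<in> Units (stalk_ring R p) \<longleftrightarrow> a \<notin> p"
proof -
  interpret P: primeideal p R by fact
  interpret localization_ring R "carrier R - p" by (rule localization_at_prime[OF p])
  interpret L: cring L by (rule localization_cring)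
  show ?thesis
  proof
    assume "a \<notin> p"
    then have "fr a f \<otimes>\<^bsub>L\<^esub> fr f a = \<one>\<^bsub>L\<^esub>"
      using f S_mult[of f a] by (simp add: fraction_mult m_comm fraction_one_eq)
    moreover have "fr a f \<in> carrier L" "fr f a \<in> carrier L" using f \<open>a \<notin> p\<close> by (auto intro!: fraction_closed)
    ultimately show "fr a f \<in> Units L" unfolding Units_def using L.m_comm by force
  next
    assume u: "fr a f \<in> Units L"
    have i: "fr a f \<otimes>\<^bsub>L\<^esub> inv\<^bsub>L\<^esub> fr a f = \<one>\<^bsub>L\<^esub>" "inv\<^bsub>L\<^esub> fr a f \<in> carrier L"
      using L.Units_r_inv[OF u] L.Units_inv_closed[OF u] by blast+
    obtain b g where bg: "b \<in> carrier R" "g \<in> carrier R - p" "inv\<^bsub>L\<^esub> fr a f = fr b g" using L_cases[OF i(2)] .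
    have g: "b \<in> carrier R" "g \<in> carrier R - p" "fr a f \<otimes>\<^bsub>L\<^esub> fr b g = fr \<one> \<one>"
      using bg i(1) fraction_one by simp_all
    then have "fr (a \<otimes> b) (f \<otimes> g) = fr \<one> \<one>" using f by (simp add: fraction_mult)
    then obtain h where h: "h \<in> carrier R - p" "h \<otimes> (a \<otimes> b \<otimes> \<one>) = h \<otimes> (\<one> \<otimes> (f \<otimes> g))"
      by (rule fraction_eqE) (use f g S_mult[of f g] S_one in auto)
    have hfg: "h \<otimes> (f \<otimes> g) \<in> carrier R - p" using h f g by (intro S_mult) auto
    have "h \<otimes> (a \<otimes> b) = h \<otimes> (f \<otimes> g)" using h(2) f g by simp
    then have n: "h \<otimes> (a \<otimes> b) \<notin> p" using hfg by simp
    show "a \<notin> p"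
    proof
      assume "a \<in> p"
      then have "a \<otimes> b \<in> p" using g(1) by (rule P.I_r_closed)
      then have "h \<otimes> (a \<otimes> b) \<in> p" using P.I_l_closed[of "a \<otimes> b" h] h(1) by simp
      with n show False by contradiction
    qed
  qed
qed

section \<open>Affine schemes\<close>

context cring
begin

lemma prime_not_one: "primeideal p R \<Longrightarrow> \<one> \<notin> p"
  using primeideal.I_notcarr ideal.one_imp_carrier primeideal.axioms(1) by metis

text \<open>Intersections rest on primality: some product of generators avoids \<open>p\<close>
  exactly if a generator from each of the two sets does. Unions of open sets come from unions of the
  generating sets.\<close>

lemma istopology_zariski: "istopology (\<lambda>U. \<exists>I \<subseteq> carrier R. U = {p. primeideal p R \<and> \<not> I \<subseteq> p})"
  unfolding istopology_def
proof (intro conjI allI impI)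
  fix U V
  assume "\<exists>I \<subseteq> carrier R. U = {p. primeideal p R \<and> \<not> I \<subseteq> p}"
    and "\<exists>I \<subseteq> carrier R. V = {p. primeideal p R \<and> \<not> I \<subseteq> p}"
  then obtain I J where I: "I \<subseteq> carrier R" "U = {p. primeideal p R \<and> \<not> I \<subseteq> p}"
    and J: "J \<subseteq> carrier R" "V = {p. primeideal p R \<and> \<not> J \<subseteq> p}" by blast
  let ?K = "{a \<otimes> b | a b. a \<in> I \<and> b \<in> J}"
  have "\<not> ?K \<subseteq> p \<longleftrightarrow> \<not> I \<subseteq> p \<and> \<not> J \<subseteq> p" if p: "primeideal p R" for p
  proof -
    interpret P: primeideal p R by fact
    have *: "a \<otimes> b \<notin> p \<longleftrightarrow> a \<notin> p \<and> b \<notin> p" if "a \<in> I" "b \<in> J" for a b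
    proof -
      have c: "a \<in> carrier R" "b \<in> carrier R" using that I(1) J(1) by auto
      show ?thesis using P.I_prime[OF c] P.I_l_closed[OF _ c(1)] P.I_r_closed[OF _ c(2)] by blast
    qed
    have "\<not> ?K \<subseteq> p \<longleftrightarrow> (\<exists>a\<in>I. \<exists>b\<in>J. a \<otimes> b \<notin> p)" by blast
    also have "\<dots> \<longleftrightarrow> (\<exists>a\<in>I. \<exists>b\<in>J. a \<notin> p \<and> b \<notin> p)" using * by simp
    also have "\<dots> \<longleftrightarrow> \<not> I \<subseteq> p \<and> \<not> J \<subseteq> p" by blast
    finally show ?thesis .
  qed
  then have "U \<inter> V = {p. primeideal p R \<and> \<not> ?K \<subseteq> p}" unfolding I J by blast
  moreover have "?K \<subseteq> carrier R" using I J by auto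
  ultimately show "\<exists>I \<subseteq> carrier R. U \<inter> V = {p. primeideal p R \<and> \<not> I \<subseteq> p}" by blast
next
  fix \<K> assume "\<forall>U\<in>\<K>. \<exists>I \<subseteq> carrier R. U = {p. primeideal p R \<and> \<not> I \<subseteq> p}"
  then obtain I where I: "\<And>U. U \<in> \<K> \<Longrightarrow> I U \<subseteq> carrier R \<and> U = {p. primeideal p R \<and> \<not> I U \<subseteq> p}" by metis
  have "p \<in> \<Union>\<K> \<longleftrightarrow> primeideal p R \<and> \<not> (\<Union>U\<in>\<K>. I U) \<subseteq> p" for p
  proof -
    have "p \<in> U \<longleftrightarrow> primeideal p R \<and> \<not> I U \<subseteq> p" if "U \<in> \<K>" for U using I[OF that] by blast
    then show ?thesis by blast
  qed
  then have "\<Union>\<K> = {p. primeideal p R \<and> \<not> (\<Union>U\<in>\<K>. I U) \<subseteq> p}" by (intro Set.set_eqI) simp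
  moreover have "(\<Union>U\<in>\<K>. I U) \<subseteq> carrier R" using I by blast
  ultimately show "\<exists>J \<subseteq> carrier R. \<Union>\<K> = {p. primeideal p R \<and> \<not> J \<subseteq> p}" by blast
qed

lemma openin_zariski: "openin (zariski R) U \<longleftrightarrow> (\<exists>I \<subseteq> carrier R. U = {p. primeideal p R \<and> \<not> I \<subseteq> p})"
  unfolding zariski_def by (subst topology_inverse'[OF istopology_zariski]) simp

lemma topspace_zariski: "topspace (zariski R) = {p. primeideal p R}"
proof (rule antisym)
  show "topspace (zariski R) \<subseteq> {p. primeideal p R}"
    using openin_zariski[of "topspace (zariski R)"] by auto
  have "{p. primeideal p R} = {p. primeideal p R \<and> \<not> {\<one>} \<subseteq> p}" using prime_not_one by auto
  then have "openin (zariski R) {p. primeideal p R}" unfolding openin_zariski by blast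
  then show "{p. primeideal p R} \<subseteq> topspace (zariski R)" by (rule openin_subset)
qed

lemma open_prime: "openin (zariski R) U \<Longrightarrow> p \<in> U \<Longrightarrow> primeideal p R"
  using openin_subset topspace_zariski by blast

lemma open_one_notin: "openin (zariski R) U \<Longrightarrow> p \<in> U \<Longrightarrow> \<one> \<notin> p"
  by (rule prime_not_one[OF open_prime])

lemma openin_basic: "f \<in> carrier R \<Longrightarrow> openin (zariski R) {p. primeideal p R \<and> f \<notin> p}"
  unfolding openin_zariski by (intro exI[of _ "{f}"]) auto

lemma openin_zariski_basic:
  assumes "openin (zariski R) U" "p \<in> U"
  obtains f where "f \<in> carrier R" "f \<notin> p" "{q. primeideal q R \<and> f \<notin> q} \<subseteq> U"
  using assms unfolding openin_zariski by blast

lemma sec_Spec: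
  "carrier (sec (Spec R) U) = spec_sections R U"
  "s \<otimes>\<^bsub>sec (Spec R) U\<^esub> t = (\<lambda>p\<in>U. s p \<otimes>\<^bsub>stalk_ring R p\<^esub> t p)"
  "s \<oplus>\<^bsub>sec (Spec R) U\<^esub> t = (\<lambda>p\<in>U. s p \<oplus>\<^bsub>stalk_ring R p\<^esub> t p)"
  "\<one>\<^bsub>sec (Spec R) U\<^esub> = (\<lambda>p\<in>U. \<one>\<^bsub>stalk_ring R p\<^esub>)"
  "\<zero>\<^bsub>sec (Spec R) U\<^esub> = (\<lambda>p\<in>U. \<zero>\<^bsub>stalk_ring R p\<^esub>)"
  "res (Spec R) U V s = restrict s V"
  "pts (Spec R) = zariski R"
  by (simp_all add: Spec_def)

abbreviation frp where "frp p a f \<equiv> fraction R (carrier R - p) (a, f)"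

lemma spec_sectionsI:
  assumes "openin (zariski R) U" "s \<in> extensional U"
    and "\<And>p. p \<in> U \<Longrightarrow> \<exists>V a f. openin (zariski R) V \<and> p \<in> V \<and> V \<subseteq> U \<and> a \<in> carrier R \<and> f \<in> carrier R \<and>
       (\<forall>q\<in>V. f \<notin> q \<and> s q = frp q a f)"
  shows "s \<in> spec_sections R U"
proof -
  have "s p \<in> carrier (stalk_ring R p)" if "p \<in> U" for p
  proof -
    interpret localization_ring R "carrier R - p"
      by (rule localization_at_prime[OF open_prime[OF assms(1) that]])
    show ?thesis using assms(3)[OF that] by (auto intro!: fraction_closed)
  qed
  then show ?thesis unfolding spec_sections_def using assms(2,3) by (simp add: PiE_def Pi_iff)
qed

lemma spec_sectionsE:
  assumes "s \<in> spec_sections R U" "p \<in> U"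
  obtains V a f where "openin (zariski R) V" "p \<in> V" "V \<subseteq> U" "a \<in> carrier R" "f \<in> carrier R"
    "\<And>q. q \<in> V \<Longrightarrow> f \<notin> q" "\<And>q. q \<in> V \<Longrightarrow> s q = frp q a f"
proof -
  have "\<exists>V a f. openin (zariski R) V \<and> p \<in> V \<and> V \<subseteq> U \<and> a \<in> carrier R \<and> f \<in> carrier R \<and>
       (\<forall>q\<in>V. f \<notin> q \<and> s q = frp q a f)"
    using assms by (simp add: spec_sections_def)
  then obtain V a f where *: "openin (zariski R) V" "p \<in> V" "V \<subseteq> U" "a \<in> carrier R" "f \<in> carrier R"
    "\<forall>q\<in>V. f \<notin> q \<and> s q = frp q a f" by (elim exE conjE)
  show thesis by (rule that[OF *(1-5)]) (use *(6) in auto)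
qed

lemma spec_sections_ext: "s \<in> spec_sections R U \<Longrightarrow> s \<in> extensional U"
  unfolding spec_sections_def by (auto simp: PiE_def)

lemma spec_sections_closed: "s \<in> spec_sections R U \<Longrightarrow> p \<in> U \<Longrightarrow> s p \<in> carrier (stalk_ring R p)"
  unfolding spec_sections_def by (auto simp: PiE_def)

definition fsec where "fsec U a f = (\<lambda>p\<in>U. frp p a f)"

lemma fsec_in:
  assumes "openin (zariski R) U" "a \<in> carrier R" "f \<in> carrier R" "\<And>p. p \<in> U \<Longrightarrow> f \<notin> p"
  shows "fsec U a f \<in> spec_sections R U"
  by (rule spec_sectionsI[OF assms(1)]) (use assms in \<open>auto simp: fsec_def\<close>)

text \<open>Sum and product are treated together. Near each point both sections are single
  fractions, and \<open>op\<close> combines them to one with numerator \<open>num a f b g\<close>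
  and denominator \<open>f \<otimes> g\<close>.\<close>

lemma spec_sections_op:
  assumes U: "openin (zariski R) U" and s: "s \<in> spec_sections R U" and t: "t \<in> spec_sections R U"
    and op: "\<And>p a f b g. p \<in> U \<Longrightarrow> a \<in> carrier R \<Longrightarrow> b \<in> carrier R \<Longrightarrow> f \<in> carrier R - p \<Longrightarrow> g \<in> carrier R - p \<Longrightarrow>
       op p (frp p a f) (frp p b g) = frp p (num a f b g) (f \<otimes> g)"
    and num: "\<And>a f b g. a \<in> carrier R \<Longrightarrow> b \<in> carrier R \<Longrightarrow> f \<in> carrier R \<Longrightarrow> g \<in> carrier R \<Longrightarrow> num a f b g \<in> carrier R"
  shows "(\<lambda>p\<in>U. op p (s p) (t p)) \<in> spec_sections R U"
proof (rule spec_sectionsI[OF U])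
  fix p assume p: "p \<in> U"
  obtain V a f where V: "openin (zariski R) V" "p \<in> V" "V \<subseteq> U" "a \<in> carrier R" "f \<in> carrier R"
    "\<And>q. q \<in> V \<Longrightarrow> f \<notin> q" "\<And>q. q \<in> V \<Longrightarrow> s q = frp q a f" by (rule spec_sectionsE[OF s p]) blast
  obtain W b g where W: "openin (zariski R) W" "p \<in> W" "W \<subseteq> U" "b \<in> carrier R" "g \<in> carrier R"
    "\<And>q. q \<in> W \<Longrightarrow> g \<notin> q" "\<And>q. q \<in> W \<Longrightarrow> t q = frp q b g" by (rule spec_sectionsE[OF t p]) blast
  have "f \<otimes> g \<notin> q \<and> (\<lambda>p\<in>U. op p (s p) (t p)) q = frp q (num a f b g) (f \<otimes> g)" if q: "q \<in> V \<inter> W" for q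
  proof -
    have "primeideal q R" using q V open_prime by blast
    then have "f \<otimes> g \<notin> q" using primeideal.I_prime[OF _ V(5) W(5)] q V(6) W(6) by blast
    moreover have "op q (s q) (t q) = frp q (num a f b g) (f \<otimes> g)"
      using op[of q a b f g] q V(3-7) W(4-7) by auto
    ultimately show ?thesis using q V(3) by auto
  qed
  then show "\<exists>V a f. openin (zariski R) V \<and> p \<in> V \<and> V \<subseteq> U \<and> a \<in> carrier R \<and> f \<in> carrier R \<and>
       (\<forall>q\<in>V. f \<notin> q \<and> (\<lambda>p\<in>U. op p (s p) (t p)) q = frp q a f)"
    using V(1-3) W(1-3) m_closed[OF V(5) W(5)] num[OF V(4) W(4) V(5) W(5)]
    by (intro exI[of _ "V \<inter> W"] exI[of _ "num a f b g"] exI[of _ "f \<otimes> g"] conjI ballI) (auto simp del: restrict_apply)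
qed auto

lemma spec_mult_closed:
  assumes U: "openin (zariski R) U" and s: "s \<in> spec_sections R U" and t: "t \<in> spec_sections R U"
  shows "(\<lambda>p\<in>U. s p \<otimes>\<^bsub>stalk_ring R p\<^esub> t p) \<in> spec_sections R U"
  by (rule spec_sections_op[OF assms, where num = "\<lambda>a f b g. a \<otimes> b"])
    (simp_all add: localization_ring.fraction_mult[OF localization_at_prime[OF open_prime[OF U]]])

lemma spec_add_closed:
  assumes U: "openin (zariski R) U" and s: "s \<in> spec_sections R U" and t: "t \<in> spec_sections R U"
  shows "(\<lambda>p\<in>U. s p \<oplus>\<^bsub>stalk_ring R p\<^esub> t p) \<in> spec_sections R U"
  by (rule spec_sections_op[OF assms, where num = "\<lambda>a f b g. a \<otimes> g \<oplus> b \<otimes> f"])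
    (simp_all add: localization_ring.fraction_add[OF localization_at_prime[OF open_prime[OF U]]])

lemma fsec_one: "openin (zariski R) U \<Longrightarrow> fsec U \<one> \<one> = \<one>\<^bsub>sec (Spec R) U\<^esub>"
  and fsec_zero: "openin (zariski R) U \<Longrightarrow> fsec U \<zero> \<one> = \<zero>\<^bsub>sec (Spec R) U\<^esub>"
  by (auto simp: sec_Spec fsec_def localization_def)

lemma spec_one_closed: "openin (zariski R) U \<Longrightarrow> \<one>\<^bsub>sec (Spec R) U\<^esub> \<in> spec_sections R U"
  and spec_zero_closed: "openin (zariski R) U \<Longrightarrow> \<zero>\<^bsub>sec (Spec R) U\<^esub> \<in> spec_sections R U"
  by (auto simp flip: fsec_one fsec_zero intro!: fsec_in dest: open_one_notin)

text \<open>All identities hold pointwise in the localizations; what is specific to sections is that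
  the results are again locally single fractions.\<close>

lemma sec_Spec_cring:
  assumes U: "openin (zariski R) U" shows "cring (sec (Spec R) U)"
proof -
  have L: "cring (stalk_ring R p)" if "p \<in> U" for p
    using localization_ring.localization_cring[OF localization_at_prime[OF open_prime[OF U that]]] .
  note c = spec_sections_closed
  show ?thesis
  proof (rule cringI)
    show "abelian_group (sec (Spec R) U)"
    proof (rule abelian_groupI, unfold sec_Spec(1))
      fix s assume s: "s \<in> spec_sections R U"
      \<comment> \<open>The negative of \<open>s\<close> is taken as its product with the section
        \<open>-1\<close>, so that closure under products shows it to be a section.\<close>
      let ?m = "fsec U (\<ominus> \<one>) \<one>"
      have m: "?m \<in> spec_sections R U" using U by (auto intro!: fsec_in dest: open_one_notin)
      have "(?m p \<otimes>\<^bsub>stalk_ring R p\<^esub> s p) \<oplus>\<^bsub>stalk_ring R p\<^esub> s p = \<zero>\<^bsub>stalk_ring R p\<^esub>" if p: "p \<in> U" for p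
      proof -
        interpret localization_ring R "carrier R - p" by (rule localization_at_prime[OF open_prime[OF U p]])
        interpret L: cring L by (rule L[OF p])
        have "?m p \<oplus>\<^bsub>L\<^esub> \<one>\<^bsub>L\<^esub> = \<zero>\<^bsub>L\<^esub>" using p S_one
          by (simp add: fsec_def fraction_one fraction_add_same l_neg fraction_zero)
        then have "(?m p \<oplus>\<^bsub>L\<^esub> \<one>\<^bsub>L\<^esub>) \<otimes>\<^bsub>L\<^esub> s p = \<zero>\<^bsub>L\<^esub>" using c[OF s p] by simp
        then show ?thesis using c[OF s p] c[OF m p] by (simp add: L.l_distr)
      qed
      then have "(\<lambda>p\<in>U. ?m p \<otimes>\<^bsub>stalk_ring R p\<^esub> s p) \<oplus>\<^bsub>sec (Spec R) U\<^esub> s = \<zero>\<^bsub>sec (Spec R) U\<^esub>"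
        by (auto simp: sec_Spec intro!: restrict_ext)
      then show "\<exists>y\<in>spec_sections R U. y \<oplus>\<^bsub>sec (Spec R) U\<^esub> s = \<zero>\<^bsub>sec (Spec R) U\<^esub>"
        using spec_mult_closed[OF U m s] by blast
      show "\<zero>\<^bsub>sec (Spec R) U\<^esub> \<oplus>\<^bsub>sec (Spec R) U\<^esub> s = s"
        using spec_sections_ext[OF s] cring.cring_simprules(8)[OF L c[OF s]]
        by (intro extensionalityI[of _ U]) (auto simp: sec_Spec)
      fix t assume t: "t \<in> spec_sections R U"
      show "s \<oplus>\<^bsub>sec (Spec R) U\<^esub> t \<in> spec_sections R U" using spec_add_closed[OF U s t] by (simp add: sec_Spec)
      show "s \<oplus>\<^bsub>sec (Spec R) U\<^esub> t = t \<oplus>\<^bsub>sec (Spec R) U\<^esub> s"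
        using cring.cring_simprules(10)[OF L c[OF s] c[OF t]] by (auto simp: sec_Spec intro!: restrict_ext)
      fix r assume r: "r \<in> spec_sections R U"
      show "s \<oplus>\<^bsub>sec (Spec R) U\<^esub> t \<oplus>\<^bsub>sec (Spec R) U\<^esub> r = s \<oplus>\<^bsub>sec (Spec R) U\<^esub> (t \<oplus>\<^bsub>sec (Spec R) U\<^esub> r)"
        using cring.cring_simprules(7)[OF L c[OF s] c[OF t] c[OF r]] by (auto simp: sec_Spec intro!: restrict_ext)
    qed (rule spec_zero_closed[OF U])
    show "comm_monoid (sec (Spec R) U)"
    proof (rule comm_monoidI, unfold sec_Spec(1))
      fix s assume s: "s \<in> spec_sections R U"
      show "\<one>\<^bsub>sec (Spec R) U\<^esub> \<otimes>\<^bsub>sec (Spec R) U\<^esub> s = s"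
        using spec_sections_ext[OF s] cring.cring_simprules(12)[OF L c[OF s]]
        by (intro extensionalityI[of _ U]) (auto simp: sec_Spec)
      fix t assume t: "t \<in> spec_sections R U"
      show "s \<otimes>\<^bsub>sec (Spec R) U\<^esub> t \<in> spec_sections R U" using spec_mult_closed[OF U s t] by (simp add: sec_Spec)
      show "s \<otimes>\<^bsub>sec (Spec R) U\<^esub> t = t \<otimes>\<^bsub>sec (Spec R) U\<^esub> s"
        using cring.cring_simprules(14)[OF L c[OF s] c[OF t]] by (auto simp: sec_Spec intro!: restrict_ext)
      fix r assume r: "r \<in> spec_sections R U"
      show "s \<otimes>\<^bsub>sec (Spec R) U\<^esub> t \<otimes>\<^bsub>sec (Spec R) U\<^esub> r = s \<otimes>\<^bsub>sec (Spec R) U\<^esub> (t \<otimes>\<^bsub>sec (Spec R) U\<^esub> r)"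
        using cring.cring_simprules(11)[OF L c[OF s] c[OF t] c[OF r]] by (auto simp: sec_Spec intro!: restrict_ext)
    qed (rule spec_one_closed[OF U])
    fix s t r assume "s \<in> carrier (sec (Spec R) U)" "t \<in> carrier (sec (Spec R) U)" "r \<in> carrier (sec (Spec R) U)"
    then have s: "s \<in> spec_sections R U" and t: "t \<in> spec_sections R U" and r: "r \<in> spec_sections R U"
      by (simp_all add: sec_Spec)
    show "(s \<oplus>\<^bsub>sec (Spec R) U\<^esub> t) \<otimes>\<^bsub>sec (Spec R) U\<^esub> r =
        s \<otimes>\<^bsub>sec (Spec R) U\<^esub> r \<oplus>\<^bsub>sec (Spec R) U\<^esub> t \<otimes>\<^bsub>sec (Spec R) U\<^esub> r"
      using cring.cring_simprules(13)[OF L c[OF s] c[OF t] c[OF r]] by (auto simp: sec_Spec intro!: restrict_ext)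
  qed
qed

lemma restrict_spec_section:
  assumes U: "openin (zariski R) U" and V: "openin (zariski R) V" "V \<subseteq> U" and s: "s \<in> spec_sections R U"
  shows "restrict s V \<in> spec_sections R V"
proof (rule spec_sectionsI[OF V(1)])
  fix p assume p: "p \<in> V"
  then obtain W a f where W: "openin (zariski R) W" "p \<in> W" "W \<subseteq> U" "a \<in> carrier R" "f \<in> carrier R"
    "\<And>q. q \<in> W \<Longrightarrow> f \<notin> q" "\<And>q. q \<in> W \<Longrightarrow> s q = frp q a f" using spec_sectionsE[OF s] V by blast
  then show "\<exists>W a f. openin (zariski R) W \<and> p \<in> W \<and> W \<subseteq> V \<and> a \<in> carrier R \<and> f \<in> carrier R \<and>
       (\<forall>q\<in>W. f \<notin> q \<and> restrict s V q = frp q a f)"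
    using p V by (intro exI[of _ "W \<inter> V"] exI[of _ a] exI[of _ f]) auto
qed auto

lemma ring_presheaf_Spec: "ring_presheaf (Spec R)"
proof
  show "presheaf_of_rings (Spec R)"
    unfolding presheaf_of_rings_def sec_Spec(7)
  proof (intro conjI allI impI ballI)
    fix U V assume "openin (zariski R) U \<and> openin (zariski R) V \<and> V \<subseteq> U"
    then have U: "openin (zariski R) U" and V: "openin (zariski R) V" "V \<subseteq> U" by auto
    show "res (Spec R) U V \<in> ring_hom (sec (Spec R) U) (sec (Spec R) V)"
      using V(2) restrict_spec_section[OF U V]
      by (intro ring_hom_memI) (auto simp: sec_Spec Int_absorb1 intro!: restrict_ext)
  next
    fix U s assume "s \<in> carrier (sec (Spec R) U)"
    then show "res (Spec R) U U s = s" using spec_sections_ext[of s U] by (simp add: sec_Spec extensional_restrict)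
  next
    fix U V W s assume "openin (zariski R) U \<and> openin (zariski R) V \<and> openin (zariski R) W \<and> W \<subseteq> V \<and> V \<subseteq> U"
    then show "res (Spec R) V W (res (Spec R) U V s) = res (Spec R) U W s" by (auto simp: sec_Spec Int_absorb1)
  qed (auto intro: sec_Spec_cring)
qed

text \<open>Stalk and localization are compared only as to which elements are invertible, since
  local stalks and local morphisms depend on nothing else. If \<open>s\<close> is
  \<open>a / f\<close> near \<open>p\<close> with \<open>a\<close> outside \<open>p\<close>, then
  \<open>f / a\<close> inverts it on the open set where \<open>a\<close> does not vanish.\<close>

lemma Spec_germ_Units_iff:
  assumes U: "openin (zariski R) U" "p \<in> U" and s: "s \<in> spec_sections R U"
  shows "germ (Spec R) p U s \<in> Units (stalk (Spec R) p) \<longleftrightarrow> s p \<in> Units (stalk_ring R p)"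
proof -
  interpret S: ring_presheaf "Spec R" by (rule ring_presheaf_Spec)
  have p: "primeideal p R" using U open_prime by blast
  interpret L: cring "stalk_ring R p"
    by (rule localization_ring.localization_cring[OF localization_at_prime[OF p]])
  note iff = S.germ_Units_iff[of U p s, unfolded sec_Spec(1,7), OF U s]
  show ?thesis
  proof
    assume "germ (Spec R) p U s \<in> Units (stalk (Spec R) p)"
    then obtain W t where W: "openin (zariski R) W" "p \<in> W" "W \<subseteq> U" "t \<in> spec_sections R W"
      "res (Spec R) U W s \<otimes>\<^bsub>sec (Spec R) W\<^esub> t = \<one>\<^bsub>sec (Spec R) W\<^esub>"
      unfolding iff by blast
    from fun_cong[OF W(5), of p] have "s p \<otimes>\<^bsub>stalk_ring R p\<^esub> t p = \<one>\<^bsub>stalk_ring R p\<^esub>"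
      using W by (simp add: sec_Spec)
    moreover have "s p \<in> carrier (stalk_ring R p)" "t p \<in> carrier (stalk_ring R p)"
      using spec_sections_closed s U W by auto
    ultimately show "s p \<in> Units (stalk_ring R p)"
      unfolding Units_def using L.m_comm by fastforce
  next
    assume u: "s p \<in> Units (stalk_ring R p)"
    obtain V a f where V: "openin (zariski R) V" "p \<in> V" "V \<subseteq> U" "a \<in> carrier R" "f \<in> carrier R"
      "\<And>q. q \<in> V \<Longrightarrow> f \<notin> q" "\<And>q. q \<in> V \<Longrightarrow> s q = frp q a f" by (rule spec_sectionsE[OF s U(2)]) blast
    have "a \<notin> p" using u V stalk_ring_Units_iff[OF p V(4,5)] by auto
    let ?W = "V \<inter> {p. primeideal p R \<and> a \<notin> p}"
    have W: "openin (zariski R) ?W" "p \<in> ?W" using V openin_basic \<open>a \<notin> p\<close> p by auto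
    have t: "fsec ?W f a \<in> spec_sections R ?W" using W V by (intro fsec_in) auto
    have "s q \<otimes>\<^bsub>stalk_ring R q\<^esub> frp q f a = \<one>\<^bsub>stalk_ring R q\<^esub>" if q: "q \<in> ?W" for q
    proof -
      interpret localization_ring R "carrier R - q" using q localization_at_prime by blast
      have "a \<otimes> f \<in> carrier R - q" using q V by (intro S_mult) auto
      then show ?thesis using q V fraction_one_eq[of "a \<otimes> f"] by (simp add: fraction_mult m_comm)
    qed
    then have "res (Spec R) U ?W s \<otimes>\<^bsub>sec (Spec R) ?W\<^esub> fsec ?W f a = \<one>\<^bsub>sec (Spec R) ?W\<^esub>"
      by (auto simp: sec_Spec fsec_def intro!: restrict_ext)
    then show "germ (Spec R) p U s \<in> Units (stalk (Spec R) p)"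
      unfolding iff using W t V by (intro exI[of _ ?W] exI[of _ "fsec ?W f a"]) auto
  qed
qed

text \<open>By \<open>Spec_germ_Units_iff\<close> the nonunits are the germs whose value at
  \<open>p\<close> has a numerator in \<open>p\<close>, and these are closed under addition.\<close>

lemma Spec_stalk_local:
  assumes p: "primeideal p R" shows "local_ring (stalk (Spec R) p)"
proof (rule local_ringI)
  interpret S: ring_presheaf "Spec R" by (rule ring_presheaf_Spec)
  let ?T = "topspace (zariski R)"
  have pT: "p \<in> ?T" using p by (simp add: topspace_zariski)
  show cr: "cring (stalk (Spec R) p)" using S.stalk_cring pT by (simp add: sec_Spec)
  interpret St: cring "stalk (Spec R) p" by (rule cr)
  interpret P: primeideal p R by (rule p)
  interpret localization_ring R "carrier R - p" by (rule localization_at_prime[OF p])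
  interpret L: cring L by (rule localization_cring)
  \<comment> \<open>The value of the zero section has the numerator \<open>\<zero>\<close>, which
    lies in \<open>p\<close>. So zero is not a unit and differs from one.\<close>
  have "germ (Spec R) p ?T \<zero>\<^bsub>sec (Spec R) ?T\<^esub> \<notin> Units (stalk (Spec R) p)"
    using stalk_ring_Units_iff[OF p, of \<zero> \<one>] pT S_one spec_zero_closed[of ?T]
    by (subst Spec_germ_Units_iff) (auto simp: sec_Spec(5) fraction_zero P.zero_closed)
  then have "\<zero>\<^bsub>stalk (Spec R) p\<^esub> \<notin> Units (stalk (Spec R) p)"
    using S.germ_zero[of ?T p] pT by (simp add: sec_Spec)
  then show "\<one>\<^bsub>stalk (Spec R) p\<^esub> \<noteq> \<zero>\<^bsub>stalk (Spec R) p\<^esub>" using St.Units_one_closed by metis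
  fix a b assume "a \<in> carrier (stalk (Spec R) p) - Units (stalk (Spec R) p)" "b \<in> carrier (stalk (Spec R) p) - Units (stalk (Spec R) p)"
  then obtain U s V t where U: "openin (zariski R) U" "p \<in> U" "s \<in> spec_sections R U" "a = germ (Spec R) p U s"
    and V: "openin (zariski R) V" "p \<in> V" "t \<in> spec_sections R V" "b = germ (Spec R) p V t"
    and nu: "a \<notin> Units (stalk (Spec R) p)" "b \<notin> Units (stalk (Spec R) p)"
    using S.stalk_cases unfolding sec_Spec by (metis DiffE)
  let ?W = "U \<inter> V"
  have W: "openin (zariski R) ?W" "p \<in> ?W" using U V by auto
  let ?s = "restrict s ?W" and ?t = "restrict t ?W"
  have c: "?s \<in> spec_sections R ?W" "?t \<in> spec_sections R ?W"
    using restrict_spec_section[OF U(1) W(1) _ U(3)] restrict_spec_section[OF V(1) W(1) _ V(3)] by auto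
  have g: "a = germ (Spec R) p ?W ?s" "b = germ (Spec R) p ?W ?t"
    using S.germ_res[of U ?W p s] S.germ_res[of V ?W p t] U V W unfolding sec_Spec by simp_all
  have ab: "a \<oplus>\<^bsub>stalk (Spec R) p\<^esub> b = germ (Spec R) p ?W (?s \<oplus>\<^bsub>sec (Spec R) ?W\<^esub> ?t)"
    unfolding g using S.germ_add[of ?W p ?s ?t] W c unfolding sec_Spec by simp
  have cl: "?s \<oplus>\<^bsub>sec (Spec R) ?W\<^esub> ?t \<in> spec_sections R ?W"
    using spec_add_closed[OF W(1) c] by (simp add: sec_Spec)
  obtain x f where x: "x \<in> carrier R" "f \<in> carrier R" "f \<notin> p" "s p = fr x f"
    using spec_sectionsE[OF U(3,2)] by metis
  obtain y g where y: "y \<in> carrier R" "g \<in> carrier R" "g \<notin> p" "t p = fr y g"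
    using spec_sectionsE[OF V(3,2)] by metis
  have "x \<in> p" "y \<in> p"
    using nu stalk_ring_Units_iff[OF p x(1-3)] stalk_ring_Units_iff[OF p y(1-3)] U V
    by (auto simp: Spec_germ_Units_iff x y)
  then have "x \<otimes> g \<oplus> y \<otimes> f \<in> p" using x y P.I_r_closed by auto
  moreover have "f \<otimes> g \<in> carrier R - p" using x y by (intro S_mult) auto
  ultimately have "s p \<oplus>\<^bsub>L\<^esub> t p \<notin> Units L"
    using stalk_ring_Units_iff[OF p, of "x \<otimes> g \<oplus> y \<otimes> f" "f \<otimes> g"] x y by (simp add: fraction_add)
  then show "a \<oplus>\<^bsub>stalk (Spec R) p\<^esub> b \<notin> Units (stalk (Spec R) p)"
    unfolding ab using W Spec_germ_Units_iff[OF W cl] by (simp add: sec_Spec)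
qed

end

section \<open>The universal property of localization\<close>

lemma (in cring) unit_inv_mult:
  assumes "u \<in> Units R" "y \<in> carrier R" shows "inv u \<otimes> (u \<otimes> y) = y" "u \<otimes> (inv u \<otimes> y) = y"
  using assms m_assoc[of "inv u" u y] m_assoc[of u "inv u" y] Units_closed[OF assms(1)] by simp_all

locale localization_lift = localization_ring A S + B: cring B
  for A :: "('a, 'm) ring_scheme" (structure) and S and B :: "('b, 'n) ring_scheme" +
  fixes h
  assumes h: "h \<in> ring_hom A B" and u: "f \<in> S \<Longrightarrow> h f \<in> Units B"
begin

definition lift where
  "lift z = (THE y. \<exists>a\<in>carrier A. \<exists>f\<in>S. z = fr a f \<and> y = inv\<^bsub>B\<^esub> (h f) \<otimes>\<^bsub>B\<^esub> h a)"

lemma h_closed: "a \<in> carrier A \<Longrightarrow> h a \<in> carrier B"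
  using ring_hom_closed[OF h] .

lemma inv_h_closed: "f \<in> S \<Longrightarrow> inv\<^bsub>B\<^esub> (h f) \<in> carrier B"
  using u by simp

text \<open>Equality of \<open>a / f\<close> and \<open>b / g\<close> means
  \<open>k a g = k b f\<close> for some \<open>k\<close> in \<open>S\<close>. After applying
  \<open>h\<close> the unit \<open>h k\<close> cancels, and the units \<open>h f\<close> and
  \<open>h g\<close> can be moved to the other sides.\<close>

lemma lift_fraction:
  assumes a: "a \<in> carrier A" and f: "f \<in> S"
  shows "lift (fr a f) = inv\<^bsub>B\<^esub> (h f) \<otimes>\<^bsub>B\<^esub> h a"
  unfolding lift_def
proof (rule the_equality)
  fix y assume "\<exists>b\<in>carrier A. \<exists>g\<in>S. fr a f = fr b g \<and> y = inv\<^bsub>B\<^esub> (h g) \<otimes>\<^bsub>B\<^esub> h b"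
  then obtain b g where bg: "b \<in> carrier A" "g \<in> S" "fr a f = fr b g" "y = inv\<^bsub>B\<^esub> (h g) \<otimes>\<^bsub>B\<^esub> h b" by blast
  obtain k where k: "k \<in> S" "k \<otimes> (a \<otimes> g) = k \<otimes> (b \<otimes> f)"
    using fraction_eqE[OF bg(3) a f bg(1,2)] .
  have "h k \<otimes>\<^bsub>B\<^esub> (h a \<otimes>\<^bsub>B\<^esub> h g) = h k \<otimes>\<^bsub>B\<^esub> (h b \<otimes>\<^bsub>B\<^esub> h f)"
    using arg_cong[OF k(2), of h] a f bg(1,2) k(1) by (simp add: ring_hom_mult[OF h])
  then have e: "h a \<otimes>\<^bsub>B\<^esub> h g = h b \<otimes>\<^bsub>B\<^esub> h f"
    using B.unit_cancel[OF u[OF k(1)]] a f bg by (simp add: h_closed)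
  note c = inv_h_closed[OF f] inv_h_closed[OF bg(2)] h_closed[OF a] h_closed[OF bg(1)] u[OF f] u[OF bg(2)]
  have "inv\<^bsub>B\<^esub> (h f) \<otimes>\<^bsub>B\<^esub> h a = inv\<^bsub>B\<^esub> (h f) \<otimes>\<^bsub>B\<^esub> (inv\<^bsub>B\<^esub> (h g) \<otimes>\<^bsub>B\<^esub> (h g \<otimes>\<^bsub>B\<^esub> h a))"
    using c by (simp add: B.unit_inv_mult)
  also have "\<dots> = inv\<^bsub>B\<^esub> (h g) \<otimes>\<^bsub>B\<^esub> (inv\<^bsub>B\<^esub> (h f) \<otimes>\<^bsub>B\<^esub> (h a \<otimes>\<^bsub>B\<^esub> h g))"
    using c(1-4) h_closed[OF S_closed[OF bg(2)]] by (simp add: B.m_ac)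
  also have "\<dots> = inv\<^bsub>B\<^esub> (h g) \<otimes>\<^bsub>B\<^esub> (inv\<^bsub>B\<^esub> (h f) \<otimes>\<^bsub>B\<^esub> (h f \<otimes>\<^bsub>B\<^esub> h b))"
    unfolding e using c(1-4) h_closed[OF S_closed[OF f]] by (simp add: B.m_comm)
  also have "\<dots> = y" using c bg by (simp add: B.unit_inv_mult)
  finally show "y = inv\<^bsub>B\<^esub> (h f) \<otimes>\<^bsub>B\<^esub> h a" ..
qed (use assms in blast)

lemma lift_fraction_eq: "a \<in> carrier A \<Longrightarrow> f \<in> S \<Longrightarrow> h f \<otimes>\<^bsub>B\<^esub> lift (fr a f) = h a"
  using u h_closed by (simp add: lift_fraction B.unit_inv_mult)

text \<open>The value at \<open>a / f\<close> is the only solution of an equation without inverses.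
  Additivity and multiplicativity of \<open>lift\<close> are then checked after multiplication by
  denominators.\<close>

lemma lift_unique:
  assumes "a \<in> carrier A" "f \<in> S" "y \<in> carrier B" "h f \<otimes>\<^bsub>B\<^esub> y = h a" shows "lift (fr a f) = y"
  using assms(1-3) u by (simp add: lift_fraction B.unit_inv_mult flip: assms(4))

lemma lift_hom: "lift \<in> ring_hom L B"
proof (rule ring_hom_memI)
  fix x assume "x \<in> carrier L"
  then obtain a f where af [simp]: "a \<in> carrier A" "f \<in> S" and x: "x = fr a f" by (elim L_cases)
  show lx: "lift x \<in> carrier B" by (simp add: x lift_fraction inv_h_closed h_closed)
  fix y assume "y \<in> carrier L"
  then obtain b g where bg [simp]: "b \<in> carrier A" "g \<in> S" and y: "y = fr b g" by (elim L_cases)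
  have ly: "lift y \<in> carrier B" by (simp add: y lift_fraction inv_h_closed h_closed)
  have fa: "h f \<otimes>\<^bsub>B\<^esub> lift x = h a" and gb: "h g \<otimes>\<^bsub>B\<^esub> lift y = h b"
    by (simp_all add: x y lift_fraction_eq)
  note c = lx ly h_closed[OF S_closed[OF af(2)]] h_closed[OF S_closed[OF bg(2)]]
  have "h (f \<otimes> g) \<otimes>\<^bsub>B\<^esub> (lift x \<otimes>\<^bsub>B\<^esub> lift y) = (h f \<otimes>\<^bsub>B\<^esub> lift x) \<otimes>\<^bsub>B\<^esub> (h g \<otimes>\<^bsub>B\<^esub> lift y)"
    using c by (simp add: ring_hom_mult[OF h] B.m_ac)
  also have "\<dots> = h (a \<otimes> b)" unfolding fa gb by (simp add: ring_hom_mult[OF h])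
  finally have "lift (fr (a \<otimes> b) (f \<otimes> g)) = lift x \<otimes>\<^bsub>B\<^esub> lift y"
    using c by (intro lift_unique S_mult) simp_all
  then show "lift (x \<otimes>\<^bsub>L\<^esub> y) = lift x \<otimes>\<^bsub>B\<^esub> lift y" by (simp add: x y fraction_mult)
  have "h (f \<otimes> g) \<otimes>\<^bsub>B\<^esub> (lift x \<oplus>\<^bsub>B\<^esub> lift y)
      = (h f \<otimes>\<^bsub>B\<^esub> lift x) \<otimes>\<^bsub>B\<^esub> h g \<oplus>\<^bsub>B\<^esub> (h g \<otimes>\<^bsub>B\<^esub> lift y) \<otimes>\<^bsub>B\<^esub> h f"
    using c by (simp add: ring_hom_mult[OF h] B.r_distr B.m_ac)
  also have "\<dots> = h (a \<otimes> g \<oplus> b \<otimes> f)"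
    unfolding fa gb by (simp add: ring_hom_mult[OF h] ring_hom_add[OF h])
  finally have "lift (fr (a \<otimes> g \<oplus> b \<otimes> f) (f \<otimes> g)) = lift x \<oplus>\<^bsub>B\<^esub> lift y"
    using c by (intro lift_unique S_mult) simp_all
  then show "lift (x \<oplus>\<^bsub>L\<^esub> y) = lift x \<oplus>\<^bsub>B\<^esub> lift y" by (simp add: x y fraction_add)
next
  show "lift \<one>\<^bsub>L\<^esub> = \<one>\<^bsub>B\<^esub>"
    unfolding fraction_one by (rule lift_unique) (auto simp: S_one ring_hom_one[OF h])
qed

end

section \<open>Morphisms of locally ringed spaces\<close>

text \<open>Separates the two ends of a morphism: a target \<open>Spec A\<close> enters through its
  rings and local stalks, while sections are glued on the source, a
  \<open>local_sheaf\<close>.\<close>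

locale local_presheaf = ring_presheaf X for X :: "('p, 's) ringed_space" +
  assumes stalk_local: "x \<in> topspace (pts X) \<Longrightarrow> local_ring (stalk X x)"

locale local_sheaf = local_presheaf X + ring_sheaf X for X :: "('p, 's) ringed_space"

lemma locally_ringed_space_local_sheaf:
  assumes "locally_ringed_space X" shows "local_sheaf X"
proof -
  have s: "sheaf_of_rings X" and "\<And>x. x \<in> topspace (pts X) \<Longrightarrow> local_ring (stalk X x)"
    using assms by (simp_all add: locally_ringed_space_def)
  moreover have "presheaf_of_rings X" using s by (simp add: sheaf_of_rings_def)
  ultimately show ?thesis by unfold_locales
qed

lemma (in cring) local_presheaf_Spec: "local_presheaf (Spec R)"
  by (intro local_presheaf.intro ring_presheaf_Spec local_presheaf_axioms.intro Spec_stalk_local)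
    (simp add: sec_Spec topspace_zariski)

text \<open>This is \<open>lrs_hom\<close> up to its last clause, the one on maximal ideals.
  Equality, pullback of germs and associativity are settled at this level; locality is added by
  \<open>lrs_hom_iff\<close>.\<close>

definition presheaf_hom ::
  "('p, 's) ringed_space \<Rightarrow> ('q, 't) ringed_space \<Rightarrow> ('p, 's, 'q, 't) rs_mor set" where
  "presheaf_hom X Y = {f.
     continuous_map (pts X) (pts Y) (on_pts f) \<and>
     on_pts f \<in> extensional (topspace (pts X)) \<and>
     on_sec f \<in> extensional {V. openin (pts Y) V} \<and>
     (\<forall>V. openin (pts Y) V \<longrightarrow>
        on_sec f V \<in> ring_hom (sec Y V) (sec X (preim X f V)) \<inter> extensional (carrier (sec Y V))) \<and>
     (\<forall>V W. openin (pts Y) V \<and> openin (pts Y) W \<and> W \<subseteq> V \<longrightarrow>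
        (\<forall>t\<in>carrier (sec Y V).
           on_sec f W (res Y V W t) = res X (preim X f V) (preim X f W) (on_sec f V t)))}"

lemma presheaf_homD:
  assumes "f \<in> presheaf_hom X Y"
  shows "x \<in> topspace (pts X) \<Longrightarrow> on_pts f x \<in> topspace (pts Y)"
    and "openin (pts Y) V \<Longrightarrow> openin (pts X) (preim X f V)"
    and "openin (pts Y) V \<Longrightarrow> on_sec f V \<in> ring_hom (sec Y V) (sec X (preim X f V))"
    and "openin (pts Y) V \<Longrightarrow> t \<in> carrier (sec Y V) \<Longrightarrow> on_sec f V t \<in> carrier (sec X (preim X f V))"
    and "openin (pts Y) V \<Longrightarrow> openin (pts Y) W \<Longrightarrow> W \<subseteq> V \<Longrightarrow> t \<in> carrier (sec Y V) \<Longrightarrow>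
       on_sec f W (res Y V W t) = res X (preim X f V) (preim X f W) (on_sec f V t)"
proof -
  have c: "continuous_map (pts X) (pts Y) (on_pts f)"
    and h: "\<And>V. openin (pts Y) V \<Longrightarrow> on_sec f V \<in> ring_hom (sec Y V) (sec X (preim X f V))"
    using assms by (auto simp: presheaf_hom_def)
  show "x \<in> topspace (pts X) \<Longrightarrow> on_pts f x \<in> topspace (pts Y)"
    using c by (auto simp: continuous_map_def)
  show "openin (pts Y) V \<Longrightarrow> openin (pts X) (preim X f V)"
    unfolding preim_def by (rule openin_continuous_map_preimage[OF c])
  show "openin (pts Y) V \<Longrightarrow> on_sec f V \<in> ring_hom (sec Y V) (sec X (preim X f V))" by (rule h)
  show "openin (pts Y) V \<Longrightarrow> t \<in> carrier (sec Y V) \<Longrightarrow> on_sec f V t \<in> carrier (sec X (preim X f V))"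
    using ring_hom_closed[OF h] .
  show "openin (pts Y) V \<Longrightarrow> openin (pts Y) W \<Longrightarrow> W \<subseteq> V \<Longrightarrow> t \<in> carrier (sec Y V) \<Longrightarrow>
       on_sec f W (res Y V W t) = res X (preim X f V) (preim X f W) (on_sec f V t)"
    using assms by (simp add: presheaf_hom_def)
qed

lemma preim_mono: "V \<subseteq> W \<Longrightarrow> preim X f V \<subseteq> preim X f W"
  by (auto simp: preim_def)

lemma preim_topspace: "f \<in> presheaf_hom X Y \<Longrightarrow> preim X f (topspace (pts Y)) = topspace (pts X)"
  using presheaf_homD(1) by (fastforce simp: preim_def)

lemma presheaf_hom_eqI:
  assumes f: "f \<in> presheaf_hom X Y" and g: "g \<in> presheaf_hom X Y"
    and p: "\<And>x. x \<in> topspace (pts X) \<Longrightarrow> on_pts f x = on_pts g x"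
    and s: "\<And>V t. openin (pts Y) V \<Longrightarrow> t \<in> carrier (sec Y V) \<Longrightarrow> on_sec f V t = on_sec g V t"
  shows "f = g"
proof (rule rs_mor.equality)
  show "on_pts f = on_pts g"
    using f g p by (intro extensionalityI[of _ "topspace (pts X)"]) (auto simp: presheaf_hom_def)
  show "on_sec f = on_sec g"
  proof (rule extensionalityI[of _ "{V. openin (pts Y) V}"])
    fix V assume "V \<in> {V. openin (pts Y) V}"
    then have V: "openin (pts Y) V" by simp
    then show "on_sec f V = on_sec g V"
      using f g s[OF V] by (intro extensionalityI[of _ "carrier (sec Y V)"]) (auto simp: presheaf_hom_def)
  qed (use f g in \<open>auto simp: presheaf_hom_def\<close>)
qed simp

text \<open>The maps on sections commute with restriction, so all representatives of a germ have the
  same image and the union in \<open>stalk_map\<close> is a single class.\<close>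

lemma stalk_map_germ:
  assumes X: "ring_presheaf X" and Y: "ring_presheaf Y" and f: "f \<in> presheaf_hom X Y"
    and x: "x \<in> topspace (pts X)" and V: "openin (pts Y) V" "on_pts f x \<in> V" "t \<in> carrier (sec Y V)"
  shows "stalk_map X f x (germ Y (on_pts f x) V t) = germ X x (preim X f V) (on_sec f V t)"
proof -
  interpret X: ring_presheaf X by (rule X)
  interpret Y: ring_presheaf Y by (rule Y)
  note d = presheaf_homD[OF f]
  have "germ X x (preim X f W) (on_sec f W r) = germ X x (preim X f V) (on_sec f V t)"
    if "(W, r) \<in> germ Y (on_pts f x) V t" for W r
  proof -
    have W: "openin (pts Y) W" "on_pts f x \<in> W" "r \<in> carrier (sec Y W)"
      "germ Y (on_pts f x) W r = germ Y (on_pts f x) V t"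
      using Y.germ_memE[OF that V(1,3)] .
    obtain N where N: "openin (pts Y) N" "on_pts f x \<in> N" "N \<subseteq> W \<inter> V" "res Y W N r = res Y V N t"
      using Y.germ_eqE[OF W(4) V] .
    have "res X (preim X f W) (preim X f N) (on_sec f W r) = on_sec f N (res Y W N r)"
      using N W by (subst d(5)) auto
    also have "\<dots> = res X (preim X f V) (preim X f N) (on_sec f V t)"
      unfolding N(4) using N V by (subst d(5)) auto
    finally show ?thesis
      using N W V x preim_mono[of N W X f] preim_mono[of N V X f]
      by (intro X.germ_eqI[where W = "preim X f N"] d) (auto simp: preim_def)
  qed
  moreover have "(V, t) \<in> germ Y (on_pts f x) V t" using Y.germ_self V by blast
  ultimately show ?thesis unfolding stalk_map_def by fast
qed

text \<open>An inverse on a neighbourhood pulls back to an inverse. The converse implication is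
  exactly what locality of a morphism adds.\<close>

lemma presheaf_hom_Units:
  assumes X: "ring_presheaf X" and Y: "ring_presheaf Y" and f: "f \<in> presheaf_hom X Y"
    and x: "x \<in> topspace (pts X)" and V: "openin (pts Y) V" "on_pts f x \<in> V" "t \<in> carrier (sec Y V)"
    and u: "germ Y (on_pts f x) V t \<in> Units (stalk Y (on_pts f x))"
  shows "germ X x (preim X f V) (on_sec f V t) \<in> Units (stalk X x)"
proof -
  interpret X: ring_presheaf X by (rule X)
  interpret Y: ring_presheaf Y by (rule Y)
  note d = presheaf_homD[OF f]
  obtain W s where W: "openin (pts Y) W" "on_pts f x \<in> W" "W \<subseteq> V" "s \<in> carrier (sec Y W)"
    "res Y V W t \<otimes>\<^bsub>sec Y W\<^esub> s = \<one>\<^bsub>sec Y W\<^esub>"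
    using u Y.germ_Units_iff[OF V] by blast
  have "res X (preim X f V) (preim X f W) (on_sec f V t) \<otimes>\<^bsub>sec X (preim X f W)\<^esub> on_sec f W s
      = \<one>\<^bsub>sec X (preim X f W)\<^esub>"
    using W V ring_hom_mult[OF d(3)[OF W(1)] Y.res_closed[OF V(1) W(1,3) V(3)] W(4)]
      ring_hom_one[OF d(3)[OF W(1)]] d(5)[OF V(1) W(1,3) V(3)] by simp
  then show ?thesis
    using W V x d(2)[OF V(1)] d(2)[OF W(1)] d(4)[OF V(1,3)] d(4)[OF W(1,4)] preim_mono[OF W(3)]
    by (subst X.germ_Units_iff) (auto simp: preim_def)
qed

text \<open>In local rings the maximal ideal consists of the nonunits, so the last clause of
  \<open>lrs_hom\<close> says that stalk maps send nonunits to nonunits. The contrapositive,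
  expressed by germs of sections, is the form in which locality can be composed and
  verified.\<close>

lemma lrs_hom_iff:
  assumes X: "local_presheaf X" and Y: "local_presheaf Y"
  shows "f \<in> lrs_hom X Y \<longleftrightarrow> f \<in> presheaf_hom X Y \<and>
    (\<forall>x\<in>topspace (pts X). \<forall>V t. openin (pts Y) V \<and> on_pts f x \<in> V \<and> t \<in> carrier (sec Y V) \<and>
       germ X x (preim X f V) (on_sec f V t) \<in> Units (stalk X x) \<longrightarrow>
       germ Y (on_pts f x) V t \<in> Units (stalk Y (on_pts f x)))"
    (is "_ \<longleftrightarrow> _ \<and> ?loc")
proof -
  interpret X: local_presheaf X by (rule X)
  interpret Y: local_presheaf Y by (rule Y)
  have A: "(\<forall>x\<in>topspace (pts X). \<forall>\<nn> \<mm>.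
        maximalideal \<nn> (stalk Y (on_pts f x)) \<and> maximalideal \<mm> (stalk X x) \<longrightarrow>
          stalk_map X f x ` \<nn> \<subseteq> \<mm>) \<longleftrightarrow> ?loc" (is "?max \<longleftrightarrow> _") if f: "f \<in> presheaf_hom X Y"
  proof (intro iffI ballI allI impI)
    fix x V t assume mx: ?max and x: "x \<in> topspace (pts X)"
      and "openin (pts Y) V \<and> on_pts f x \<in> V \<and> t \<in> carrier (sec Y V) \<and>
        germ X x (preim X f V) (on_sec f V t) \<in> Units (stalk X x)"
    then have V: "openin (pts Y) V" "on_pts f x \<in> V" "t \<in> carrier (sec Y V)"
      and u: "germ X x (preim X f V) (on_sec f V t) \<in> Units (stalk X x)" by auto
    let ?SX = "stalk X x" and ?SY = "stalk Y (on_pts f x)"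
    have "maximalideal (carrier ?SX - Units ?SX) ?SX" "maximalideal (carrier ?SY - Units ?SY) ?SY"
      using local_ring_nonunits X.stalk_local Y.stalk_local x presheaf_homD(1)[OF f x] by blast+
    then have im: "stalk_map X f x ` (carrier ?SY - Units ?SY) \<subseteq> carrier ?SX - Units ?SX" using mx x by blast
    show "germ Y (on_pts f x) V t \<in> Units ?SY"
    proof (rule ccontr)
      assume "germ Y (on_pts f x) V t \<notin> Units ?SY"
      then have "germ Y (on_pts f x) V t \<in> carrier ?SY - Units ?SY" using Y.germ_closed[OF V] by blast
      then have "stalk_map X f x (germ Y (on_pts f x) V t) \<notin> Units ?SX" using im by blast
      then show False
        using u stalk_map_germ[OF X.ring_presheaf_axioms Y.ring_presheaf_axioms f x V] by simp
    qed
  next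
    fix x \<nn> \<mm> assume lc: ?loc and x: "x \<in> topspace (pts X)"
      and m: "maximalideal \<nn> (stalk Y (on_pts f x)) \<and> maximalideal \<mm> (stalk X x)"
    let ?SX = "stalk X x" and ?SY = "stalk Y (on_pts f x)"
    have n: "\<nn> = carrier ?SY - Units ?SY" "\<mm> = carrier ?SX - Units ?SX"
      using m local_ring_maximalideal_eq X.stalk_local Y.stalk_local x presheaf_homD(1)[OF f x] by blast+
    show "stalk_map X f x ` \<nn> \<subseteq> \<mm>"
    proof
      fix b assume "b \<in> stalk_map X f x ` \<nn>"
      then obtain a where a: "a \<in> carrier ?SY" "a \<notin> Units ?SY" "b = stalk_map X f x a" unfolding n by blast
      then obtain V t where V: "openin (pts Y) V" "on_pts f x \<in> V" "t \<in> carrier (sec Y V)" "a = germ Y (on_pts f x) V t"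
        by (elim Y.stalk_cases)
      have b: "b = germ X x (preim X f V) (on_sec f V t)"
        unfolding a(3) V(4) by (rule stalk_map_germ[OF X.ring_presheaf_axioms Y.ring_presheaf_axioms f x V(1-3)])
      have "b \<in> carrier ?SX"
        unfolding b using presheaf_homD(2,4)[OF f V(1)] V x by (intro X.germ_closed) (auto simp: preim_def)
      moreover have "b \<notin> Units ?SX"
      proof
        assume "b \<in> Units ?SX"
        then have "germ Y (on_pts f x) V t \<in> Units ?SY" using lc x V(1-3) unfolding b by blast
        then show False using a(2) V(4) by simp
      qed
      ultimately show "b \<in> \<mm>" unfolding n by blast
    qed
  qed
  have "f \<in> lrs_hom X Y \<longleftrightarrow> f \<in> presheaf_hom X Y \<and> ?max"
    unfolding lrs_hom_def presheaf_hom_def by simp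
  also have "\<dots> \<longleftrightarrow> f \<in> presheaf_hom X Y \<and> ?loc" by (rule conj_cong[OF refl A])
  finally show ?thesis .
qed

lemma lrs_hom_presheaf_hom: "f \<in> lrs_hom X Y \<Longrightarrow> f \<in> presheaf_hom X Y"
  unfolding lrs_hom_def presheaf_hom_def by auto

lemma preim_rs_comp:
  assumes "f \<in> presheaf_hom X Y"
  shows "preim X (rs_comp X Y Z g f) V = preim X f (preim Y g V)"
  using presheaf_homD(1)[OF assms] by (auto simp: preim_def rs_comp_def compose_def)

lemma rs_comp_simps:
  "x \<in> topspace (pts X) \<Longrightarrow> on_pts (rs_comp X Y Z g f) x = on_pts g (on_pts f x)"
  "openin (pts Z) V \<Longrightarrow> t \<in> carrier (sec Z V) \<Longrightarrow>
     on_sec (rs_comp X Y Z g f) V t = on_sec f (preim Y g V) (on_sec g V t)"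
  by (simp_all add: rs_comp_def compose_def)

text \<open>Morphisms are extensional, so the maps on sections of a composite agree with the plain
  composite of functions only on the carrier.\<close>

lemma ring_hom_cong:
  assumes "f \<in> ring_hom R S" "ring R" "\<And>r. r \<in> carrier R \<Longrightarrow> g r = f r"
  shows "g \<in> ring_hom R S"
proof -
  interpret ring R by fact
  show ?thesis
    using assms(3) ring_hom_closed[OF assms(1)] ring_hom_mult[OF assms(1)] ring_hom_add[OF assms(1)]
      ring_hom_one[OF assms(1)]
    by (intro ring_hom_memI) auto
qed

lemma presheaf_hom_comp:
  assumes Z: "ring_presheaf Z" and f: "f \<in> presheaf_hom X Y" and g: "g \<in> presheaf_hom Y Z"
  shows "rs_comp X Y Z g f \<in> presheaf_hom X Z"
proof -
  interpret Z: ring_presheaf Z by (rule Z)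
  note df = presheaf_homD[OF f] and dg = presheaf_homD[OF g]
  have c: "continuous_map (pts X) (pts Z) (on_pts (rs_comp X Y Z g f))"
    using continuous_map_compose[of "pts X" "pts Y" "on_pts f" "pts Z" "on_pts g"] f g
    by (auto simp: presheaf_hom_def rs_comp_simps intro: continuous_map_eq)
  have h: "on_sec (rs_comp X Y Z g f) V \<in> ring_hom (sec Z V) (sec X (preim X f (preim Y g V)))"
    if V: "openin (pts Z) V" for V
    using ring_hom_trans[OF dg(3)[OF V] df(3)[OF dg(2)[OF V]]] cring.axioms(1)[OF Z.sec_cring[OF V]]
    by (rule ring_hom_cong) (simp add: rs_comp_simps V)
  have r: "on_sec (rs_comp X Y Z g f) W (res Z V W t) =
      res X (preim X f (preim Y g V)) (preim X f (preim Y g W)) (on_sec (rs_comp X Y Z g f) V t)"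
    if V: "openin (pts Z) V" "openin (pts Z) W" "W \<subseteq> V" "t \<in> carrier (sec Z V)" for V W t
    using V Z.res_closed[OF V] df(5)[OF dg(2)[OF V(1)] dg(2)[OF V(2)] preim_mono[OF V(3)] dg(4)[OF V(1,4)]]
    by (simp add: rs_comp_simps dg(5))
  show ?thesis
    unfolding presheaf_hom_def
  proof (intro CollectI conjI allI impI ballI)
    show "on_pts (rs_comp X Y Z g f) \<in> extensional (topspace (pts X))"
      "on_sec (rs_comp X Y Z g f) \<in> extensional {V. openin (pts Z) V}"
      by (simp_all add: rs_comp_def)
    fix V assume "openin (pts Z) V"
    moreover from this have "on_sec (rs_comp X Y Z g f) V \<in> extensional (carrier (sec Z V))"
      by (simp add: rs_comp_def)
    ultimately show "on_sec (rs_comp X Y Z g f) V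
        \<in> ring_hom (sec Z V) (sec X (preim X (rs_comp X Y Z g f) V)) \<inter> extensional (carrier (sec Z V))"
      using h by (simp add: preim_rs_comp[OF f])
  qed (use c r in \<open>auto simp: preim_rs_comp[OF f]\<close>)
qed

lemma lrs_hom_comp:
  assumes X: "local_presheaf X" and Y: "local_presheaf Y" and Z: "local_presheaf Z"
    and f: "f \<in> lrs_hom X Y" and g: "g \<in> lrs_hom Y Z"
  shows "rs_comp X Y Z g f \<in> lrs_hom X Z"
proof -
  note pf = lrs_hom_presheaf_hom[OF f] and pg = lrs_hom_presheaf_hom[OF g]
  have "rs_comp X Y Z g f \<in> presheaf_hom X Z"
    using presheaf_hom_comp[OF _ pf pg] Z by (simp add: local_presheaf.axioms)
  moreover have "germ Z (on_pts (rs_comp X Y Z g f) x) V t \<in> Units (stalk Z (on_pts (rs_comp X Y Z g f) x))"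
    if x: "x \<in> topspace (pts X)" and V: "openin (pts Z) V" "on_pts (rs_comp X Y Z g f) x \<in> V" "t \<in> carrier (sec Z V)"
      and u: "germ X x (preim X (rs_comp X Y Z g f) V) (on_sec (rs_comp X Y Z g f) V t) \<in> Units (stalk X x)"
    for x V t
  proof -
    have y: "on_pts f x \<in> topspace (pts Y)" by (rule presheaf_homD(1)[OF pf x])
    have gV: "on_pts g (on_pts f x) \<in> V" using V x by (simp add: rs_comp_simps)
    have "germ X x (preim X f (preim Y g V)) (on_sec f (preim Y g V) (on_sec g V t)) \<in> Units (stalk X x)"
      using u x V by (simp add: preim_rs_comp[OF pf] rs_comp_simps)
    then have "germ Y (on_pts f x) (preim Y g V) (on_sec g V t) \<in> Units (stalk Y (on_pts f x))"
      using f x y gV presheaf_homD(2,4)[OF pg V(1)] V(3) unfolding lrs_hom_iff[OF X Y] by (auto simp: preim_def)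
    then have "germ Z (on_pts g (on_pts f x)) V t \<in> Units (stalk Z (on_pts g (on_pts f x)))"
      using g y V gV unfolding lrs_hom_iff[OF Y Z] by blast
    then show ?thesis using x by (simp add: rs_comp_simps)
  qed
  ultimately show ?thesis unfolding lrs_hom_iff[OF X Z] by blast
qed

lemma rs_comp_assoc:
  assumes W: "ring_presheaf W" and Z: "ring_presheaf Z"
    and f: "f \<in> presheaf_hom X Y" and g: "g \<in> presheaf_hom Y Z" and h: "h \<in> presheaf_hom Z W"
  shows "rs_comp X Z W h (rs_comp X Y Z g f) = rs_comp X Y W (rs_comp Y Z W h g) f"
proof (rule presheaf_hom_eqI)
  show "rs_comp X Z W h (rs_comp X Y Z g f) \<in> presheaf_hom X W"
    "rs_comp X Y W (rs_comp Y Z W h g) f \<in> presheaf_hom X W"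
    using assms by (auto intro: presheaf_hom_comp)
  fix x assume "x \<in> topspace (pts X)"
  then show "on_pts (rs_comp X Z W h (rs_comp X Y Z g f)) x = on_pts (rs_comp X Y W (rs_comp Y Z W h g) f) x"
    using presheaf_homD(1)[OF f] by (simp add: rs_comp_simps)
next
  fix V t assume "openin (pts W) V" "t \<in> carrier (sec W V)"
  then show "on_sec (rs_comp X Z W h (rs_comp X Y Z g f)) V t = on_sec (rs_comp X Y W (rs_comp Y Z W h g) f) V t"
    using presheaf_homD(2,4)[OF h] by (simp add: rs_comp_simps preim_rs_comp[OF g])
qed

lemma rs_id_lrs_hom:
  assumes "local_presheaf X" shows "rs_id X \<in> lrs_hom X X"
proof -
  interpret local_presheaf X by fact
  have pre: "preim X (rs_id X) V = V" if "openin (pts X) V" for V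
    using openin_subset[OF that] by (auto simp: preim_def rs_id_def)
  have "rs_id X \<in> presheaf_hom X X"
    unfolding presheaf_hom_def
  proof (intro CollectI conjI allI impI ballI)
    show "continuous_map (pts X) (pts X) (on_pts (rs_id X))"
      by (rule continuous_map_eq[OF continuous_map_id]) (simp add: rs_id_def)
    fix V assume V: "openin (pts X) V"
    have "id \<in> ring_hom (sec X V) (sec X V)" by (rule ring_hom_memI) auto
    then have "on_sec (rs_id X) V \<in> ring_hom (sec X V) (sec X V)"
      by (rule ring_hom_cong[OF _ cring.axioms(1)[OF sec_cring[OF V]]]) (simp add: rs_id_def V)
    then show "on_sec (rs_id X) V \<in> ring_hom (sec X V) (sec X (preim X (rs_id X) V)) \<inter> extensional (carrier (sec X V))"
      using V by (simp add: pre) (simp add: rs_id_def)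
  next
    fix V W t assume "openin (pts X) V \<and> openin (pts X) W \<and> W \<subseteq> V" "t \<in> carrier (sec X V)"
    then show "on_sec (rs_id X) W (res X V W t) = res X (preim X (rs_id X) V) (preim X (rs_id X) W) (on_sec (rs_id X) V t)"
      by (simp add: pre) (simp add: rs_id_def res_closed)
  qed (simp_all add: rs_id_def)
  then show ?thesis
    unfolding lrs_hom_iff[OF assms assms] by (auto simp: pre) (auto simp: rs_id_def)
qed

lemma rs_comp_id_right:
  assumes X: "local_presheaf X" and Y: "ring_presheaf Y" and f: "f \<in> presheaf_hom X Y"
  shows "rs_comp X X Y f (rs_id X) = f"
proof (rule presheaf_hom_eqI[OF presheaf_hom_comp[OF Y _ f] f])
  show "rs_id X \<in> presheaf_hom X X" using rs_id_lrs_hom[OF X] lrs_hom_presheaf_hom by blast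
qed (use presheaf_homD(2,4)[OF f] in \<open>auto simp: rs_comp_simps rs_id_def\<close>)

section \<open>Morphisms to affine schemes\<close>

context cring
begin

text \<open>The canonical map from \<open>R\<close> to the global functions on its spectrum.
  Morphisms to \<open>Spec R\<close> are recognized by their pullbacks of these functions.\<close>

definition gsec where "gsec a = fsec (topspace (zariski R)) a \<one>"

lemma gsec_closed: "a \<in> carrier R \<Longrightarrow> gsec a \<in> spec_sections R (topspace (zariski R))"
  unfolding gsec_def by (rule fsec_in) (auto dest: open_one_notin[OF openin_topspace])

lemma gsec_apply: "primeideal p R \<Longrightarrow> gsec a p = frp p a \<one>"
  by (simp add: gsec_def fsec_def topspace_zariski)

lemma Spec_germ_gsec_Units:
  assumes "primeideal p R" "a \<in> carrier R"
  shows "germ (Spec R) p (topspace (zariski R)) (gsec a) \<in> Units (stalk (Spec R) p) \<longleftrightarrow> a \<notin> p"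
proof -
  have p: "p \<in> topspace (zariski R)" using assms(1) by (simp add: topspace_zariski)
  show ?thesis
    unfolding Spec_germ_Units_iff[OF openin_topspace p gsec_closed[OF assms(2)]]
    using assms by (simp add: gsec_apply stalk_ring_Units_iff prime_not_one)
qed

lemma gsec_hom: "gsec \<in> ring_hom R (sec (Spec R) (topspace (zariski R)))"
proof (rule ring_hom_memI)
  fix a b assume ab: "a \<in> carrier R" "b \<in> carrier R"
  have "gsec (a \<otimes> b) p = gsec a p \<otimes>\<^bsub>stalk_ring R p\<^esub> gsec b p \<and> gsec (a \<oplus> b) p = gsec a p \<oplus>\<^bsub>stalk_ring R p\<^esub> gsec b p"
    if p: "primeideal p R" for p
  proof -
    interpret localization_ring R "carrier R - p" by (rule localization_at_prime[OF p])
    show ?thesis using ab p S_one by (simp add: gsec_apply fraction_mult fraction_add_same)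
  qed
  then show "gsec (a \<otimes> b) = gsec a \<otimes>\<^bsub>sec (Spec R) (topspace (zariski R))\<^esub> gsec b"
    "gsec (a \<oplus> b) = gsec a \<oplus>\<^bsub>sec (Spec R) (topspace (zariski R))\<^esub> gsec b"
    by (auto simp: sec_Spec topspace_zariski fun_eq_iff) (auto simp: gsec_def fsec_def topspace_zariski)
next
  show "gsec \<one> = \<one>\<^bsub>sec (Spec R) (topspace (zariski R))\<^esub>" by (simp add: gsec_def fsec_one)
qed (simp add: sec_Spec(1) gsec_closed)

end

locale lrs_to_affine = local_sheaf X + A: cring A
  for X :: "('p, 's) ringed_space" and A :: "('a, 'm) ring_scheme"
begin

lemma local_presheaf_X: "local_presheaf X" by (rule local_presheaf_axioms)

abbreviation TX where "TX \<equiv> topspace (pts X)"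
abbreviation TA where "TA \<equiv> topspace (zariski A)"

lemma affine_preim_top: "F \<in> lrs_hom X (Spec A) \<Longrightarrow> preim X F TA = TX"
  using preim_topspace[OF lrs_hom_presheaf_hom] by (metis A.sec_Spec(7))

context
  fixes F assumes F: "F \<in> lrs_hom X (Spec A)"
begin

lemmas Fp = lrs_hom_presheaf_hom[OF F]
lemmas Fd = presheaf_homD[OF Fp, unfolded A.sec_Spec(1,7)]

lemma on_pts_prime: "x \<in> TX \<Longrightarrow> primeideal (on_pts F x) A"
  using Fd(1) by (simp add: A.topspace_zariski)

text \<open>Any morphism preserves invertible germs, and a local one also reflects them. Hence the
  image of a point is determined by the pullback of global functions.\<close>

lemma on_pts_char:
  assumes x: "x \<in> TX" and a: "a \<in> carrier A"
  shows "a \<notin> on_pts F x \<longleftrightarrow> germ X x TX (on_sec F TA (A.gsec a)) \<in> Units (stalk X x)"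
proof -
  have t: "openin (pts (Spec A)) TA" "on_pts F x \<in> TA" "A.gsec a \<in> carrier (sec (Spec A) TA)"
    using on_pts_prime[OF x] A.gsec_closed[OF a] by (simp_all add: A.sec_Spec(1,7)) (simp add: A.topspace_zariski)
  have "germ (Spec A) (on_pts F x) TA (A.gsec a) \<in> Units (stalk (Spec A) (on_pts F x)) \<longleftrightarrow>
      germ X x (preim X F TA) (on_sec F TA (A.gsec a)) \<in> Units (stalk X x)"
    using F x t presheaf_hom_Units[OF ring_presheaf_axioms A.ring_presheaf_Spec Fp x t]
    unfolding lrs_hom_iff[OF local_presheaf_X A.local_presheaf_Spec] by blast
  then show ?thesis using A.Spec_germ_gsec_Units[OF on_pts_prime[OF x] a] affine_preim_top[OF F] by simp
qed

text \<open>Near the image of \<open>x\<close> the section \<open>t\<close> is some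
  \<open>a / g\<close>, and the equation \<open>g t = a\<close> pulls back. Since the pullback of
  \<open>g\<close> is invertible at \<open>x\<close> by \<open>on_pts_char\<close>, the germ of the
  pullback of \<open>t\<close> is determined by global functions.\<close>

lemma on_sec_char:
  assumes V: "openin (zariski A) V" and t: "t \<in> spec_sections A V" and x: "x \<in> preim X F V"
  obtains a g where "a \<in> carrier A" "g \<in> carrier A" "g \<notin> on_pts F x" "t (on_pts F x) = A.frp (on_pts F x) a g"
    "germ X x TX (on_sec F TA (A.gsec g)) \<otimes>\<^bsub>stalk X x\<^esub> germ X x (preim X F V) (on_sec F V t)
      = germ X x TX (on_sec F TA (A.gsec a))"
proof -
  interpret S: ring_presheaf "Spec A" by (rule A.ring_presheaf_Spec)
  have xV: "x \<in> TX" "on_pts F x \<in> V" using x by (auto simp: preim_def)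
  obtain W a g where W: "openin (zariski A) W" "on_pts F x \<in> W" "W \<subseteq> V" "a \<in> carrier A" "g \<in> carrier A"
    "\<And>q. q \<in> W \<Longrightarrow> g \<notin> q" "\<And>q. q \<in> W \<Longrightarrow> t q = A.frp q a g" by (rule A.spec_sectionsE[OF t xV(2)]) blast
  have WT: "W \<subseteq> TA" using openin_subset[OF W(1)] .
  note ga = A.gsec_closed[OF W(4)] and gg = A.gsec_closed[OF W(5)]
  have eq: "res (Spec A) TA W (A.gsec g) \<otimes>\<^bsub>sec (Spec A) W\<^esub> res (Spec A) V W t = res (Spec A) TA W (A.gsec a)"
  proof -
    have "A.gsec g q \<otimes>\<^bsub>stalk_ring A q\<^esub> t q = A.gsec a q" if q: "q \<in> W" for q
    proof -
      have p: "primeideal q A" using A.open_prime[OF W(1) q] .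
      interpret localization_ring A "carrier A - q" by (rule localization_at_prime[OF p])
      have "g \<in> carrier A - q" using W q by auto
      then have "fraction A (carrier A - q) (g \<otimes>\<^bsub>A\<^esub> a, g) = fraction A (carrier A - q) (a, \<one>\<^bsub>A\<^esub>)"
        using fraction_scale[of g a "\<one>\<^bsub>A\<^esub>"] W S_one by simp
      then show ?thesis using W q p S_one by (simp add: A.gsec_apply fraction_mult)
    qed
    then show ?thesis using WT by (auto simp: A.sec_Spec intro!: restrict_ext)
  qed
  have o: "openin (pts X) (preim X F W)" "openin (pts X) (preim X F V)" "preim X F W \<subseteq> preim X F V"
    "preim X F W \<subseteq> TX" "x \<in> preim X F W"
    using Fd(2) V W xV by (auto simp: preim_def)
  have c: "on_sec F TA (A.gsec g) \<in> Sc TX" "on_sec F TA (A.gsec a) \<in> Sc TX" "on_sec F V t \<in> Sc (preim X F V)"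
    using Fd(4)[OF openin_topspace gg] Fd(4)[OF openin_topspace ga] Fd(4)[OF V t] affine_preim_top[OF F] by simp_all
  have rc: "res (Spec A) TA W (A.gsec g) \<in> spec_sections A W" "res (Spec A) V W t \<in> spec_sections A W"
    using S.res_closed[unfolded A.sec_Spec(1,7)] V W WT gg t by auto
  have "res X TX (preim X F W) (on_sec F TA (A.gsec g)) \<otimes>\<^bsub>sec X (preim X F W)\<^esub> res X (preim X F V) (preim X F W) (on_sec F V t)
      = res X TX (preim X F W) (on_sec F TA (A.gsec a))"
    using arg_cong[OF eq, of "on_sec F W"] ring_hom_mult[OF Fd(3)[OF W(1)], unfolded A.sec_Spec(1), OF rc]
      Fd(5)[OF openin_topspace W(1) WT gg] Fd(5)[OF openin_topspace W(1) WT ga] Fd(5)[OF V W(1) W(3) t]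
      affine_preim_top[OF F] by simp
  then have "germ X x (preim X F W) (res X TX (preim X F W) (on_sec F TA (A.gsec g))) \<otimes>\<^bsub>stalk X x\<^esub>
      germ X x (preim X F W) (res X (preim X F V) (preim X F W) (on_sec F V t))
      = germ X x (preim X F W) (res X TX (preim X F W) (on_sec F TA (A.gsec a)))"
    using o c by (subst germ_mult) (auto simp: res_closed)
  then have "germ X x TX (on_sec F TA (A.gsec g)) \<otimes>\<^bsub>stalk X x\<^esub> germ X x (preim X F V) (on_sec F V t)
      = germ X x TX (on_sec F TA (A.gsec a))"
    using o c by (simp add: germ_res)
  then show thesis using that W xV by blast
qed

end

text \<open>The points agree by \<open>on_pts_char\<close>. By \<open>on_sec_char\<close> the germs
  of pulled back sections are values of a homomorphism on the localization that depends only on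
  global functions, and germs determine sections.\<close>

lemma affine_hom_eqI:
  assumes F: "F \<in> lrs_hom X (Spec A)" and G: "G \<in> lrs_hom X (Spec A)"
    and eq: "\<And>a. a \<in> carrier A \<Longrightarrow> on_sec F TA (A.gsec a) = on_sec G TA (A.gsec a)"
  shows "F = G"
proof (rule presheaf_hom_eqI[OF Fp[OF F] Fp[OF G]])
  have pts_eq: "on_pts F x = on_pts G x" if x: "x \<in> TX" for x
  proof -
    have "on_pts F x \<subseteq> carrier A" "on_pts G x \<subseteq> carrier A"
      using ideal.Icarr[OF primeideal.axioms(1)[OF on_pts_prime[OF F x]]]
        ideal.Icarr[OF primeideal.axioms(1)[OF on_pts_prime[OF G x]]] by blast+
    moreover have "a \<notin> on_pts F x \<longleftrightarrow> a \<notin> on_pts G x" if "a \<in> carrier A" for a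
      unfolding on_pts_char[OF F x that] on_pts_char[OF G x that] eq[OF that] by (rule refl)
    ultimately show ?thesis by blast
  qed
  then show "on_pts F x = on_pts G x" if "x \<in> topspace (pts X)" for x using that .
  fix V t assume "openin (pts (Spec A)) V" "t \<in> carrier (sec (Spec A) V)"
  then have V: "openin (zariski A) V" and t: "t \<in> spec_sections A V" by (simp_all add: A.sec_Spec)
  have pre: "preim X G V = preim X F V" using pts_eq by (auto simp: preim_def)
  note o = Fd(2)[OF F V]
  show "on_sec F V t = on_sec G V t"
  proof (rule section_eqI[OF o])
    show c: "on_sec F V t \<in> Sc (preim X F V)" "on_sec G V t \<in> Sc (preim X F V)"
      using Fd(4)[OF F V t] Fd(4)[OF G V t] pre by simp_all
    fix x assume x: "x \<in> preim X F V"
    then have xX: "x \<in> TX" and xV: "on_pts F x \<in> V" by (auto simp: preim_def)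
    interpret S: cring "stalk X x" by (rule stalk_cring[OF xX])
    let ?p = "on_pts F x"
    \<comment> \<open>By \<open>eq\<close> this map to the stalk is the same for \<open>F\<close>
      and \<open>G\<close>. The fractions found for \<open>t\<close> on the two sides may differ,
      but the lift of \<open>h\<close> does not depend on the representation.\<close>
    define h where "h = (\<lambda>a. germ X x TX (on_sec F TA (A.gsec a)))"
    have h: "h \<in> ring_hom A (stalk X x)"
    proof -
      have "A.gsec \<in> ring_hom A (sec (Spec A) TA)" by (rule A.gsec_hom)
      moreover have "on_sec F TA \<in> ring_hom (sec (Spec A) TA) (sec X TX)"
        using Fd(3)[OF F openin_topspace] affine_preim_top[OF F] by simp
      ultimately have "germ X x TX \<circ> (on_sec F TA \<circ> A.gsec) \<in> ring_hom A (stalk X x)"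
        using germ_hom[OF openin_topspace xX] by (intro ring_hom_trans)
      then show ?thesis by (simp add: h_def o_def)
    qed
    have u: "h f \<in> Units (stalk X x)" if "f \<in> carrier A - ?p" for f
      using that on_pts_char[OF F xX, of f] by (auto simp: h_def)
    interpret L: localization_lift A "carrier A - ?p" "stalk X x" h
      by (intro localization_lift.intro localization_lift_axioms.intro localization_at_prime[OF on_pts_prime[OF F xX]]
          S.cring_axioms h u)
    obtain a g where ag: "a \<in> carrier A" "g \<in> carrier A" "g \<notin> ?p" "t ?p = A.frp ?p a g"
      "h g \<otimes>\<^bsub>stalk X x\<^esub> germ X x (preim X F V) (on_sec F V t) = h a"
      unfolding h_def by (rule on_sec_char[OF F V t x])
    obtain b k where bk: "b \<in> carrier A" "k \<in> carrier A" "k \<notin> ?p" "t ?p = A.frp ?p b k"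
      "h k \<otimes>\<^bsub>stalk X x\<^esub> germ X x (preim X F V) (on_sec G V t) = h b"
    proof (rule on_sec_char[OF G V t])
      show "x \<in> preim X G V" using x pre by simp
      fix b k assume "b \<in> carrier A" "k \<in> carrier A" "k \<notin> on_pts G x" "t (on_pts G x) = A.frp (on_pts G x) b k"
        "germ X x TX (on_sec G TA (A.gsec k)) \<otimes>\<^bsub>stalk X x\<^esub> germ X x (preim X G V) (on_sec G V t)
          = germ X x TX (on_sec G TA (A.gsec b))"
      then show thesis by (intro that[of b k]) (simp_all add: h_def pts_eq[OF xX] eq pre)
    qed
    have gc: "germ X x (preim X F V) (on_sec F V t) \<in> carrier (stalk X x)" "germ X x (preim X F V) (on_sec G V t) \<in> carrier (stalk X x)"
      using germ_closed[OF o x] c by simp_all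
    have "L.lift (t ?p) = germ X x (preim X F V) (on_sec F V t)"
      unfolding ag(4) using ag gc by (intro L.lift_unique) auto
    moreover have "L.lift (t ?p) = germ X x (preim X F V) (on_sec G V t)"
      unfolding bk(4) using bk gc by (intro L.lift_unique) auto
    ultimately show "germ X x (preim X F V) (on_sec F V t) = germ X x (preim X F V) (on_sec G V t)" by simp
  qed
qed

section \<open>The morphism to an affine scheme that belongs to a ring homomorphism on global
  sections\<close>

context
  fixes \<psi> assumes psi: "\<psi> \<in> ring_hom A (sec X TX)"
begin

definition gh where "gh x a = germ X x TX (\<psi> a)"
text \<open>The preimage of the maximal ideal of the stalk at \<open>x\<close>; by
  \<open>on_pts_char\<close> it is the only candidate for the image of \<open>x\<close>.\<close>

definition pt where "pt x = {a \<in> carrier A. gh x a \<notin> Units (stalk X x)}"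
definition pre where "pre V = {x \<in> TX. pt x \<in> V}"
definition val where
  "val x z = localization_lift.lift A (carrier A - pt x) (stalk X x) (gh x) z"

lemma gh_hom: "x \<in> TX \<Longrightarrow> gh x \<in> ring_hom A (stalk X x)"
  using ring_hom_trans[OF psi germ_hom[OF openin_topspace, of x]] by (simp add: gh_def[abs_def] o_def)

lemma pt_prime:
  assumes x: "x \<in> TX" shows "primeideal (pt x) A"
proof -
  interpret S: cring "stalk X x" by (rule stalk_cring[OF x])
  interpret h: ring_hom_ring A "stalk X x" "gh x"
    by (intro ring_hom_ringI2 A.ring_axioms S.ring_axioms gh_hom[OF x])
  have "primeideal (carrier (stalk X x) - Units (stalk X x)) (stalk X x)"
    by (rule S.maximalideal_prime[OF local_ring_nonunits[OF stalk_local[OF x]]])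
  from h.primeideal_vimage[OF A.cring_axioms this]
  have "primeideal {r \<in> carrier A. gh x r \<in> carrier (stalk X x) - Units (stalk X x)} A" .
  moreover have "{r \<in> carrier A. gh x r \<in> carrier (stalk X x) - Units (stalk X x)} = pt x"
    unfolding pt_def using ring_hom_closed[OF gh_hom[OF x]] by blast
  ultimately show ?thesis by simp
qed

lemma gh_Units: "a \<in> carrier A \<Longrightarrow> a \<notin> pt x \<longleftrightarrow> gh x a \<in> Units (stalk X x)"
  by (auto simp: pt_def)

lemma pt_lift: "x \<in> TX \<Longrightarrow> localization_lift A (carrier A - pt x) (stalk X x) (gh x)"
  by (intro localization_lift.intro localization_lift_axioms.intro localization_at_prime[OF pt_prime]
      stalk_cring gh_hom) (auto simp: gh_Units)

lemma val_hom: "x \<in> TX \<Longrightarrow> val x \<in> ring_hom (stalk_ring A (pt x)) (stalk X x)"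
  unfolding val_def[abs_def]
  by (rule localization_lift.lift_hom[OF pt_lift])

lemma val_unique:
  assumes x: "x \<in> TX" and "a \<in> carrier A" "g \<in> carrier A" "g \<notin> pt x" "y \<in> carrier (stalk X x)"
    "gh x g \<otimes>\<^bsub>stalk X x\<^esub> y = gh x a"
  shows "val x (A.frp (pt x) a g) = y"
  unfolding val_def
  by (rule localization_lift.lift_unique[OF pt_lift[OF x]]) (use assms in auto)

lemma val_eq:
  assumes x: "x \<in> TX" and "a \<in> carrier A" "g \<in> carrier A" "g \<notin> pt x"
  shows "gh x g \<otimes>\<^bsub>stalk X x\<^esub> val x (A.frp (pt x) a g) = gh x a"
  unfolding val_def
  by (rule localization_lift.lift_fraction_eq[OF pt_lift[OF x]]) (use assms in auto)

text \<open>If \<open>\<psi> f\<close> is invertible at \<open>x\<close>, it is so on a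
  neighbourhood, where \<open>f\<close> stays outside the primes \<open>pt y\<close>. The first fact
  makes fractions with denominator \<open>f\<close> into sections, the second makes
  \<open>pt\<close> continuous.\<close>

lemma psi_unit_nbhd:
  assumes x: "x \<in> TX" and f: "f \<in> carrier A" "f \<notin> pt x"
  obtains W t where "opn W" "x \<in> W" "t \<in> Sc W" "res X TX W (\<psi> f) \<otimes>\<^bsub>sec X W\<^esub> t = \<one>\<^bsub>sec X W\<^esub>"
    "\<And>y. y \<in> W \<Longrightarrow> f \<notin> pt y"
proof -
  have pf: "\<psi> f \<in> Sc TX" using ring_hom_closed[OF psi f(1)] .
  have "germ X x TX (\<psi> f) \<in> Units (stalk X x)" using f by (simp add: gh_Units gh_def)
  then obtain W t where W: "opn W" "x \<in> W" "W \<subseteq> TX" "t \<in> Sc W" "res X TX W (\<psi> f) \<otimes>\<^bsub>sec X W\<^esub> t = \<one>\<^bsub>sec X W\<^esub>"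
    using germ_Units_iff[OF openin_topspace x pf] by blast
  have "f \<notin> pt y" if "y \<in> W" for y
  proof -
    have "y \<in> TX" using W that by blast
    then have "germ X y TX (\<psi> f) \<in> Units (stalk X y)"
      using W that germ_Units_iff[OF openin_topspace _ pf] by blast
    then show ?thesis using f by (simp add: gh_Units gh_def)
  qed
  then show thesis using that W by blast
qed

lemma pre_open: "openin (zariski A) V \<Longrightarrow> opn (pre V)"
proof (subst openin_subopen, intro ballI)
  fix x assume V: "openin (zariski A) V" and "x \<in> pre V"
  then have x: "x \<in> TX" "pt x \<in> V" by (auto simp: pre_def)
  obtain f where f: "f \<in> carrier A" "f \<notin> pt x" "{q. primeideal q A \<and> f \<notin> q} \<subseteq> V"
    using A.openin_zariski_basic[OF V x(2)] .
  obtain W t where W: "opn W" "x \<in> W" "\<And>y. y \<in> W \<Longrightarrow> f \<notin> pt y"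
    using psi_unit_nbhd[OF x(1) f(1,2)] by metis
  have "W \<subseteq> pre V" using W f openin_subset[OF W(1)] pt_prime by (auto simp: pre_def)
  then show "\<exists>T. opn T \<and> x \<in> T \<and> T \<subseteq> pre V" using W by blast
qed

text \<open>The pullback of \<open>t\<close> is prescribed by its germs. Where \<open>t\<close> is
  \<open>a / g\<close> and \<open>r\<close> is an inverse of \<open>\<psi> g\<close>, the section
  \<open>\<psi> a\<close> times \<open>r\<close> has these germs, because it solves the equation
  that characterizes \<open>val\<close>. Such local sections glue.\<close>

lemma val_section_exists:
  assumes V: "openin (zariski A) V" and t: "t \<in> spec_sections A V"
  shows "\<exists>!u. u \<in> Sc (pre V) \<and> (\<forall>x\<in>pre V. germ X x (pre V) u = val x (t (pt x)))"
proof -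
  note o = pre_open[OF V]
  have "\<exists>W s. opn W \<and> x \<in> W \<and> W \<subseteq> pre V \<and> s \<in> Sc W \<and> (\<forall>y\<in>W. germ X y W s = val y (t (pt y)))"
    if x: "x \<in> pre V" for x
  proof -
    have xX: "x \<in> TX" and xV: "pt x \<in> V" using x by (auto simp: pre_def)
    obtain V' a g where V': "openin (zariski A) V'" "pt x \<in> V'" "V' \<subseteq> V" "a \<in> carrier A" "g \<in> carrier A"
      "\<And>q. q \<in> V' \<Longrightarrow> g \<notin> q" "\<And>q. q \<in> V' \<Longrightarrow> t q = A.frp q a g" by (rule A.spec_sectionsE[OF t xV]) blast
    obtain W r where W: "opn W" "x \<in> W" "r \<in> Sc W" "res X TX W (\<psi> g) \<otimes>\<^bsub>sec X W\<^esub> r = \<one>\<^bsub>sec X W\<^esub>"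
      using psi_unit_nbhd[OF xX V'(5) V'(6)[OF V'(2)]] by metis
    have WT: "W \<subseteq> TX" using openin_subset[OF W(1)] .
    let ?N = "W \<inter> pre V'"
    have N: "opn ?N" "x \<in> ?N" "?N \<subseteq> pre V" using W V' pre_open[OF V'(1)] xX by (auto simp: pre_def)
    have pa: "\<psi> a \<in> Sc TX" and pg: "\<psi> g \<in> Sc TX" using ring_hom_closed[OF psi] V' by auto
    have c: "res X TX W (\<psi> a) \<in> Sc W" "res X TX W (\<psi> g) \<in> Sc W"
      using res_closed[OF openin_topspace W(1) WT] pa pg by auto
    interpret W: cring "sec X W" by (rule sec_cring[OF W(1)])
    let ?s = "res X W ?N (res X TX W (\<psi> a) \<otimes>\<^bsub>sec X W\<^esub> r)"
    have sc: "?s \<in> Sc ?N" using c W N by (intro res_closed) auto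
    have "germ X y ?N ?s = val y (t (pt y))" if y: "y \<in> ?N" for y
    proof -
      have yX: "y \<in> TX" and yV: "pt y \<in> V'" and yW: "y \<in> W" using y by (auto simp: pre_def)
      have e: "res X TX W (\<psi> g) \<otimes>\<^bsub>sec X W\<^esub> (res X TX W (\<psi> a) \<otimes>\<^bsub>sec X W\<^esub> r) = res X TX W (\<psi> a)"
        using c W by (simp add: W.m_lcomm[of _ "res X TX W (\<psi> a)"])
      have "germ X y ?N ?s = germ X y W (res X TX W (\<psi> a) \<otimes>\<^bsub>sec X W\<^esub> r)"
        using N W c y by (intro germ_res) auto
      moreover have "germ X y W (res X TX W (\<psi> g)) \<otimes>\<^bsub>stalk X y\<^esub> germ X y W (res X TX W (\<psi> a) \<otimes>\<^bsub>sec X W\<^esub> r)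
          = germ X y W (res X TX W (\<psi> a))"
        using W c yW e by (simp add: germ_mult)
      ultimately have "gh y g \<otimes>\<^bsub>stalk X y\<^esub> germ X y ?N ?s = gh y a"
        using W WT yW pa pg by (simp add: gh_def germ_res)
      moreover have "germ X y ?N ?s \<in> carrier (stalk X y)" using germ_closed[OF N(1) y sc] .
      ultimately have "val y (A.frp (pt y) a g) = germ X y ?N ?s"
        using V' yV by (intro val_unique[OF yX]) auto
      then show ?thesis using V'(7)[OF yV] by simp
    qed
    then show ?thesis using N sc by (intro exI[of _ ?N] exI[of _ ?s]) auto
  qed
  from glue_germs[OF o this] obtain u where "u \<in> Sc (pre V)" "\<And>x. x \<in> pre V \<Longrightarrow> germ X x (pre V) u = val x (t (pt x))"
    by metis
  moreover have "u = u'" if "u \<in> Sc (pre V)" "u' \<in> Sc (pre V)"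
    "\<forall>x\<in>pre V. germ X x (pre V) u = val x (t (pt x))" "\<forall>x\<in>pre V. germ X x (pre V) u' = val x (t (pt x))" for u u'
    using that by (intro section_eqI[OF o]) auto
  ultimately show ?thesis by blast
qed

definition adj_mor :: "('p, 's, 'a set, 'a set \<Rightarrow> ('a \<times> 'a) set) rs_mor" where
  "adj_mor = \<lparr>on_pts = (\<lambda>x\<in>TX. pt x),
     on_sec = (\<lambda>V\<in>{V. openin (zariski A) V}. \<lambda>t\<in>spec_sections A V.
       THE u. u \<in> Sc (pre V) \<and> (\<forall>x\<in>pre V. germ X x (pre V) u = val x (t (pt x))))\<rparr>"

lemma preim_adj: "preim X adj_mor V = pre V"
  by (auto simp: preim_def pre_def adj_mor_def)

lemma on_sec_adj:
  assumes V: "openin (zariski A) V" and t: "t \<in> spec_sections A V"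
  shows "on_sec adj_mor V t \<in> Sc (pre V)"
    and "x \<in> pre V \<Longrightarrow> germ X x (pre V) (on_sec adj_mor V t) = val x (t (pt x))"
  using theI'[OF val_section_exists[OF V t]] V t by (simp_all add: adj_mor_def)

text \<open>Sections over \<open>pre V\<close> are compared by their germs. There the homomorphism
  properties become those of \<open>val x\<close>, and restriction leaves the prescribed germs
  unchanged.\<close>

lemma adj_mor_presheaf_hom: "adj_mor \<in> presheaf_hom X (Spec A)"
  unfolding presheaf_hom_def mem_Collect_eq preim_adj A.sec_Spec(1,7)
proof (intro conjI allI impI ballI)
  show "continuous_map (pts X) (zariski A) (on_pts adj_mor)"
    unfolding continuous_map_def
  proof (intro conjI allI impI)
    show "on_pts adj_mor \<in> TX \<rightarrow> TA" by (auto simp: adj_mor_def A.topspace_zariski pt_prime)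
    fix V assume "openin (zariski A) V"
    moreover have "{x \<in> TX. on_pts adj_mor x \<in> V} = pre V" by (auto simp: adj_mor_def pre_def)
    ultimately show "opn {x \<in> TX. on_pts adj_mor x \<in> V}" using pre_open by simp
  qed
  show "on_pts adj_mor \<in> extensional TX" "on_sec adj_mor \<in> extensional {V. openin (zariski A) V}"
    by (simp_all add: adj_mor_def)
  fix V assume V: "openin (zariski A) V"
  note o = pre_open[OF V]
  interpret Sp: cring "sec (Spec A) V" by (rule A.sec_Spec_cring[OF V])
  interpret SX: cring "sec X (pre V)" by (rule sec_cring[OF o])
  note cl = on_sec_adj(1)[OF V] and gm = on_sec_adj(2)[OF V]
  have "on_sec adj_mor V \<in> ring_hom (sec (Spec A) V) (sec X (pre V))"
  proof (rule ring_hom_memI, unfold A.sec_Spec(1))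
    fix s t assume s: "s \<in> spec_sections A V" and t: "t \<in> spec_sections A V"
    have st: "s \<otimes>\<^bsub>sec (Spec A) V\<^esub> t \<in> spec_sections A V" "s \<oplus>\<^bsub>sec (Spec A) V\<^esub> t \<in> spec_sections A V"
      using Sp.m_closed Sp.a_closed s t by (auto simp: A.sec_Spec(1))
    have *: "x \<in> TX" "pt x \<in> V" "s (pt x) \<in> carrier (stalk_ring A (pt x))" "t (pt x) \<in> carrier (stalk_ring A (pt x))"
      if "x \<in> pre V" for x
      using that A.spec_sections_closed s t by (auto simp: pre_def)
    show "on_sec adj_mor V (s \<otimes>\<^bsub>sec (Spec A) V\<^esub> t) = on_sec adj_mor V s \<otimes>\<^bsub>sec X (pre V)\<^esub> on_sec adj_mor V t"
    proof (rule section_eqI[OF o])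
      fix x assume x: "x \<in> pre V"
      show "germ X x (pre V) (on_sec adj_mor V (s \<otimes>\<^bsub>sec (Spec A) V\<^esub> t)) =
          germ X x (pre V) (on_sec adj_mor V s \<otimes>\<^bsub>sec X (pre V)\<^esub> on_sec adj_mor V t)"
        unfolding germ_mult[OF o x cl[OF s] cl[OF t], symmetric] gm[OF st(1) x] gm[OF s x] gm[OF t x]
        using *(2)[OF x] ring_hom_mult[OF val_hom[OF *(1)[OF x]] *(3,4)[OF x]] by (simp add: A.sec_Spec(2))
    qed (use cl s t st in auto)
    show "on_sec adj_mor V (s \<oplus>\<^bsub>sec (Spec A) V\<^esub> t) = on_sec adj_mor V s \<oplus>\<^bsub>sec X (pre V)\<^esub> on_sec adj_mor V t"
    proof (rule section_eqI[OF o])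
      fix x assume x: "x \<in> pre V"
      show "germ X x (pre V) (on_sec adj_mor V (s \<oplus>\<^bsub>sec (Spec A) V\<^esub> t)) =
          germ X x (pre V) (on_sec adj_mor V s \<oplus>\<^bsub>sec X (pre V)\<^esub> on_sec adj_mor V t)"
        unfolding germ_add[OF o x cl[OF s] cl[OF t], symmetric] gm[OF st(2) x] gm[OF s x] gm[OF t x]
        using *(2)[OF x] ring_hom_add[OF val_hom[OF *(1)[OF x]] *(3,4)[OF x]] by (simp add: A.sec_Spec(3))
    qed (use cl s t st in auto)
  next
    show "on_sec adj_mor V \<one>\<^bsub>sec (Spec A) V\<^esub> = \<one>\<^bsub>sec X (pre V)\<^esub>"
    proof (rule section_eqI[OF o])
      fix x assume x: "x \<in> pre V"
      then have "x \<in> TX" "pt x \<in> V" by (auto simp: pre_def)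
      then show "germ X x (pre V) (on_sec adj_mor V \<one>\<^bsub>sec (Spec A) V\<^esub>) = germ X x (pre V) \<one>\<^bsub>sec X (pre V)\<^esub>"
        using gm[OF A.spec_one_closed[OF V] x] ring_hom_one[OF val_hom, of x]
        by (simp add: germ_one[OF o x] A.sec_Spec(4))
    qed (use cl A.spec_one_closed[OF V] in auto)
  qed (rule cl)
  moreover have "on_sec adj_mor V \<in> extensional (spec_sections A V)" using V by (simp add: adj_mor_def)
  ultimately show "on_sec adj_mor V \<in> ring_hom (sec (Spec A) V) (sec X (pre V)) \<inter> extensional (spec_sections A V)" by blast
next
  fix V W t assume VW: "openin (zariski A) V \<and> openin (zariski A) W \<and> W \<subseteq> V" and t: "t \<in> spec_sections A V"
  then have V: "openin (zariski A) V" and W: "openin (zariski A) W" "W \<subseteq> V" by auto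
  have sub: "pre W \<subseteq> pre V" using W by (auto simp: pre_def)
  have rt: "res (Spec A) V W t \<in> spec_sections A W"
    using A.restrict_spec_section[OF V W t] by (simp add: A.sec_Spec)
  show "on_sec adj_mor W (res (Spec A) V W t) = res X (pre V) (pre W) (on_sec adj_mor V t)"
  proof (rule section_eqI[OF pre_open[OF W(1)]])
    show "on_sec adj_mor W (res (Spec A) V W t) \<in> Sc (pre W)" by (rule on_sec_adj(1)[OF W(1) rt])
    show "res X (pre V) (pre W) (on_sec adj_mor V t) \<in> Sc (pre W)"
      by (rule res_closed[OF pre_open[OF V] pre_open[OF W(1)] sub on_sec_adj(1)[OF V t]])
    fix x assume x: "x \<in> pre W"
    then have "pt x \<in> W" by (simp add: pre_def)
    then show "germ X x (pre W) (on_sec adj_mor W (res (Spec A) V W t)) = germ X x (pre W) (res X (pre V) (pre W) (on_sec adj_mor V t))"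
      using x sub on_sec_adj(2)[OF W(1) rt x] on_sec_adj(2)[OF V t, of x]
        germ_res[OF pre_open[OF V] pre_open[OF W(1)] sub x on_sec_adj(1)[OF V t]]
      by (auto simp: A.sec_Spec(6))
  qed
qed

text \<open>For \<open>t = a / g\<close> at \<open>pt x\<close>, the product of the unit
  \<open>gh x g\<close> with the germ of the pullback is \<open>gh x a\<close>. If that germ is a
  unit, then so is \<open>gh x a\<close>, which puts \<open>a\<close> outside
  \<open>pt x\<close>.\<close>

lemma adj_mor_lrs_hom: "adj_mor \<in> lrs_hom X (Spec A)"
  unfolding lrs_hom_iff[OF local_presheaf_X A.local_presheaf_Spec] preim_adj A.sec_Spec(1,7)
proof (intro conjI adj_mor_presheaf_hom ballI allI impI)
  fix x V t assume x: "x \<in> TX" and *: "openin (zariski A) V \<and> on_pts adj_mor x \<in> V \<and> t \<in> spec_sections A V \<and>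
      germ X x (pre V) (on_sec adj_mor V t) \<in> Units (stalk X x)"
  have px: "on_pts adj_mor x = pt x" using x by (simp add: adj_mor_def)
  have V: "openin (zariski A) V" "pt x \<in> V" and t: "t \<in> spec_sections A V" using * px by auto
  interpret S: cring "stalk X x" by (rule stalk_cring[OF x])
  have xV: "x \<in> pre V" using x V by (simp add: pre_def)
  have u: "val x (t (pt x)) \<in> Units (stalk X x)" using * on_sec_adj(2)[OF V(1) t xV] by simp
  obtain a g where ag: "a \<in> carrier A" "g \<in> carrier A" "g \<notin> pt x" "t (pt x) = A.frp (pt x) a g"
    using A.spec_sectionsE[OF t V(2)] V(2) by metis
  have "gh x g \<in> Units (stalk X x)" using ag gh_Units by simp
  then have "gh x a \<in> Units (stalk X x)"
    using u val_eq[OF x ag(1-3)] S.Units_m_closed ag(4) by metis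
  then have "a \<notin> pt x" using ag gh_Units by simp
  then show "germ (Spec A) (on_pts adj_mor x) V t \<in> Units (stalk (Spec A) (on_pts adj_mor x))"
    unfolding px A.Spec_germ_Units_iff[OF V t] ag(4) using A.stalk_ring_Units_iff[OF pt_prime[OF x] ag(1-3)] by simp
qed

lemma adj_mor_gsec:
  assumes a: "a \<in> carrier A" shows "on_sec adj_mor TA (A.gsec a) = \<psi> a"
proof -
  have pT: "pre TA = TX" using pt_prime by (auto simp: pre_def A.topspace_zariski)
  note o = on_sec_adj[OF openin_topspace A.gsec_closed[OF a], unfolded pT]
  show ?thesis
  proof (rule section_eqI[OF openin_topspace o(1) ring_hom_closed[OF psi a]])
    fix x assume x: "x \<in> TX"
    interpret S: cring "stalk X x" by (rule stalk_cring[OF x])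
    have "gh x \<one>\<^bsub>A\<^esub> = \<one>\<^bsub>stalk X x\<^esub>" using ring_hom_one[OF gh_hom[OF x]] .
    then have "val x (A.frp (pt x) a \<one>\<^bsub>A\<^esub>) = gh x a"
      using a A.prime_not_one[OF pt_prime[OF x]] ring_hom_closed[OF gh_hom[OF x] a]
      by (intro val_unique[OF x]) auto
    then show "germ X x TX (on_sec adj_mor TA (A.gsec a)) = germ X x TX (\<psi> a)"
      using o(2)[OF x] A.gsec_apply[OF pt_prime[OF x]] by (simp add: gh_def)
  qed
qed

end

lemma affine_hom_exists:
  assumes "\<psi> \<in> ring_hom A (sec X TX)"
  obtains F where "F \<in> lrs_hom X (Spec A)" "\<And>a. a \<in> carrier A \<Longrightarrow> on_sec F TA (A.gsec a) = \<psi> a"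
  using adj_mor_lrs_hom[OF assms] adj_mor_gsec[OF assms] that by blast

end

section \<open>Polynomial rings\<close>

text \<open>\<^const>\<open>mpoly_ring\<close> is only defined over rings without further record fields.\<close>

locale base_ring = cring R for R :: "'k ring" (structure)
begin

lemma mpoly_coeff: "f \<in> carrier (mpoly_ring R I) \<Longrightarrow> f m \<in> carrier R"
  using indexed_pset_in_carrier[of "carrier R" f I] by (simp add: mpoly_ring_def carrier_coeff_def)

lemma mpoly_simps:
  "f \<oplus>\<^bsub>mpoly_ring R I\<^esub> g = indexed_padd f g"
  "\<one>\<^bsub>mpoly_ring R I\<^esub> = indexed_const \<one>"
  "\<zero>\<^bsub>mpoly_ring R I\<^esub> = indexed_const \<zero>"
  by (simp_all add: mpoly_ring_def)

lemma mpoly_const_closed: "c \<in> carrier R \<Longrightarrow> indexed_const c \<in> carrier (mpoly_ring R I)"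
  and mpoly_add_closed: "f \<in> carrier (mpoly_ring R I) \<Longrightarrow> g \<in> carrier (mpoly_ring R I) \<Longrightarrow>
    indexed_padd f g \<in> carrier (mpoly_ring R I)"
  and mpoly_pmult_closed: "f \<in> carrier (mpoly_ring R I) \<Longrightarrow> i \<in> I \<Longrightarrow>
    indexed_pmult f i \<in> carrier (mpoly_ring R I)"
  by (auto simp: mpoly_ring_def intro: indexed_pset.intros)

lemma mpoly_var_closed: "i \<in> I \<Longrightarrow> indexed_var i \<in> carrier (mpoly_ring R I)"
  unfolding indexed_var_def by (simp add: mpoly_const_closed mpoly_pmult_closed)

text \<open>Polynomials are generated by constants, sums and multiplication by a variable. This
  induction takes the place of a normal form in the proofs about products and evaluation.\<close>

lemma mpoly_induct [consumes 1, case_names const add pmult]: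
  assumes "f \<in> carrier (mpoly_ring R I)"
    and "\<And>c. c \<in> carrier R \<Longrightarrow> Q (indexed_const c)"
    and "\<And>f g. f \<in> carrier (mpoly_ring R I) \<Longrightarrow> Q f \<Longrightarrow> g \<in> carrier (mpoly_ring R I) \<Longrightarrow> Q g \<Longrightarrow>
      Q (indexed_padd f g)"
    and "\<And>f i. f \<in> carrier (mpoly_ring R I) \<Longrightarrow> Q f \<Longrightarrow> i \<in> I \<Longrightarrow> Q (indexed_pmult f i)"
  shows "Q f"
proof -
  have "f \<in> indexed_pset I (carrier R)" using assms(1) by (simp add: mpoly_ring_def)
  then show ?thesis
    by (induction rule: indexed_pset.induct) (use assms(2-4) in \<open>auto simp: mpoly_ring_def\<close>)
qed

lemma mpoly_finite_support:
  "f \<in> carrier (mpoly_ring R I) \<Longrightarrow> finite {m. f m \<noteq> \<zero>}"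
proof (induction rule: mpoly_induct)
  case (const c)
  have "{m. indexed_const c m \<noteq> \<zero>} \<subseteq> {{#}}" by (auto simp: indexed_const_def)
  then show ?case by (rule finite_subset) simp
next
  case (add f g)
  have "{m. indexed_padd f g m \<noteq> \<zero>} \<subseteq> {m. f m \<noteq> \<zero>} \<union> {m. g m \<noteq> \<zero>}"
    by (auto simp: indexed_padd_def)
  then show ?case by (rule finite_subset) (use add in simp)
next
  case (pmult f i)
  have "{m. indexed_pmult f i m \<noteq> \<zero>} \<subseteq> add_mset i ` {m. f m \<noteq> \<zero>}"
  proof
    fix m assume "m \<in> {m. indexed_pmult f i m \<noteq> \<zero>}"
    then have "i \<in># m" "f (m - {#i#}) \<noteq> \<zero>" by (auto simp: indexed_pmult_def split: if_splits)
    then show "m \<in> add_mset i ` {m. f m \<noteq> \<zero>}" by (intro image_eqI[of _ _ "m - {#i#}"]) auto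
  qed
  then show ?case by (rule finite_subset) (use pmult in simp)
qed

text \<open>The coefficients of a product of polynomials are sums over these sets; finiteness allows
  single terms to be isolated and vanishing terms to be dropped.\<close>

lemma finite_submultisets: "finite {a. a \<subseteq># (m :: nat multiset)}"
proof (induction m)
  case (add x m)
  have "{a. a \<subseteq># add_mset x m} \<subseteq> {a. a \<subseteq># m} \<union> add_mset x ` {a. a \<subseteq># m}"
  proof
    fix a assume a: "a \<in> {a. a \<subseteq># add_mset x m}"
    show "a \<in> {a. a \<subseteq># m} \<union> add_mset x ` {a. a \<subseteq># m}"
    proof (cases "x \<in># a")
      case True
      then have "a = add_mset x (a - {#x#})" by simp
      moreover from this have "a - {#x#} \<subseteq># m" using a by (metis mem_Collect_eq mset_subset_eq_add_mset_cancel)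
      ultimately show ?thesis by blast
    next
      case False
      have "count a y \<le> count m y" for y
        using a False mset_subset_eq_count[of a "add_mset x m" y] by (cases "y = x") (auto simp: not_in_iff)
      then have "a \<subseteq># m" by (simp add: subseteq_mset_def)
      then show ?thesis by simp
    qed
  qed
  then show ?case by (rule finite_subset) (use add in simp)
qed simp

lemma diff_diff_submultiset: "a \<subseteq># m \<Longrightarrow> m - (m - a) = (a :: nat multiset)"
  by (auto simp: multiset_eq_iff subseteq_mset_def)

text \<open>The product of \<open>mpoly_ring\<close> as an operation on all coefficient functions,
  in which the index set does not occur.\<close>

definition conv :: "(nat multiset \<Rightarrow> 'k) \<Rightarrow> (nat multiset \<Rightarrow> 'k) \<Rightarrow> nat multiset \<Rightarrow> 'k" (infixl \<open>\<star>\<close> 70)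
  where "f \<star> g = (\<lambda>m. \<Oplus>a\<in>{a. a \<subseteq># m}. f a \<otimes> g (m - a))"

lemma mpoly_mult: "f \<otimes>\<^bsub>mpoly_ring R I\<^esub> g = f \<star> g"
  by (simp add: mpoly_ring_def conv_def)

lemma pm_const:
  assumes "c \<in> carrier R" "\<And>m. g m \<in> carrier R" shows "indexed_const c \<star> g = (\<lambda>m. c \<otimes> g m)"
proof
  fix m :: "nat multiset"
  have "(\<Oplus>a\<in>{a. a \<subseteq># m}. indexed_const c a \<otimes> g (m - a)) = (\<Oplus>a\<in>{a. a \<subseteq># m}. if {#} = a then c \<otimes> g (m - a) else \<zero>)"
    using assms by (intro finsum_cong') (auto simp: indexed_const_def)
  also have "\<dots> = c \<otimes> g m"
    using assms finite_submultisets[of m]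
    by (subst finsum_singleton[of "{#}" "{a. a \<subseteq># m}" "\<lambda>a. c \<otimes> g (m - a)"]) auto
  finally show "(indexed_const c \<star> g) m = c \<otimes> g m" unfolding conv_def .
qed

lemma pm_add:
  assumes "\<And>m. f m \<in> carrier R" "\<And>m. f' m \<in> carrier R" "\<And>m. g m \<in> carrier R"
  shows "indexed_padd f f' \<star> g = indexed_padd (f \<star> g) (f' \<star> g)"
proof
  fix m :: "nat multiset"
  have "(indexed_padd f f' \<star> g) m = (\<Oplus>a\<in>{a. a \<subseteq># m}. f a \<otimes> g (m - a) \<oplus> f' a \<otimes> g (m - a))"
    unfolding conv_def using assms by (intro finsum_cong') (auto simp: indexed_padd_def l_distr)
  also have "\<dots> = indexed_padd (f \<star> g) (f' \<star> g) m"
    unfolding indexed_padd_def conv_def using assms by (intro finsum_addf) auto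
  finally show "(indexed_padd f f' \<star> g) m = indexed_padd (f \<star> g) (f' \<star> g) m" .
qed

text \<open>Only submultisets of \<open>m\<close> that contain \<open>i\<close> contribute. Removing
  one \<open>i\<close> identifies them with the submultisets of \<open>m - {#i#}\<close>, if
  \<open>i\<close> occurs in \<open>m\<close> at all.\<close>

lemma pm_pmult:
  assumes "\<And>m. f m \<in> carrier R" "\<And>m. g m \<in> carrier R"
  shows "indexed_pmult f i \<star> g = indexed_pmult (f \<star> g) i"
proof
  fix m :: "nat multiset"
  let ?A = "{a. a \<subseteq># m}" and ?B = "{a. a \<subseteq># m \<and> i \<in># a}"
  have "(indexed_pmult f i \<star> g) m = (\<Oplus>a\<in>?B. f (a - {#i#}) \<otimes> g (m - a))"
    unfolding conv_def using assms finite_submultisets[of m]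
    by (intro add.finprod_mono_neutral_cong_right) (auto simp: indexed_pmult_def Pi_iff)
  also have "\<dots> = indexed_pmult (f \<star> g) i m"
  proof (cases "i \<in># m")
    case True
    have B: "?B = add_mset i ` {a. a \<subseteq># m - {#i#}}"
    proof (intro equalityI subsetI)
      fix a assume "a \<in> ?B"
      then have "a = add_mset i (a - {#i#})" "a - {#i#} \<subseteq># m - {#i#}" by (auto simp: subseteq_mset_def diff_le_mono)
      then show "a \<in> add_mset i ` {a. a \<subseteq># m - {#i#}}" by blast
    next
      fix a assume "a \<in> add_mset i ` {a. a \<subseteq># m - {#i#}}"
      then show "a \<in> ?B" using True by (auto simp: insert_subset_eq_iff)
    qed
    have "(\<Oplus>a\<in>?B. f (a - {#i#}) \<otimes> g (m - a)) = (\<Oplus>a\<in>{a. a \<subseteq># m - {#i#}}. f a \<otimes> g (m - add_mset i a))"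
      unfolding B using assms by (subst finsum_reindex) (auto simp: inj_on_def)
    also have "\<dots> = (f \<star> g) (m - {#i#})" unfolding conv_def using assms by (intro finsum_cong') auto
    finally show ?thesis using True by (simp add: indexed_pmult_def)
  next
    case False
    then have "?B = {}" by (auto dest: mset_subset_eqD)
    then show ?thesis using False by (simp only: finsum_empty) (simp add: indexed_pmult_def)
  qed
  finally show "(indexed_pmult f i \<star> g) m = indexed_pmult (f \<star> g) i m" .
qed

text \<open>Complementation \<open>a \<mapsto> m - a\<close> is an involution of the submultisets of
  \<open>m\<close> that exchanges the two factors.\<close>

lemma pm_comm:
  assumes "\<And>m. f m \<in> carrier R" "\<And>m. g m \<in> carrier R" shows "f \<star> g = g \<star> f"
proof
  fix m :: "nat multiset"
  have img: "(\<lambda>a. m - a) ` {a. a \<subseteq># m} = {a. a \<subseteq># m}"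
  proof (intro equalityI subsetI)
    fix a assume "a \<in> {a. a \<subseteq># m}"
    then have "a = m - (m - a)" "m - a \<in> {a. a \<subseteq># m}" by (auto simp: diff_diff_submultiset)
    then show "a \<in> (\<lambda>a. m - a) ` {a. a \<subseteq># m}" by blast
  qed auto
  have inj: "inj_on (\<lambda>a. m - a) {a. a \<subseteq># m}"
    by (rule inj_on_inverseI[of _ "\<lambda>a. m - a"]) (auto simp: diff_diff_submultiset)
  have "(f \<star> g) m = (\<Oplus>a\<in>(\<lambda>a. m - a) ` {a. a \<subseteq># m}. f a \<otimes> g (m - a))" unfolding img conv_def ..
  also have "\<dots> = (\<Oplus>a\<in>{a. a \<subseteq># m}. f (m - a) \<otimes> g (m - (m - a)))"
    using assms inj by (intro finsum_reindex) auto
  also have "\<dots> = (g \<star> f) m"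
    unfolding conv_def using assms by (intro finsum_cong') (auto simp: diff_diff_submultiset m_comm)
  finally show "(f \<star> g) m = (g \<star> f) m" .
qed

lemma pm_coeff:
  "(\<And>m. f m \<in> carrier R) \<Longrightarrow> (\<And>m. g m \<in> carrier R) \<Longrightarrow> (f \<star> g) m \<in> carrier R"
  unfolding conv_def by (intro finsum_closed) auto

text \<open>The carrier is generated inductively, so the product has to be built up again from the
  generators. The rules for the left factor do this down to constants, where a second induction on
  \<open>g\<close> takes over.\<close>

lemma mpoly_mult_closed:
  assumes f: "f \<in> carrier (mpoly_ring R I)" and g: "g \<in> carrier (mpoly_ring R I)"
  shows "f \<star> g \<in> carrier (mpoly_ring R I)"
  using f
proof (induction rule: mpoly_induct)
  case (const c)
  have "(\<lambda>m. c \<otimes> g m) \<in> carrier (mpoly_ring R I)"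
    using g
  proof (induction rule: mpoly_induct)
    case (const d)
    have "(\<lambda>m. c \<otimes> indexed_const d m) = (indexed_const (c \<otimes> d) :: nat multiset \<Rightarrow> 'k)"
      using \<open>c \<in> carrier R\<close> by (auto simp: indexed_const_def)
    then show ?case using mpoly_const_closed[of "c \<otimes> d" I] const \<open>c \<in> carrier R\<close> by simp
  next
    case (add p q)
    have "(\<lambda>m. c \<otimes> indexed_padd p q m) = indexed_padd (\<lambda>m. c \<otimes> p m) (\<lambda>m. c \<otimes> q m)"
      using add mpoly_coeff \<open>c \<in> carrier R\<close> by (auto simp: indexed_padd_def r_distr)
    then show ?case using mpoly_add_closed add by simp
  next
    case (pmult p i)
    have "(\<lambda>m. c \<otimes> indexed_pmult p i m) = indexed_pmult (\<lambda>m. c \<otimes> p m) i"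
      using \<open>c \<in> carrier R\<close> by (auto simp: indexed_pmult_def)
    then show ?case using mpoly_pmult_closed pmult by simp
  qed
  then show ?case using const g by (simp add: pm_const mpoly_coeff)
next
  case (add p q)
  then show ?case using g by (simp add: pm_add mpoly_coeff mpoly_add_closed)
next
  case (pmult p i)
  then show ?case using g by (simp add: pm_pmult mpoly_coeff mpoly_pmult_closed)
qed

text \<open>Induction on the first factor leaves only the case of a constant, which avoids sums over
  chains of submultisets.\<close>

lemma pm_assoc:
  assumes f: "f \<in> carrier (mpoly_ring R I)" and g: "\<And>m. g m \<in> carrier R" and h: "\<And>m. h m \<in> carrier R"
  shows "(f \<star> g) \<star> h = f \<star> (g \<star> h)"
  using f
proof (induction rule: mpoly_induct)
  case (const c)
  have "((\<lambda>m. c \<otimes> g m) \<star> h) m = c \<otimes> (g \<star> h) m" for m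
    unfolding conv_def using const g h finite_submultisets[of m]
    by (subst finsum_rdistr) (auto intro!: finsum_cong' simp: m_assoc)
  then show ?case using const g h by (simp add: pm_const pm_coeff)
next
  case (add p q)
  then show ?case using g h by (simp add: pm_add mpoly_coeff pm_coeff)
next
  case (pmult p i)
  then show ?case using g h by (simp add: pm_pmult mpoly_coeff pm_coeff)
qed

lemma mpoly_cring: "cring (mpoly_ring R I)"
proof (rule cringI)
  show "abelian_group (mpoly_ring R I)"
  proof (rule abelian_groupI, unfold mpoly_simps mpoly_mult)
    fix f g assume f: "f \<in> carrier (mpoly_ring R I)" and g: "g \<in> carrier (mpoly_ring R I)"
    show "indexed_padd f g \<in> carrier (mpoly_ring R I)" by (rule mpoly_add_closed[OF f g])
    show "indexed_padd f g = indexed_padd g f"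
      using mpoly_coeff[OF f] mpoly_coeff[OF g] by (auto simp: indexed_padd_def a_comm)
    show "indexed_padd (indexed_const \<zero>) f = f"
      using mpoly_coeff[OF f] by (auto simp: indexed_padd_def indexed_const_def)
    have "indexed_const (\<ominus> \<one>) \<star> f = (\<lambda>m. \<ominus> f m)"
      using mpoly_coeff[OF f] by (simp add: pm_const l_minus)
    then have "indexed_padd (indexed_const (\<ominus> \<one>) \<star> f) f = indexed_const \<zero>"
      using mpoly_coeff[OF f] by (auto simp: indexed_padd_def indexed_const_def l_neg)
    then show "\<exists>y\<in>carrier (mpoly_ring R I). indexed_padd y f = indexed_const \<zero>"
      using mpoly_mult_closed[OF mpoly_const_closed f] by (meson a_inv_closed one_closed)
    fix h assume h: "h \<in> carrier (mpoly_ring R I)"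
    show "indexed_padd (indexed_padd f g) h = indexed_padd f (indexed_padd g h)"
      using mpoly_coeff[OF f] mpoly_coeff[OF g] mpoly_coeff[OF h] by (auto simp: indexed_padd_def a_assoc)
  qed (simp add: mpoly_const_closed)
  show "comm_monoid (mpoly_ring R I)"
  proof (rule comm_monoidI, unfold mpoly_simps mpoly_mult)
    fix f g assume f: "f \<in> carrier (mpoly_ring R I)" and g: "g \<in> carrier (mpoly_ring R I)"
    show "f \<star> g \<in> carrier (mpoly_ring R I)" by (rule mpoly_mult_closed[OF f g])
    show "f \<star> g = g \<star> f" using mpoly_coeff[OF f] mpoly_coeff[OF g] by (rule pm_comm)
    show "indexed_const \<one> \<star> f = f" using mpoly_coeff[OF f] by (simp add: pm_const)
    fix h assume h: "h \<in> carrier (mpoly_ring R I)"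
    show "(f \<star> g) \<star> h = f \<star> (g \<star> h)" using f mpoly_coeff[OF g] mpoly_coeff[OF h] by (rule pm_assoc)
  qed (simp add: mpoly_const_closed)
  fix f g h assume "f \<in> carrier (mpoly_ring R I)" "g \<in> carrier (mpoly_ring R I)" "h \<in> carrier (mpoly_ring R I)"
  then show "(f \<oplus>\<^bsub>mpoly_ring R I\<^esub> g) \<otimes>\<^bsub>mpoly_ring R I\<^esub> h =
      f \<otimes>\<^bsub>mpoly_ring R I\<^esub> h \<oplus>\<^bsub>mpoly_ring R I\<^esub> g \<otimes>\<^bsub>mpoly_ring R I\<^esub> h"
    unfolding mpoly_simps mpoly_mult using mpoly_coeff by (intro pm_add) auto
qed

lemma mpoly_mult_var:
  assumes "f \<in> carrier (mpoly_ring R I)"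
  shows "indexed_pmult f i = indexed_var i \<otimes>\<^bsub>mpoly_ring R I\<^esub> f"
  unfolding mpoly_mult indexed_var_def
  using mpoly_coeff[OF assms] by (subst pm_pmult) (simp_all add: pm_const, simp add: indexed_const_def)

lemma indexed_const_hom: "indexed_const \<in> ring_hom R (mpoly_ring R I)"
proof (rule ring_hom_memI)
  fix c d assume cd: "c \<in> carrier R" "d \<in> carrier R"
  show "indexed_const (c \<otimes> d) = indexed_const c \<otimes>\<^bsub>mpoly_ring R I\<^esub> indexed_const d"
    unfolding mpoly_mult using cd by (subst pm_const) (auto simp: indexed_const_def)
  show "indexed_const (c \<oplus> d) = indexed_const c \<oplus>\<^bsub>mpoly_ring R I\<^esub> indexed_const d"
    unfolding mpoly_simps by (rule indexed_padd_const[symmetric])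
qed (simp_all add: mpoly_const_closed mpoly_simps)

lemma mpoly_hom_eqI:
  assumes F: "F \<in> ring_hom (mpoly_ring R I) S" and G: "G \<in> ring_hom (mpoly_ring R I) S"
    and c: "\<And>c. c \<in> carrier R \<Longrightarrow> F (indexed_const c) = G (indexed_const c)"
    and v: "\<And>i. i \<in> I \<Longrightarrow> F (indexed_var i) = G (indexed_var i)"
    and f: "f \<in> carrier (mpoly_ring R I)"
  shows "F f = G f"
  using f
proof (induction rule: mpoly_induct)
  case (add f g)
  then show ?case using ring_hom_add[OF F, of f g] ring_hom_add[OF G, of f g] by (simp add: mpoly_simps)
next
  case (pmult f i)
  then show ?case
    using ring_hom_mult[OF F mpoly_var_closed, of i f] ring_hom_mult[OF G mpoly_var_closed, of i f] v
    by (simp add: mpoly_mult_var)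
qed (rule c)

end

section \<open>Evaluation of polynomials\<close>

locale mpoly_evaluation = R: base_ring R + S: cring S
  for R :: "'k ring" and S :: "('b, 'n) ring_scheme" +
  fixes \<phi> and v :: "nat \<Rightarrow> 'b" and I :: "nat set"
  assumes hom: "\<phi> \<in> ring_hom R S" and var: "\<And>i. v i \<in> carrier S"
begin

definition monom_val where "monom_val m = (\<Otimes>\<^bsub>S\<^esub>i\<in>set_mset m. v i [^]\<^bsub>S\<^esub> count m i)"

abbreviation ev where "ev \<equiv> mpoly_eval R S \<phi> v"

lemma phi_closed: "c \<in> carrier R \<Longrightarrow> \<phi> c \<in> carrier S"
  using ring_hom_closed[OF hom] .

lemma phi_zero: "\<phi> \<zero>\<^bsub>R\<^esub> = \<zero>\<^bsub>S\<^esub>"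
  using ring_hom_zero[OF hom R.ring_axioms S.ring_axioms] .

lemma monom_val_closed: "monom_val m \<in> carrier S"
  unfolding monom_val_def using var by (intro S.finprod_closed) auto

lemma monom_val_superset:
  assumes "finite A" "set_mset m \<subseteq> A"
  shows "monom_val m = (\<Otimes>\<^bsub>S\<^esub>i\<in>A. v i [^]\<^bsub>S\<^esub> count m i)"
  unfolding monom_val_def
  using assms var by (intro S.finprod_mono_neutral_cong_left) (auto simp: not_in_iff)

lemma monom_val_add_mset: "monom_val (add_mset i m) = v i \<otimes>\<^bsub>S\<^esub> monom_val m"
proof -
  \<comment> \<open>The set of variables may or may not grow, so both monomials are evaluated over
    \<open>?A\<close>. The new factor is written as a product over \<open>?A\<close> with a single
    nontrivial term.\<close>
  let ?A = "insert i (set_mset m)"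
  have "monom_val (add_mset i m) = (\<Otimes>\<^bsub>S\<^esub>j\<in>?A. (if i = j then v j else \<one>\<^bsub>S\<^esub>) \<otimes>\<^bsub>S\<^esub> v j [^]\<^bsub>S\<^esub> count m j)"
  proof -
    have "monom_val (add_mset i m) = (\<Otimes>\<^bsub>S\<^esub>j\<in>?A. v j [^]\<^bsub>S\<^esub> count (add_mset i m) j)"
      by (rule monom_val_superset) auto
    also have "\<dots> = (\<Otimes>\<^bsub>S\<^esub>j\<in>?A. (if i = j then v j else \<one>\<^bsub>S\<^esub>) \<otimes>\<^bsub>S\<^esub> v j [^]\<^bsub>S\<^esub> count m j)"
      by (rule S.finprod_cong') (use var S.nat_pow_Suc2 in auto)
    finally show ?thesis .
  qed
  also have "\<dots> = (\<Otimes>\<^bsub>S\<^esub>j\<in>?A. if i = j then v j else \<one>\<^bsub>S\<^esub>) \<otimes>\<^bsub>S\<^esub> (\<Otimes>\<^bsub>S\<^esub>j\<in>?A. v j [^]\<^bsub>S\<^esub> count m j)"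
    using var by (intro S.finprod_multf) auto
  also have "(\<Otimes>\<^bsub>S\<^esub>j\<in>?A. if i = j then v j else \<one>\<^bsub>S\<^esub>) = v i"
    using var by (intro S.finprod_singleton) auto
  also have "(\<Otimes>\<^bsub>S\<^esub>j\<in>?A. v j [^]\<^bsub>S\<^esub> count m j) = monom_val m"
    by (rule monom_val_superset[symmetric]) auto
  finally show ?thesis .
qed

text \<open>Polynomials with different supports become comparable when they are summed over one
  finite set; the additional terms vanish.\<close>

lemma ev_superset:
  assumes "finite M" "{m. f m \<noteq> \<zero>\<^bsub>R\<^esub>} \<subseteq> M" "\<And>m. f m \<in> carrier R"
  shows "ev f = (\<Oplus>\<^bsub>S\<^esub>m\<in>M. \<phi> (f m) \<otimes>\<^bsub>S\<^esub> monom_val m)"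
  unfolding mpoly_eval_def monom_val_def[symmetric]
  using assms monom_val_closed phi_closed
  by (intro S.add.finprod_mono_neutral_cong_left[folded finsum_def]) (auto simp: phi_zero)

lemma ev_closed: "f \<in> carrier (mpoly_ring R I) \<Longrightarrow> ev f \<in> carrier S"
  unfolding mpoly_eval_def monom_val_def[symmetric]
  using monom_val_closed phi_closed R.mpoly_coeff by (intro S.finsum_closed) auto

lemma ev_const:
  assumes c: "c \<in> carrier R" shows "ev (R.indexed_const c) = \<phi> c"
proof -
  have "ev (R.indexed_const c) = (\<Oplus>\<^bsub>S\<^esub>m\<in>{{#}}. \<phi> (R.indexed_const c m) \<otimes>\<^bsub>S\<^esub> monom_val m)"
    using c by (intro ev_superset) (auto simp: R.indexed_const_def)
  then show ?thesis using c phi_closed[OF c] by (simp add: R.indexed_const_def monom_val_def)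
qed

lemma ev_add:
  assumes f: "f \<in> carrier (mpoly_ring R I)" and g: "g \<in> carrier (mpoly_ring R I)"
  shows "ev (f \<oplus>\<^bsub>mpoly_ring R I\<^esub> g) = ev f \<oplus>\<^bsub>S\<^esub> ev g"
proof -
  let ?M = "{m. f m \<noteq> \<zero>\<^bsub>R\<^esub>} \<union> {m. g m \<noteq> \<zero>\<^bsub>R\<^esub>}"
  have M: "finite ?M" using R.mpoly_finite_support f g by blast
  note c = R.mpoly_coeff[OF f] R.mpoly_coeff[OF g] R.mpoly_coeff[OF R.mpoly_add_closed[OF f g]]
  have "ev (R.indexed_padd f g) = (\<Oplus>\<^bsub>S\<^esub>m\<in>?M. \<phi> (f m) \<otimes>\<^bsub>S\<^esub> monom_val m \<oplus>\<^bsub>S\<^esub> \<phi> (g m) \<otimes>\<^bsub>S\<^esub> monom_val m)"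
    using M c monom_val_closed phi_closed
    by (subst ev_superset[of ?M]) (auto intro!: S.finsum_cong' simp: R.indexed_padd_def ring_hom_add[OF hom] S.l_distr)
  also have "\<dots> = (\<Oplus>\<^bsub>S\<^esub>m\<in>?M. \<phi> (f m) \<otimes>\<^bsub>S\<^esub> monom_val m) \<oplus>\<^bsub>S\<^esub> (\<Oplus>\<^bsub>S\<^esub>m\<in>?M. \<phi> (g m) \<otimes>\<^bsub>S\<^esub> monom_val m)"
    using c monom_val_closed phi_closed by (intro S.finsum_addf) auto
  also have "\<dots> = ev f \<oplus>\<^bsub>S\<^esub> ev g"
    using ev_superset[OF M _ c(1)] ev_superset[OF M _ c(2)] by auto
  finally show ?thesis by (simp add: R.mpoly_simps)
qed

lemma ev_pmult:
  assumes f: "f \<in> carrier (mpoly_ring R I)"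
  shows "ev (R.indexed_pmult f i) = v i \<otimes>\<^bsub>S\<^esub> ev f"
proof -
  let ?M = "{m. f m \<noteq> \<zero>\<^bsub>R\<^esub>}"
  have M: "finite ?M" by (rule R.mpoly_finite_support[OF f])
  note c = R.mpoly_coeff[OF f]
  have "ev (R.indexed_pmult f i) = (\<Oplus>\<^bsub>S\<^esub>m\<in>add_mset i ` ?M. \<phi> (R.indexed_pmult f i m) \<otimes>\<^bsub>S\<^esub> monom_val m)"
  proof (rule ev_superset)
    show "{m. R.indexed_pmult f i m \<noteq> \<zero>\<^bsub>R\<^esub>} \<subseteq> add_mset i ` ?M"
    proof
      fix m assume "m \<in> {m. R.indexed_pmult f i m \<noteq> \<zero>\<^bsub>R\<^esub>}"
      then have "i \<in># m" "f (m - {#i#}) \<noteq> \<zero>\<^bsub>R\<^esub>" by (auto simp: R.indexed_pmult_def split: if_splits)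
      then show "m \<in> add_mset i ` ?M" by (intro image_eqI[of _ _ "m - {#i#}"]) auto
    qed
  qed (use M c in \<open>auto simp: R.indexed_pmult_def\<close>)
  also have "\<dots> = (\<Oplus>\<^bsub>S\<^esub>m\<in>?M. \<phi> (R.indexed_pmult f i (add_mset i m)) \<otimes>\<^bsub>S\<^esub> monom_val (add_mset i m))"
    using c monom_val_closed phi_closed by (intro S.finsum_reindex) (auto simp: R.indexed_pmult_def inj_on_def)
  also have "\<dots> = (\<Oplus>\<^bsub>S\<^esub>m\<in>?M. v i \<otimes>\<^bsub>S\<^esub> (\<phi> (f m) \<otimes>\<^bsub>S\<^esub> monom_val m))"
    using c monom_val_closed phi_closed var
    by (intro S.finsum_cong') (auto simp: R.indexed_pmult_def monom_val_add_mset S.m_lcomm)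
  also have "\<dots> = v i \<otimes>\<^bsub>S\<^esub> ev f"
    unfolding ev_superset[OF M order_refl c]
    using M c monom_val_closed phi_closed var by (intro S.finsum_rdistr[symmetric]) auto
  finally show ?thesis .
qed

text \<open>Multiplicativity follows the recursion of the product: induction on the first factor,
  and a second induction on the other one when the first is a constant.\<close>

lemma ev_hom: "ev \<in> ring_hom (mpoly_ring R I) S"
proof (rule ring_hom_memI)
  fix f g assume f: "f \<in> carrier (mpoly_ring R I)" and g: "g \<in> carrier (mpoly_ring R I)"
  interpret P: cring "mpoly_ring R I" by (rule R.mpoly_cring)
  show "ev f \<in> carrier S" by (rule ev_closed[OF f])
  show "ev (f \<oplus>\<^bsub>mpoly_ring R I\<^esub> g) = ev f \<oplus>\<^bsub>S\<^esub> ev g"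
    by (rule ev_add[OF f g])
  show "ev (f \<otimes>\<^bsub>mpoly_ring R I\<^esub> g) = ev f \<otimes>\<^bsub>S\<^esub> ev g"
    using f
  proof (induction rule: R.mpoly_induct)
    case (const c)
    show ?case
      using g
    proof (induction rule: R.mpoly_induct)
      case (const d)
      then show ?case
        using \<open>c \<in> carrier R\<close>
        by (simp add: ev_const ring_hom_mult[OF hom] flip: ring_hom_mult[OF R.indexed_const_hom])
    next
      case (add p q)
      note cc = R.mpoly_const_closed[OF \<open>c \<in> carrier R\<close>, of I]
      have "ev (R.indexed_const c \<otimes>\<^bsub>mpoly_ring R I\<^esub> (p \<oplus>\<^bsub>mpoly_ring R I\<^esub> q)) =
          ev (R.indexed_const c) \<otimes>\<^bsub>S\<^esub> ev (p \<oplus>\<^bsub>mpoly_ring R I\<^esub> q)"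
        using add cc by (simp add: P.r_distr ev_add ev_closed S.r_distr)
      then show ?case by (simp add: R.mpoly_simps(1))
    next
      case (pmult p i)
      note cc = R.mpoly_const_closed[OF \<open>c \<in> carrier R\<close>, of I] and x = R.mpoly_var_closed[OF \<open>i \<in> I\<close>]
      have "ev (R.indexed_const c \<otimes>\<^bsub>mpoly_ring R I\<^esub> R.indexed_pmult p i) =
          ev (R.indexed_pmult (R.indexed_const c \<otimes>\<^bsub>mpoly_ring R I\<^esub> p) i)"
        using pmult cc x by (simp add: R.mpoly_mult_var[where I = I] P.m_lcomm)
      also have "\<dots> = v i \<otimes>\<^bsub>S\<^esub> (ev (R.indexed_const c) \<otimes>\<^bsub>S\<^esub> ev p)"
        using pmult cc by (simp add: ev_pmult)
      also have "\<dots> = ev (R.indexed_const c) \<otimes>\<^bsub>S\<^esub> ev (R.indexed_pmult p i)"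
        using pmult cc var by (simp add: ev_pmult ev_closed S.m_lcomm)
      finally show ?case .
    qed
  next
    case (add p q)
    have "ev ((p \<oplus>\<^bsub>mpoly_ring R I\<^esub> q) \<otimes>\<^bsub>mpoly_ring R I\<^esub> g) = ev (p \<oplus>\<^bsub>mpoly_ring R I\<^esub> q) \<otimes>\<^bsub>S\<^esub> ev g"
      using add g by (simp add: P.l_distr ev_add ev_closed S.l_distr)
    then show ?case by (simp add: R.mpoly_simps(1))
  next
    case (pmult p i)
    note x = R.mpoly_var_closed[OF \<open>i \<in> I\<close>]
    have "ev (R.indexed_pmult p i \<otimes>\<^bsub>mpoly_ring R I\<^esub> g) = ev (R.indexed_pmult (p \<otimes>\<^bsub>mpoly_ring R I\<^esub> g) i)"
      using pmult g x by (simp add: R.mpoly_mult_var[where I = I] P.m_assoc)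
    also have "\<dots> = ev (R.indexed_pmult p i) \<otimes>\<^bsub>S\<^esub> ev g"
      using pmult g var by (simp add: ev_pmult ev_closed S.m_assoc)
    finally show ?case .
  qed
next
  show "ev \<one>\<^bsub>mpoly_ring R I\<^esub> = \<one>\<^bsub>S\<^esub>"
    by (simp add: R.mpoly_simps ev_const ring_hom_one[OF hom])
qed

lemma ev_var: "i \<in> I \<Longrightarrow> ev (R.indexed_var i) = v i"
  unfolding R.indexed_var_def using var
  by (simp add: ev_pmult R.mpoly_const_closed ev_const ring_hom_one[OF hom])

end

section \<open>Morphisms of affine schemes\<close>

locale affine_morphism = A: cring A + B: cring B
  for A :: "('a, 'm) ring_scheme" and B :: "('b, 'n) ring_scheme" +
  fixes \<phi> assumes hom: "\<phi> \<in> ring_hom A B"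
begin

definition contract where "contract p = {a \<in> carrier A. \<phi> a \<in> p}"

text \<open>The induced map from the localization at \<open>contract p\<close> to the localization
  at \<open>p\<close>, in the shape in which \<open>Spec_map\<close> contains it.\<close>

definition stalk_hom where "stalk_hom p z = (\<Union>(a, f)\<in>z. B.frp p (\<phi> a) (\<phi> f))"

abbreviation F where "F \<equiv> Spec_map A B \<phi>"

lemma phi_closed: "a \<in> carrier A \<Longrightarrow> \<phi> a \<in> carrier B"
  using ring_hom_closed[OF hom] .

lemma phi_notin_prime: "g \<in> carrier A - contract p \<Longrightarrow> \<phi> g \<in> carrier B - p"
  using phi_closed by (auto simp: contract_def)

lemma contract_prime:
  assumes "primeideal p B" shows "primeideal (contract p) A"
proof -
  interpret h: ring_hom_ring A B \<phi> by (intro ring_hom_ringI2 A.ring_axioms B.ring_axioms hom)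
  show ?thesis unfolding contract_def by (rule h.primeideal_vimage[OF A.cring_axioms assms])
qed

lemma on_pts_Spec_map: "primeideal p B \<Longrightarrow> on_pts F p = contract p"
  by (simp add: Spec_map_def contract_def Let_def)

lemma preim_Spec_map: "preim (Spec B) F V = {p. primeideal p B \<and> contract p \<in> V}"
  by (auto simp: preim_def B.sec_Spec B.topspace_zariski on_pts_Spec_map)

lemma on_sec_Spec_map:
  assumes "openin (zariski A) V" "s \<in> spec_sections A V"
  shows "on_sec F V s = (\<lambda>p\<in>preim (Spec B) F V. stalk_hom p (s (contract p)))"
  unfolding preim_Spec_map using assms
  by (simp add: Spec_map_def contract_def Let_def stalk_hom_def)

lemma stalk_hom_fraction:
  assumes p: "primeideal p B" and "a \<in> carrier A" "f \<in> carrier A" "f \<notin> contract p"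
  shows "stalk_hom p (A.frp (contract p) a f) = B.frp p (\<phi> a) (\<phi> f)"
proof -
  interpret LA: localization_ring A "carrier A - contract p" by (rule localization_at_prime[OF contract_prime[OF p]])
  interpret LB: localization_ring B "carrier B - p" by (rule localization_at_prime[OF p])
  note S = phi_notin_prime
  show ?thesis
    unfolding stalk_hom_def
  proof (rule LA.fraction_Union)
    fix b g assume bg: "b \<in> carrier A" "g \<in> carrier A - contract p" "A.frp (contract p) b g = A.frp (contract p) a f"
    have f: "f \<in> carrier A - contract p" using assms by simp
    obtain h where h: "h \<in> carrier A - contract p" "h \<otimes>\<^bsub>A\<^esub> (b \<otimes>\<^bsub>A\<^esub> f) = h \<otimes>\<^bsub>A\<^esub> (a \<otimes>\<^bsub>A\<^esub> g)"
      using LA.fraction_eqE[OF bg(3,1,2) assms(2) f] .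
    have "\<phi> h \<otimes>\<^bsub>B\<^esub> (\<phi> b \<otimes>\<^bsub>B\<^esub> \<phi> f) = \<phi> h \<otimes>\<^bsub>B\<^esub> (\<phi> a \<otimes>\<^bsub>B\<^esub> \<phi> g)"
      using arg_cong[OF h(2), of \<phi>] h(1) bg(1,2) assms by (simp add: ring_hom_mult[OF hom])
    then show "B.frp p (\<phi> b) (\<phi> g) = B.frp p (\<phi> a) (\<phi> f)"
      using bg h(1) assms S by (intro LB.fraction_eqI[of _ _ _ _ "\<phi> h"]) (auto simp: phi_closed)
  qed (use assms in auto)
qed

lemma stalk_hom_hom:
  assumes p: "primeideal p B" shows "stalk_hom p \<in> ring_hom (stalk_ring A (contract p)) (stalk_ring B p)"
proof -
  interpret LA: localization_ring A "carrier A - contract p" by (rule localization_at_prime[OF contract_prime[OF p]])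
  interpret LB: localization_ring B "carrier B - p" by (rule localization_at_prime[OF p])
  note S = phi_notin_prime
  have fr: "stalk_hom p (A.frp (contract p) a f) = B.frp p (\<phi> a) (\<phi> f)"
    if "a \<in> carrier A" "f \<in> carrier A - contract p" for a f
    using stalk_hom_fraction[OF p] that by blast
  show ?thesis
  proof (rule ring_hom_memI)
    fix x assume "x \<in> carrier LA.L"
    then obtain a f where x: "a \<in> carrier A" "f \<in> carrier A - contract p" "x = LA.fr a f" by (elim LA.L_cases)
    show "stalk_hom p x \<in> carrier LB.L" unfolding x(3) fr[OF x(1,2)] by (intro LB.fraction_closed phi_closed S x(1,2))
    fix y assume "y \<in> carrier LA.L"
    then obtain b g where y: "b \<in> carrier A" "g \<in> carrier A - contract p" "y = LA.fr b g" by (elim LA.L_cases)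
    have fg: "f \<otimes>\<^bsub>A\<^esub> g \<in> carrier A - contract p" by (rule LA.S_mult[OF x(2) y(2)])
    show "stalk_hom p (x \<otimes>\<^bsub>LA.L\<^esub> y) = stalk_hom p x \<otimes>\<^bsub>LB.L\<^esub> stalk_hom p y"
      unfolding x(3) y(3) LA.fraction_mult[OF x(1,2) y(1,2)] fr[OF x(1,2)] fr[OF y(1,2)]
        LB.fraction_mult[OF phi_closed[OF x(1)] S[OF x(2)] phi_closed[OF y(1)] S[OF y(2)]]
      using x(1,2) y(1,2) fg by (simp only: fr A.m_closed) (simp add: ring_hom_mult[OF hom])
    show "stalk_hom p (x \<oplus>\<^bsub>LA.L\<^esub> y) = stalk_hom p x \<oplus>\<^bsub>LB.L\<^esub> stalk_hom p y"
      unfolding x(3) y(3) LA.fraction_add[OF x(1,2) y(1,2)] fr[OF x(1,2)] fr[OF y(1,2)]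
        LB.fraction_add[OF phi_closed[OF x(1)] S[OF x(2)] phi_closed[OF y(1)] S[OF y(2)]]
      using x(1,2) y(1,2) fg by (subst fr) (auto simp: ring_hom_mult[OF hom] ring_hom_add[OF hom])
  next
    show "stalk_hom p \<one>\<^bsub>LA.L\<^esub> = \<one>\<^bsub>LB.L\<^esub>"
      unfolding LA.fraction_one LB.fraction_one using LA.S_one by (simp only: fr A.one_closed ring_hom_one[OF hom])
  qed
qed

lemma open_preim_Spec_map:
  assumes "openin (zariski A) V" shows "openin (zariski B) (preim (Spec B) F V)"
proof -
  obtain I where I: "I \<subseteq> carrier A" "V = {p. primeideal p A \<and> \<not> I \<subseteq> p}"
    using assms unfolding A.openin_zariski by blast
  have "preim (Spec B) F V = {p. primeideal p B \<and> \<not> \<phi> ` I \<subseteq> p}"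
    unfolding preim_Spec_map I(2) using I(1) contract_prime by (auto simp: contract_def)
  moreover have "\<phi> ` I \<subseteq> carrier B" using I(1) phi_closed by auto
  ultimately show ?thesis unfolding B.openin_zariski by blast
qed

lemma on_sec_Spec_map_closed:
  assumes V: "openin (zariski A) V" and s: "s \<in> spec_sections A V"
  shows "on_sec F V s \<in> spec_sections B (preim (Spec B) F V)"
  unfolding on_sec_Spec_map[OF V s]
proof (rule B.spec_sectionsI[OF open_preim_Spec_map[OF V]])
  fix p assume p: "p \<in> preim (Spec B) F V"
  obtain W a f where W: "openin (zariski A) W" "contract p \<in> W" "W \<subseteq> V" "a \<in> carrier A" "f \<in> carrier A"
    "\<And>q. q \<in> W \<Longrightarrow> f \<notin> q" "\<And>q. q \<in> W \<Longrightarrow> s q = A.frp q a f"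
    by (rule A.spec_sectionsE[OF s, of "contract p"]) (use p in \<open>auto simp: preim_Spec_map\<close>)
  have "\<phi> f \<notin> q \<and> stalk_hom q (s (contract q)) = B.frp q (\<phi> a) (\<phi> f)" if q: "q \<in> preim (Spec B) F W" for q
  proof -
    have "primeideal q B" "contract q \<in> W" using q by (auto simp: preim_Spec_map)
    then show ?thesis using W stalk_hom_fraction[of q a f] by (auto simp: contract_def)
  qed
  moreover have "preim (Spec B) F W \<subseteq> preim (Spec B) F V" by (rule preim_mono[OF W(3)])
  moreover have "p \<in> preim (Spec B) F W" using p W(2) by (simp add: preim_Spec_map)
  ultimately show "\<exists>Y b g. openin (zariski B) Y \<and> p \<in> Y \<and> Y \<subseteq> preim (Spec B) F V \<and> b \<in> carrier B \<and> g \<in> carrier B \<and>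
      (\<forall>q\<in>Y. g \<notin> q \<and> (\<lambda>p\<in>preim (Spec B) F V. stalk_hom p (s (contract p))) q = B.frp q b g)"
    using open_preim_Spec_map[OF W(1)] phi_closed W(4,5)
    by (intro exI[of _ "preim (Spec B) F W"] exI[of _ "\<phi> a"] exI[of _ "\<phi> f"]) auto
qed simp

lemma Spec_map_presheaf_hom: "F \<in> presheaf_hom (Spec B) (Spec A)"
  unfolding presheaf_hom_def mem_Collect_eq A.sec_Spec(1,6,7) B.sec_Spec(6,7)
proof (intro conjI allI impI ballI)
  show "continuous_map (zariski B) (zariski A) (on_pts F)"
    unfolding continuous_map_def
  proof (intro conjI allI impI)
    show "on_pts F \<in> topspace (zariski B) \<rightarrow> topspace (zariski A)"
      by (auto simp: A.topspace_zariski B.topspace_zariski on_pts_Spec_map contract_prime)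
    fix V assume "openin (zariski A) V"
    then show "openin (zariski B) {x \<in> topspace (zariski B). on_pts F x \<in> V}"
      using open_preim_Spec_map by (simp add: preim_def B.sec_Spec)
  qed
  show "on_pts F \<in> extensional (topspace (zariski B))" "on_sec F \<in> extensional {V. openin (zariski A) V}"
    by (simp_all add: Spec_map_def Let_def B.topspace_zariski)
  fix V assume V: "openin (zariski A) V"
  have "on_sec F V \<in> ring_hom (sec (Spec A) V) (sec (Spec B) (preim (Spec B) F V))"
  proof (rule ring_hom_memI, unfold A.sec_Spec(1) B.sec_Spec(1))
    interpret SA: cring "sec (Spec A) V" by (rule A.sec_Spec_cring[OF V])
    fix s t assume s: "s \<in> spec_sections A V" and t: "t \<in> spec_sections A V"
    have st: "s \<otimes>\<^bsub>sec (Spec A) V\<^esub> t \<in> spec_sections A V" "s \<oplus>\<^bsub>sec (Spec A) V\<^esub> t \<in> spec_sections A V"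
      using SA.m_closed SA.a_closed s t by (auto simp: A.sec_Spec(1))
    have *: "primeideal p B" "contract p \<in> V" "s (contract p) \<in> carrier (stalk_ring A (contract p))"
      "t (contract p) \<in> carrier (stalk_ring A (contract p))" if "p \<in> preim (Spec B) F V" for p
      using that A.spec_sections_closed s t by (auto simp: preim_Spec_map)
    show "on_sec F V (s \<otimes>\<^bsub>sec (Spec A) V\<^esub> t) = on_sec F V s \<otimes>\<^bsub>sec (Spec B) (preim (Spec B) F V)\<^esub> on_sec F V t"
      unfolding on_sec_Spec_map[OF V s] on_sec_Spec_map[OF V t] on_sec_Spec_map[OF V st(1)] B.sec_Spec(2)
      using * ring_hom_mult[OF stalk_hom_hom *(3,4)]
      by (intro restrict_ext) (simp add: A.sec_Spec(2))
    show "on_sec F V (s \<oplus>\<^bsub>sec (Spec A) V\<^esub> t) = on_sec F V s \<oplus>\<^bsub>sec (Spec B) (preim (Spec B) F V)\<^esub> on_sec F V t"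
      unfolding on_sec_Spec_map[OF V s] on_sec_Spec_map[OF V t] on_sec_Spec_map[OF V st(2)] B.sec_Spec(3)
      using * ring_hom_add[OF stalk_hom_hom *(3,4)]
      by (intro restrict_ext) (simp add: A.sec_Spec(3))
  next
    show "on_sec F V \<one>\<^bsub>sec (Spec A) V\<^esub> = \<one>\<^bsub>sec (Spec B) (preim (Spec B) F V)\<^esub>"
      unfolding on_sec_Spec_map[OF V A.spec_one_closed[OF V]] B.sec_Spec(4)
      by (intro restrict_ext) (simp add: A.sec_Spec(4) preim_Spec_map ring_hom_one[OF stalk_hom_hom])
  qed (rule on_sec_Spec_map_closed[OF V])
  moreover have "on_sec F V \<in> extensional (spec_sections A V)" using V by (simp add: Spec_map_def Let_def)
  ultimately show "on_sec F V \<in> ring_hom (sec (Spec A) V) (sec (Spec B) (preim (Spec B) F V)) \<inter> extensional (spec_sections A V)"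
    by blast
next
  fix V W s assume VW: "openin (zariski A) V \<and> openin (zariski A) W \<and> W \<subseteq> V" and s: "s \<in> spec_sections A V"
  then have V: "openin (zariski A) V" and W: "openin (zariski A) W" "W \<subseteq> V" by auto
  show "on_sec F W (restrict s W) = restrict (on_sec F V s) (preim (Spec B) F W)"
    unfolding on_sec_Spec_map[OF V s] on_sec_Spec_map[OF W(1) A.restrict_spec_section[OF V W s]]
    using W(2) by (intro restrict_ext) (auto simp: preim_Spec_map)
qed

text \<open>If the image of \<open>a / f\<close> is a unit at \<open>p\<close>, then
  \<open>\<phi> a\<close> lies outside \<open>p\<close>. So \<open>a\<close> lies outside
  \<open>contract p\<close>, and \<open>a / f\<close> was a unit already.\<close>

lemma Spec_map_lrs_hom: "F \<in> lrs_hom (Spec B) (Spec A)"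
  unfolding lrs_hom_iff[OF B.local_presheaf_Spec A.local_presheaf_Spec] A.sec_Spec(1,7) B.sec_Spec(7)
proof (intro conjI Spec_map_presheaf_hom ballI allI impI)
  fix p V t assume "p \<in> topspace (zariski B)" and *: "openin (zariski A) V \<and> on_pts F p \<in> V \<and> t \<in> spec_sections A V \<and>
      germ (Spec B) p (preim (Spec B) F V) (on_sec F V t) \<in> Units (stalk (Spec B) p)"
  then have p: "primeideal p B" by (simp add: B.topspace_zariski)
  note c = on_pts_Spec_map[OF p]
  have V: "openin (zariski A) V" "contract p \<in> V" and t: "t \<in> spec_sections A V" using * c by auto
  have pV: "p \<in> preim (Spec B) F V" using p V by (simp add: preim_Spec_map)
  have "on_sec F V t p \<in> Units (stalk_ring B p)"
    using * B.Spec_germ_Units_iff[OF open_preim_Spec_map[OF V(1)] pV on_sec_Spec_map_closed[OF V(1) t]] by blast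
  then have u: "stalk_hom p (t (contract p)) \<in> Units (stalk_ring B p)"
    using pV by (simp add: on_sec_Spec_map[OF V(1) t])
  obtain a f where af: "a \<in> carrier A" "f \<in> carrier A" "f \<notin> contract p" "t (contract p) = A.frp (contract p) a f"
    using A.spec_sectionsE[OF t V(2)] V(2) by metis
  have "\<phi> a \<notin> p"
    using u B.stalk_ring_Units_iff[OF p, of "\<phi> a" "\<phi> f"] af stalk_hom_fraction[OF p af(1-3)]
    by (auto simp: phi_closed contract_def)
  then have "a \<notin> contract p" by (simp add: contract_def)
  then show "germ (Spec A) (on_pts F p) V t \<in> Units (stalk (Spec A) (on_pts F p))"
    unfolding c A.Spec_germ_Units_iff[OF V t] af(4) using A.stalk_ring_Units_iff[OF contract_prime[OF p] af(1-3)] by simp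
qed

text \<open>Together with \<open>affine_hom_eqI\<close> this allows composites with
  \<open>Spec_map\<close> to be compared by applying \<open>\<phi>\<close> to ring elements, without
  sections over smaller open sets.\<close>

lemma Spec_map_gsec:
  assumes a: "a \<in> carrier A" shows "on_sec F (topspace (zariski A)) (A.gsec a) = B.gsec (\<phi> a)"
proof -
  have "preim (Spec B) F (topspace (zariski A)) = topspace (zariski B)"
    by (auto simp: preim_Spec_map A.topspace_zariski B.topspace_zariski contract_prime)
  moreover have "stalk_hom p (A.gsec a (contract p)) = B.frp p (\<phi> a) \<one>\<^bsub>B\<^esub>" if p: "primeideal p B" for p
    using stalk_hom_fraction[OF p a A.one_closed] A.prime_not_one[OF contract_prime[OF p]]
    by (simp add: A.gsec_apply contract_prime[OF p] ring_hom_one[OF hom])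
  ultimately show ?thesis
    unfolding on_sec_Spec_map[OF openin_topspace A.gsec_closed[OF a]] B.gsec_def B.fsec_def
    by (auto simp: B.topspace_zariski intro!: restrict_ext)
qed

end

lemma rs_comp_global:
  assumes u: "u \<in> presheaf_hom X Y" and v: "v \<in> presheaf_hom Y Z" and t: "t \<in> carrier (sec Z (topspace (pts Z)))"
  shows "on_sec (rs_comp X Y Z v u) (topspace (pts Z)) t = on_sec u (topspace (pts Y)) (on_sec v (topspace (pts Z)) t)"
  using t by (simp add: rs_comp_simps preim_topspace[OF v])

lemma global_hom:
  assumes "u \<in> presheaf_hom X Y"
  shows "on_sec u (topspace (pts Y)) \<in> ring_hom (sec Y (topspace (pts Y))) (sec X (topspace (pts X)))"
  using presheaf_homD(3)[OF assms openin_topspace] by (simp add: preim_topspace[OF assms])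

section \<open>Schemes over a base ring and the affine line\<close>

text \<open>The common setting in which morphisms over the base are composed. Schemes belong to it
  by \<open>is_kscheme_local_kspace\<close>; for the affine line and the algebraic simplices it
  follows from the ring theory of \<open>Spec\<close>.\<close>

definition local_kspace :: "'k ring \<Rightarrow> ('p, 's, 'k) kscheme \<Rightarrow> bool" where
  "local_kspace K X \<longleftrightarrow> local_presheaf (und X) \<and> str X \<in> lrs_hom (und X) (Spec K)"

lemma is_kscheme_local_sheaf: "is_kscheme K X \<Longrightarrow> local_sheaf (und X)"
  using locally_ringed_space_local_sheaf by (auto simp: is_kscheme_def scheme_def)

lemma is_kscheme_local_kspace: "is_kscheme K X \<Longrightarrow> local_kspace K X"
  using is_kscheme_local_sheaf[of K X] by (simp add: is_kscheme_def local_kspace_def local_sheaf.axioms)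

lemma local_kspace_presheaf: "local_kspace K X \<Longrightarrow> ring_presheaf (und X)"
  by (simp add: local_kspace_def local_presheaf.axioms)

lemma khom_presheaf_hom: "f \<in> khom K X Y \<Longrightarrow> f \<in> presheaf_hom (und X) (und Y)"
  using lrs_hom_presheaf_hom by (auto simp: khom_def)

lemma khom_id:
  assumes K: "cring K" and X: "local_kspace K X" shows "rs_id (und X) \<in> khom K X X"
  using rs_id_lrs_hom[of "und X"] rs_comp_id_right[of "und X" "Spec K" "str X"] X
    cring.ring_presheaf_Spec[OF K] lrs_hom_presheaf_hom[of "str X"]
  by (simp add: khom_def local_kspace_def)

lemma khom_comp:
  assumes K: "cring K" and X: "local_kspace K X" and Y: "local_kspace K Y" and Z: "local_kspace K Z"
    and f: "f \<in> khom K X Y" and g: "g \<in> khom K Y Z"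
  shows "kcomp X Y Z g f \<in> khom K X Z"
proof -
  have "rs_comp (und X) (und Z) (Spec K) (str Z) (kcomp X Y Z g f)
      = rs_comp (und X) (und Y) (Spec K) (rs_comp (und Y) (und Z) (Spec K) (str Z) g) f"
    using Z by (intro rs_comp_assoc cring.ring_presheaf_Spec[OF K] local_kspace_presheaf[OF Z]
        khom_presheaf_hom[OF f] khom_presheaf_hom[OF g]) (simp add: local_kspace_def lrs_hom_presheaf_hom)
  then show ?thesis
    using assms lrs_hom_comp[of "und X" "und Y" "und Z" f g] by (simp add: khom_def local_kspace_def)
qed

lemma kcomp_assoc:
  assumes W: "local_kspace K W" and Z: "local_kspace K Z"
    and "f \<in> khom K X Y" "g \<in> khom K Y Z" "h \<in> khom K Z W"
  shows "kcomp X Z W h (kcomp X Y Z g f) = kcomp X Y W (kcomp Y Z W h g) f"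
  using assms by (intro rs_comp_assoc local_kspace_presheaf khom_presheaf_hom)

locale kscheme_to_affine = K: base_ring K + A: cring A
  for K :: "'k ring" and A :: "('a, 'm) ring_scheme" and X :: "('p, 's, 'k) kscheme" +
  fixes \<alpha>
  assumes X: "is_kscheme K X" and alpha: "\<alpha> \<in> ring_hom K A"
begin

abbreviation Y where "Y \<equiv> kSpec K A \<alpha>"
abbreviation TX where "TX \<equiv> topspace (pts (und X))"
abbreviation TA where "TA \<equiv> topspace (zariski A)"
abbreviation TK where "TK \<equiv> topspace (zariski K)"

sublocale S: affine_morphism K A \<alpha>
  by unfold_locales (rule alpha)

sublocale XA: lrs_to_affine "und X" A
  using is_kscheme_local_sheaf[OF X] A.cring_axioms by (rule lrs_to_affine.intro)

sublocale XK: lrs_to_affine "und X" K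
  using is_kscheme_local_sheaf[OF X] K.cring_axioms by (rule lrs_to_affine.intro)

lemma Y_local: "local_kspace K Y"
  by (simp add: local_kspace_def kSpec_def A.local_presheaf_Spec S.Spec_map_lrs_hom)

lemma str_X: "str X \<in> lrs_hom (und X) (Spec K)"
  using X by (simp add: is_kscheme_def)

text \<open>Morphisms to \<open>Spec K\<close> are equal if they pull global functions back equally.
  Compatibility with the structure morphisms therefore reduces to an equation for each
  scalar.\<close>

lemma khom_affine_iff:
  "f \<in> khom K X Y \<longleftrightarrow> f \<in> lrs_hom (und X) (Spec A) \<and>
    (\<forall>c\<in>carrier K. on_sec f TA (A.gsec (\<alpha> c)) = on_sec (str X) TK (K.gsec c))"
proof -
  have "rs_comp (und X) (Spec A) (Spec K) S.F f = str X \<longleftrightarrow>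
      (\<forall>c\<in>carrier K. on_sec f TA (A.gsec (\<alpha> c)) = on_sec (str X) TK (K.gsec c))"
    if f: "f \<in> lrs_hom (und X) (Spec A)"
  proof -
    have c: "rs_comp (und X) (Spec A) (Spec K) S.F f \<in> lrs_hom (und X) (Spec K)"
      by (rule lrs_hom_comp[OF XA.local_presheaf_X A.local_presheaf_Spec K.local_presheaf_Spec f S.Spec_map_lrs_hom])
    have g: "on_sec (rs_comp (und X) (Spec A) (Spec K) S.F f) TK (K.gsec c) = on_sec f TA (A.gsec (\<alpha> c))"
      if "c \<in> carrier K" for c
      using rs_comp_global[OF lrs_hom_presheaf_hom[OF f] S.Spec_map_presheaf_hom, unfolded K.sec_Spec(1,7) A.sec_Spec(7),
          OF K.gsec_closed[OF that]] by (simp add: S.Spec_map_gsec[OF that])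
    show ?thesis using XK.affine_hom_eqI[OF c str_X] g by auto
  qed
  then show ?thesis by (auto simp: khom_def kSpec_def)
qed

lemma khom_affine_eqI:
  assumes "f \<in> khom K X Y" "g \<in> khom K X Y" "\<And>a. a \<in> carrier A \<Longrightarrow> on_sec f TA (A.gsec a) = on_sec g TA (A.gsec a)"
  shows "f = g"
  using assms XA.affine_hom_eqI khom_affine_iff by blast

lemma pullback_hom:
  assumes f: "f \<in> khom K X Y" shows "(\<lambda>a. on_sec f TA (A.gsec a)) \<in> ring_hom A (sec (und X) TX)"
proof -
  have "f \<in> presheaf_hom (und X) (Spec A)" using f lrs_hom_presheaf_hom by (auto simp: khom_affine_iff)
  from global_hom[OF this] have "on_sec f TA \<in> ring_hom (sec (Spec A) TA) (sec (und X) TX)" by (simp add: A.sec_Spec)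
  from ring_hom_trans[OF A.gsec_hom this] show ?thesis by (simp add: o_def)
qed

end

definition line_coord :: "'k ring \<Rightarrow> nat multiset \<Rightarrow> 'k" where
  "line_coord K = ring.indexed_var K 0"

text \<open>The function on \<open>X\<close> that corresponds to a morphism to the affine line.\<close>

definition line_fun where
  "line_fun K f = on_sec f (topspace (zariski (mpoly_ring K {0}))) (cring.gsec (mpoly_ring K {0}) (line_coord K))"

locale kscheme_over = K: base_ring K
  for K :: "'k ring" and X :: "('p, 's, 'k) kscheme" +
  assumes X: "is_kscheme K X"
begin

sublocale L: kscheme_to_affine K "mpoly_ring K {0}" X K.indexed_const
  by (intro kscheme_to_affine.intro kscheme_to_affine_axioms.intro K.base_ring_axioms K.mpoly_cring X K.indexed_const_hom)

lemma line_eq: "L.Y = affine_line K"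
  by (simp add: affine_line_def)

lemma line_coord_closed: "line_coord K \<in> carrier (mpoly_ring K {0})"
  unfolding line_coord_def by (rule K.mpoly_var_closed) simp

lemma line_fun_closed: "f \<in> khom K X (affine_line K) \<Longrightarrow> line_fun K f \<in> carrier (sec (und X) (topspace (pts (und X))))"
  using ring_hom_closed[OF L.pullback_hom line_coord_closed] by (simp add: line_fun_def line_eq)

text \<open>A homomorphism on the polynomial ring is determined by the coordinate and the scalars,
  and on scalars it is prescribed by the structure morphism.\<close>

lemma line_hom_eqI:
  assumes f: "f \<in> khom K X (affine_line K)" and g: "g \<in> khom K X (affine_line K)" and eq: "line_fun K f = line_fun K g"
  shows "f = g"
proof (rule L.khom_affine_eqI)
  show fg: "f \<in> khom K X L.Y" "g \<in> khom K X L.Y" using f g by (simp_all add: line_eq)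
  fix a assume "a \<in> carrier (mpoly_ring K {0})"
  then show "on_sec f L.TA (L.A.gsec a) = on_sec g L.TA (L.A.gsec a)"
  proof (rule K.mpoly_hom_eqI[OF L.pullback_hom[OF fg(1)] L.pullback_hom[OF fg(2)], rotated 2])
    fix c assume "c \<in> carrier K"
    then show "on_sec f L.TA (L.A.gsec (K.indexed_const c)) = on_sec g L.TA (L.A.gsec (K.indexed_const c))"
      using fg by (simp add: L.khom_affine_iff)
  next
    fix i :: nat assume "i \<in> {0}"
    then show "on_sec f L.TA (L.A.gsec (K.indexed_var i)) = on_sec g L.TA (L.A.gsec (K.indexed_var i))"
      using eq by (simp add: line_fun_def line_coord_def)
  qed
qed

text \<open>Evaluation at \<open>s\<close>, with coefficients sent through the structure morphism,
  is a ring homomorphism to the global functions; \<open>affine_hom_exists\<close> turns it into a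
  morphism.\<close>

lemma line_hom_exists:
  assumes s: "s \<in> carrier (sec (und X) (topspace (pts (und X))))"
  obtains f where "f \<in> khom K X (affine_line K)" "line_fun K f = s"
proof -
  let ?S = "sec (und X) (topspace (pts (und X)))"
  define \<sigma> where "\<sigma> = (\<lambda>c. on_sec (str X) L.TK (K.gsec c))"
  interpret S: cring ?S by (rule L.XA.sec_cring) simp
  have "on_sec (str X) L.TK \<in> ring_hom (sec (Spec K) L.TK) ?S"
    using global_hom[OF lrs_hom_presheaf_hom[OF L.str_X]] by (simp add: K.sec_Spec)
  from ring_hom_trans[OF K.gsec_hom this] have sg: "\<sigma> \<in> ring_hom K ?S" by (simp add: o_def \<sigma>_def)
  interpret E: mpoly_evaluation K ?S \<sigma> "\<lambda>i. s" "{0}"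
    by unfold_locales (use sg s in auto)
  obtain f where f: "f \<in> lrs_hom (und X) (Spec (mpoly_ring K {0}))"
    "\<And>a. a \<in> carrier (mpoly_ring K {0}) \<Longrightarrow> on_sec f L.TA (L.A.gsec a) = E.ev a"
    using L.XA.affine_hom_exists[OF E.ev_hom] by blast
  have "f \<in> khom K X L.Y"
    unfolding L.khom_affine_iff using f(1) by (simp add: f(2) K.mpoly_const_closed E.ev_const) (simp add: \<sigma>_def)
  moreover have "line_fun K f = s"
    unfolding line_fun_def f(2)[OF line_coord_closed] unfolding line_coord_def by (rule E.ev_var) simp
  ultimately show thesis using that by (simp add: line_eq)
qed

text \<open>Through this the action of simplicial operators on morphisms becomes the pullback of
  functions, which is a ring homomorphism.\<close>

lemma line_fun_comp:
  assumes u: "u \<in> khom K W X" and f: "f \<in> khom K X (affine_line K)"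
  shows "line_fun K (kcomp W X (affine_line K) f u) = on_sec u (topspace (pts (und X))) (line_fun K f)"
proof -
  have "f \<in> presheaf_hom (und X) (Spec (mpoly_ring K {0}))"
    using khom_presheaf_hom[OF f] by (simp add: affine_line_def kSpec_def)
  from rs_comp_global[OF khom_presheaf_hom[OF u] this, unfolded L.A.sec_Spec(1,7), OF L.A.gsec_closed[OF line_coord_closed]]
  show ?thesis by (simp add: line_fun_def affine_line_def kSpec_def)
qed

end

section \<open>Contractible geometric realizations\<close>

lemma istopology_quotient:
  "istopology (\<lambda>V. V \<subseteq> q ` topspace Y \<and> openin Y {d \<in> topspace Y. q d \<in> V})"
  unfolding istopology_def
proof (intro conjI allI impI)
  fix S T
  assume S: "S \<subseteq> q ` topspace Y \<and> openin Y {d \<in> topspace Y. q d \<in> S}"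
    and T: "T \<subseteq> q ` topspace Y \<and> openin Y {d \<in> topspace Y. q d \<in> T}"
  show "S \<inter> T \<subseteq> q ` topspace Y" using S by blast
  have "{d \<in> topspace Y. q d \<in> S \<inter> T} = {d \<in> topspace Y. q d \<in> S} \<inter> {d \<in> topspace Y. q d \<in> T}"
    by blast
  then show "openin Y {d \<in> topspace Y. q d \<in> S \<inter> T}" using S T by (simp add: openin_Int)
next
  fix \<K>
  assume K: "\<forall>V\<in>\<K>. V \<subseteq> q ` topspace Y \<and> openin Y {d \<in> topspace Y. q d \<in> V}"
  show "\<Union>\<K> \<subseteq> q ` topspace Y" using K by blast
  have "{d \<in> topspace Y. q d \<in> \<Union>\<K>} = \<Union>((\<lambda>V. {d \<in> topspace Y. q d \<in> V}) ` \<K>)" by blast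
  then show "openin Y {d \<in> topspace Y. q d \<in> \<Union>\<K>}" using K by (auto intro!: openin_Union)
qed

lemma openin_realization:
  "openin (realization X) V \<longleftrightarrow> V \<subseteq> real_class X ` topspace (cells X) \<and>
     openin (cells X) {d \<in> topspace (cells X). real_class X d \<in> V}"
  unfolding realization_def by (subst topology_inverse'[OF istopology_quotient]) simp

lemma topspace_realization: "topspace (realization X) = real_class X ` topspace (cells X)"
proof (rule antisym)
  show "topspace (realization X) \<subseteq> real_class X ` topspace (cells X)"
    using openin_realization[of X "topspace (realization X)"] by simp
  have "{d \<in> topspace (cells X). real_class X d \<in> real_class X ` topspace (cells X)} = topspace (cells X)"
    by blast
  then have "openin (realization X) (real_class X ` topspace (cells X))"
    by (subst openin_realization) simp
  then show "real_class X ` topspace (cells X) \<subseteq> topspace (realization X)" by (rule openin_subset)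
qed

lemma quotient_map_real_class: "quotient_map (cells X) (realization X) (real_class X)"
  unfolding quotient_map_def topspace_realization by (auto simp: openin_realization)

lemma topspace_cells:
  "((n, x), t) \<in> topspace (cells X) \<longleftrightarrow> x \<in> simplices X n \<and> t \<in> standard_simplex n"
  unfolding cells_def by auto

lemma real_class_act:
  assumes "\<theta> \<in> simplex_cat m n" "x \<in> simplices X n" "t \<in> standard_simplex m"
  shows "real_class X ((m, act X m n \<theta> x), t) = real_class X ((n, x), simplex_push m \<theta> t)"
proof -
  let ?R = "glue X \<union> (glue X)\<inverse>"
  have "equiv UNIV (?R\<^sup>*)"
    by (rule equivI) (auto simp: refl_rtrancl sym_rtrancl sym_Un_converse trans_rtrancl)
  moreover have "(((m, act X m n \<theta> x), t), ((n, x), simplex_push m \<theta> t)) \<in> ?R\<^sup>*"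
    using assms by (intro r_into_rtrancl) (auto simp: glue_def)
  ultimately show ?thesis unfolding real_class_def by (rule equiv_class_eq)
qed

text \<open>Points of one class are joined by a chain of gluings and reversed gluings, so invariance
  under a single gluing suffices to define maps on the realization.\<close>

lemma real_class_invariant:
  assumes h: "\<And>m n \<theta> x t. \<theta> \<in> simplex_cat m n \<Longrightarrow> x \<in> simplices X n \<Longrightarrow> t \<in> standard_simplex m \<Longrightarrow>
       h ((m, act X m n \<theta> x), t) = h ((n, x), simplex_push m \<theta> t)"
    and eq: "real_class X d = real_class X d'"
  shows "h d = h d'"
proof -
  have "d' \<in> real_class X d" using eq by (simp add: real_class_def)
  then have "(d, d') \<in> (glue X \<union> (glue X)\<inverse>)\<^sup>*" by (simp add: real_class_def)
  then show ?thesis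
  proof (induction rule: rtrancl_induct)
    case (step y z)
    then have "h y = h z" by (auto simp: glue_def h)
    with step show ?case by simp
  qed simp
qed

subsection \<open>Joining two parallel faces\<close>

text \<open>The point at time \<open>s\<close> of the segment in the simplex with \<open>2n+2\<close> vertices, viewed as the join of
  two copies of the \<open>n\<close>-simplex, that joins the two copies of \<open>t\<close>.\<close>

definition simplex_join :: "nat \<Rightarrow> (nat \<Rightarrow> real) \<Rightarrow> real \<Rightarrow> nat \<Rightarrow> real" where
  "simplex_join n t s =
     (\<lambda>i. if i \<le> n then (1 - s) * t i else if i \<le> 2*n+1 then s * t (i - (n+1)) else 0)"

definition front_face :: "nat \<Rightarrow> nat \<Rightarrow> nat" where
  "front_face n = (\<lambda>i\<in>{..n}. i)"

definition back_face :: "nat \<Rightarrow> nat \<Rightarrow> nat" where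
  "back_face n = (\<lambda>i\<in>{..n}. i + (n+1))"

text \<open>The join of \<open>\<theta>\<close> with itself: the vertices \<open>0\<close> to
  \<open>n\<close> of the target form the first copy of [n], the vertices \<open>n+1\<close> to
  \<open>2*n+1\<close> the second.\<close>

definition double :: "nat \<Rightarrow> nat \<Rightarrow> (nat \<Rightarrow> nat) \<Rightarrow> nat \<Rightarrow> nat" where
  "double m n \<theta> = (\<lambda>i\<in>{..2*m+1}. if i \<le> m then \<theta> i else \<theta> (i - (m+1)) + (n+1))"

lemma front_face_in_simplex_cat: "front_face n \<in> simplex_cat n (2*n+1)"
  unfolding front_face_def simplex_cat_def by (auto simp: mono_on_def)

lemma back_face_in_simplex_cat: "back_face n \<in> simplex_cat n (2*n+1)"
  unfolding back_face_def simplex_cat_def by (auto simp: mono_on_def)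

lemma double_in_simplex_cat:
  assumes "\<theta> \<in> simplex_cat m n" shows "double m n \<theta> \<in> simplex_cat (2*m+1) (2*n+1)"
proof -
  have b: "\<theta> i \<le> n" if "i \<le> m" for i using assms that by (auto simp: simplex_cat_def)
  have mo: "\<theta> i \<le> \<theta> j" if "i \<le> j" "j \<le> m" for i j
    using assms that by (auto simp: simplex_cat_def mono_on_def)
  have "\<theta> i + Suc n \<le> Suc (2*n)" if "i \<le> m" for i using b[OF that] by simp
  moreover have "\<theta> i \<le> Suc (2*n)" if "i \<le> m" for i using b[OF that] by simp
  moreover have "\<theta> i \<le> \<theta> j + Suc n" if "i \<le> m" for i j using b[OF that] by simp
  ultimately show ?thesis
    unfolding double_def simplex_cat_def
    by (auto simp: mono_on_def intro!: mo)
qed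

lemma simplex_push_in:
  assumes "\<theta> \<in> {..m} \<rightarrow> {..n}" "t \<in> standard_simplex m"
  shows "simplex_push m \<theta> t \<in> standard_simplex n"
proof -
  have t: "\<And>i. 0 \<le> t i" "(\<Sum>i\<le>m. t i) = 1" using assms(2) by (auto simp: standard_simplex_def)
  have 0: "0 \<le> simplex_push m \<theta> t i" for i unfolding simplex_push_def by (simp add: sum_nonneg t)
  have 1: "simplex_push m \<theta> t i \<le> 1" for i
  proof -
    have "simplex_push m \<theta> t i \<le> (\<Sum>i\<le>m. t i)"
      unfolding simplex_push_def by (rule sum_mono2) (auto simp: t)
    then show ?thesis by (simp add: t)
  qed
  have 2: "simplex_push m \<theta> t i = 0" if "i > n" for i
  proof -
    have "{j. j \<le> m \<and> \<theta> j = i} = {}"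
    proof -
      have "\<theta> j \<noteq> i" if "j \<le> m" for j using funcset_mem[OF assms(1), of j] that \<open>i > n\<close> by auto
      then show ?thesis by blast
    qed
    then show ?thesis unfolding simplex_push_def by (simp only: sum.empty)
  qed
  have "(\<Sum>i\<le>n. simplex_push m \<theta> t i) = (\<Sum>i\<in>{..n}. \<Sum>j\<in>{j \<in> {..m}. \<theta> j = i}. t j)"
    unfolding simplex_push_def by simp
  also have "\<dots> = (\<Sum>j\<le>m. t j)"
    by (rule sum.group) (use assms(1) in auto)
  finally show ?thesis using 0 1 2 t by (auto simp: standard_simplex_def)
qed

lemma simplex_join_in:
  assumes "t \<in> standard_simplex n" "0 \<le> s" "s \<le> 1"
  shows "simplex_join n t s \<in> standard_simplex (2*n+1)"
proof -
  have t: "\<And>i. 0 \<le> t i" "\<And>i. t i \<le> 1" "(\<Sum>i\<le>n. t i) = 1" using assms(1) by (auto simp: standard_simplex_def)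
  have "(\<Sum>i\<le>2*n+1. simplex_join n t s i) =
      (\<Sum>i\<in>{..n}. simplex_join n t s i) + (\<Sum>i\<in>{n+1..2*n+1}. simplex_join n t s i)"
  proof -
    have "{..2*n+1} = {..n} \<union> {n+1..2*n+1}" by auto
    then show ?thesis by (simp only:) (rule sum.union_disjoint, auto)
  qed
  also have "(\<Sum>i\<in>{..n}. simplex_join n t s i) = (1 - s) * (\<Sum>i\<le>n. t i)"
    unfolding simplex_join_def by (simp add: sum_distrib_left)
  also have "(\<Sum>i\<in>{n+1..2*n+1}. simplex_join n t s i) = (\<Sum>i\<in>{0+(n+1)..n+(n+1)}. simplex_join n t s i)"
    by (rule sum.cong) auto
  also have "\<dots> = (\<Sum>i\<le>n. s * t i)"
    unfolding sum.shift_bounds_cl_nat_ivl atMost_atLeast0 by (rule sum.cong) (auto simp: simplex_join_def)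
  also have "\<dots> = s" by (simp add: sum_distrib_left[symmetric] t)
  finally have "(\<Sum>i\<le>2*n+1. simplex_join n t s i) = 1" by (simp add: t)
  then show ?thesis
    using assms(2,3) t by (auto simp: standard_simplex_def simplex_join_def intro!: mult_le_one)
qed

text \<open>Each fibre of \<open>double m n \<theta>\<close> is a fibre of \<open>\<theta>\<close>
  inside one of the two copies, where \<open>simplex_join\<close> scales all coordinates by the same
  factor. This makes the movement along the segments compatible with gluing.\<close>

lemma simplex_push_double:
  "simplex_push (2*m+1) (double m n \<theta>) (simplex_join m t s) = simplex_join n (simplex_push m \<theta> t) s"
  if th: "\<theta> \<in> simplex_cat m n"
proof
  fix i :: nat
  have b: "\<theta> i \<le> n" if "i \<le> m" for i using th that by (auto simp: simplex_cat_def)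
  have split: "{j. j \<le> 2*m+1 \<and> double m n \<theta> j = i} =
      {j. j \<le> m \<and> \<theta> j = i} \<union> (\<lambda>j. j + (m+1)) ` {j. j \<le> m \<and> \<theta> j + (n+1) = i}" (is "?L = ?A \<union> ?f ` ?B")
  proof (rule Set.set_eqI, rule iffI)
    fix j assume j: "j \<in> ?L"
    show "j \<in> ?A \<union> ?f ` ?B"
    proof (cases "j \<le> m")
      case True then show ?thesis using j by (auto simp: double_def)
    next
      case False
      then have "j = ?f (j - (m+1))" "j - (m+1) \<in> ?B" using j by (auto simp: double_def)
      then show ?thesis by blast
    qed
  qed (auto simp: double_def)
  have fA: "finite ?A" and fB: "finite ?B" by auto
  have "simplex_push (2*m+1) (double m n \<theta>) (simplex_join m t s) i
      = (\<Sum>j\<in>?A. simplex_join m t s j) + (\<Sum>j\<in>?f ` ?B. simplex_join m t s j)"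
    unfolding simplex_push_def split by (rule sum.union_disjoint) auto
  also have "(\<Sum>j\<in>?A. simplex_join m t s j) = (1 - s) * (\<Sum>j\<in>?A. t j)"
    by (simp add: sum_distrib_left simplex_join_def)
  also have "(\<Sum>j\<in>?f ` ?B. simplex_join m t s j) = (\<Sum>j\<in>?B. simplex_join m t s (?f j))"
    by (subst sum.reindex) (auto simp: inj_on_def)
  also have "\<dots> = s * (\<Sum>j\<in>?B. t j)"
    by (simp add: sum_distrib_left simplex_join_def)
  finally have e: "simplex_push (2*m+1) (double m n \<theta>) (simplex_join m t s) i
      = (1 - s) * (\<Sum>j\<in>?A. t j) + s * (\<Sum>j\<in>?B. t j)" .
  show "simplex_push (2*m+1) (double m n \<theta>) (simplex_join m t s) i = simplex_join n (simplex_push m \<theta> t) s i"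
  proof (cases "i \<le> n")
    case True
    then have "?B = {}" by auto
    with e True show ?thesis by (simp only: sum.empty) (simp add: simplex_join_def simplex_push_def)
  next
    case False
    then have A: "?A = {}" using b by auto
    show ?thesis
    proof (cases "i \<le> 2*n+1")
      case True
      have "?B = {j. j \<le> m \<and> \<theta> j = i - (n+1)}" using False by auto
      with e A False True show ?thesis by (simp only: A sum.empty) (simp add: simplex_join_def simplex_push_def)
    next
      case F2: False
      then have "?B = {}" using b by fastforce
      with e A False F2 show ?thesis by (simp only: A sum.empty) (simp add: simplex_join_def simplex_push_def)
    qed
  qed
qed

lemma simplex_push_front_face:
  assumes "t \<in> standard_simplex n" shows "simplex_push n (front_face n) t = simplex_join n t 0"
proof
  fix i
  have "{j. j \<le> n \<and> front_face n j = i} = (if i \<le> n then {i} else {})" by (auto simp: front_face_def)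
  then show "simplex_push n (front_face n) t i = simplex_join n t 0 i"
    by (simp add: simplex_push_def simplex_join_def)
qed

lemma simplex_push_back_face:
  assumes "t \<in> standard_simplex n" shows "simplex_push n (back_face n) t = simplex_join n t 1"
proof
  fix i
  have "{j. j \<le> n \<and> back_face n j = i} = (if n < i \<and> i \<le> 2*n+1 then {i - (n+1)} else {})"
    by (auto simp: back_face_def)
  then show "simplex_push n (back_face n) t i = simplex_join n t 1 i"
    by (simp add: simplex_push_def simplex_join_def)
qed

lemma simplex_push_to_vertex:
  assumes "t \<in> standard_simplex n" shows "simplex_push n (\<lambda>i\<in>{..n}. 0) t = (\<lambda>i::nat. if i = 0 then 1 else 0)"
proof
  fix i :: nat
  have "{j. j \<le> n \<and> (\<lambda>i\<in>{..n}. 0) j = i} = (if i = 0 then {..n} else {})" by auto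
  then show "simplex_push n (\<lambda>i\<in>{..n}. 0) t i = (if i = 0 then 1 else 0)"
    using assms by (simp add: simplex_push_def standard_simplex_def)
qed

abbreviation simplex_top :: "nat \<Rightarrow> (nat \<Rightarrow> real) topology" where
  "simplex_top n \<equiv> subtopology (powertop_real UNIV) (standard_simplex n)"

abbreviation unit_interval :: "real topology" where
  "unit_interval \<equiv> top_of_set {0..1}"

lemma continuous_simplex_join:
  "continuous_map (prod_topology unit_interval (simplex_top n)) (simplex_top (2*n+1))
     (\<lambda>p. simplex_join n (snd p) (fst p))"
proof (rule continuous_map_into_subtopology)
  let ?P = "prod_topology unit_interval (simplex_top n)"
  have c: "continuous_map ?P euclideanreal (\<lambda>p. snd p k)" for k
  proof -
    have "continuous_map (simplex_top n) euclideanreal (\<lambda>t. t k)"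
      by (intro continuous_map_from_subtopology continuous_map_product_projection) simp
    from continuous_map_compose[OF continuous_map_snd this] show ?thesis by (simp add: o_def)
  qed
  have f: "continuous_map ?P euclideanreal fst"
    using continuous_map_fst continuous_map_into_fulltopology by blast
  show "continuous_map ?P (powertop_real UNIV) (\<lambda>p. simplex_join n (snd p) (fst p))"
  proof (subst continuous_map_componentwise_UNIV, intro allI)
    fix k
    show "continuous_map ?P euclideanreal (\<lambda>p. simplex_join n (snd p) (fst p) k)"
      unfolding simplex_join_def
      by (cases "k \<le> n"; cases "k \<le> 2*n+1"; simp)
        (intro continuous_map_real_mult continuous_map_diff f c continuous_map_const[THEN iffD2] disjI2; simp)+
  qed
  show "(\<lambda>p. simplex_join n (snd p) (fst p)) \<in> topspace ?P \<rightarrow> standard_simplex (2*n+1)"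
    by (auto simp del: One_nat_def add_Suc_right intro!: simplex_join_in[simplified])
qed

text \<open>The injections of the summands are open maps, so products of open sets of
  \<open>Z\<close> with open sets of one summand are open in the whole product, and continuity can
  be checked cell by cell.\<close>

lemma continuous_map_prod_sum_topology:
  assumes "\<And>i. i \<in> I \<Longrightarrow> continuous_map (prod_topology Z (X i)) Y (\<lambda>p. f (fst p, (i, snd p)))"
  shows "continuous_map (prod_topology Z (sum_topology X I)) Y f"
  unfolding continuous_map_def
proof (intro conjI allI impI)
  show "f \<in> topspace (prod_topology Z (sum_topology X I)) \<rightarrow> topspace Y"
  proof
    fix p assume "p \<in> topspace (prod_topology Z (sum_topology X I))"
    then obtain z i x where p: "p = (z, (i, x))" "z \<in> topspace Z" "i \<in> I" "x \<in> topspace (X i)" by auto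
    then show "f p \<in> topspace Y"
      using continuous_map_image_subset_topspace[OF assms[OF p(3)]] by (force simp: image_subset_iff)
  qed
  fix W assume W: "openin Y W"
  show "openin (prod_topology Z (sum_topology X I)) {p \<in> topspace (prod_topology Z (sum_topology X I)). f p \<in> W}"
    (is "openin ?P ?S")
  proof (subst openin_subopen, intro ballI)
    fix p assume pS: "p \<in> ?S"
    then obtain z i x where p: "p = (z, (i, x))" "z \<in> topspace Z" "i \<in> I" "x \<in> topspace (X i)" "f p \<in> W" by auto
    have "openin (prod_topology Z (X i)) {p \<in> topspace (prod_topology Z (X i)). f (fst p, (i, snd p)) \<in> W}"
      using openin_continuous_map_preimage[OF assms[OF p(3)] W] .
    then obtain U V where UV: "openin Z U" "openin (X i) V" "z \<in> U" "x \<in> V"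
      and sub: "U \<times> V \<subseteq> {p \<in> topspace (prod_topology Z (X i)). f (fst p, (i, snd p)) \<in> W}"
      using p unfolding openin_prod_topology_alt by (elim allE[of _ z] allE[of _ x]) auto
    have "openin ?P (U \<times> Pair i ` V)"
      using UV(1) open_map_component_injection[OF p(3), of X] UV(2) by (simp add: openin_prod_Times_iff open_map_def)
    moreover have "U \<times> Pair i ` V \<subseteq> ?S" using sub p(3) by (auto)
    ultimately show "\<exists>T. openin ?P T \<and> p \<in> T \<and> T \<subseteq> ?S" using p UV by blast
  qed
qed

text \<open>\<open>\<Phi>\<close> extends every simplex \<open>x\<close> to the join of two copies of it, naturally in all \<open>\<theta>\<close>, such that the second
  copy is constant. Moving along the segments of the join contracts the realization.\<close>

theorem contractible_realization:
  fixes \<Phi> :: "nat \<Rightarrow> 'a \<Rightarrow> 'a"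
  assumes X: "simplicial_set X"
    and in_simp: "\<And>n x. x \<in> simplices X n \<Longrightarrow> \<Phi> n x \<in> simplices X (2*n+1)"
    and natural: "\<And>m n \<theta> x. \<theta> \<in> simplex_cat m n \<Longrightarrow> x \<in> simplices X n \<Longrightarrow>
        \<Phi> m (act X m n \<theta> x) = act X (2*m+1) (2*n+1) (double m n \<theta>) (\<Phi> n x)"
    and frnt: "\<And>n x. x \<in> simplices X n \<Longrightarrow> act X n (2*n+1) (front_face n) (\<Phi> n x) = x"
    and bck: "\<And>n x. x \<in> simplices X n \<Longrightarrow> act X n (2*n+1) (back_face n) (\<Phi> n x) = act X n 0 (\<lambda>i\<in>{..n}. 0) z"
    and z: "z \<in> simplices X 0"
  shows "contractible_space (realization X)"
proof -
  let ?q = "real_class X" and ?C = "cells X"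
  define j :: "real \<times> 'a cell_point \<Rightarrow> 'a cell_point" where
    "j = (\<lambda>(s, ((n, x), t)). ((2*n+1, \<Phi> n x), simplex_join n t s))"
  have jc: "continuous_map (prod_topology unit_interval ?C) ?C j"
    unfolding cells_def
  proof (rule continuous_map_prod_sum_topology)
    fix i assume "i \<in> Sigma UNIV (simplices X)"
    then obtain n x where i: "i = (n, x)" "x \<in> simplices X n" by auto
    have "(2*n+1, \<Phi> n x) \<in> Sigma UNIV (simplices X)" using in_simp[OF i(2)] by simp
    from continuous_map_component_injection[OF this, of "\<lambda>(n, x). simplex_top n"]
    have "continuous_map (simplex_top (2*n+1)) (sum_topology (\<lambda>(n, x). simplex_top n) (Sigma UNIV (simplices X)))
        (Pair (2*n+1, \<Phi> n x))" by simp
    from continuous_map_compose[OF continuous_simplex_join this]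
    show "continuous_map (prod_topology unit_interval (case i of (n, x) \<Rightarrow> simplex_top n))
           (sum_topology (\<lambda>(n, x). simplex_top n) (Sigma UNIV (simplices X))) (\<lambda>p. j (fst p, i, snd p))"
      by (simp add: i j_def o_def)
  qed
  define h where "h = (\<lambda>p. ?q (j p))"
  have hc: "continuous_map (prod_topology unit_interval ?C) (realization X) h"
    unfolding h_def using continuous_map_compose[OF jc quotient_imp_continuous_map[OF quotient_map_real_class]]
    by (simp add: o_def)
  \<comment> \<open>Naturality of \<open>\<Phi>\<close> replaces the operator
    \<open>\<theta>\<close> by \<open>double m n \<theta>\<close>. Gluing moves this to the points
    of the simplex, where it commutes with the segments.\<close>
  have inv: "h (s, d) = h (s, d')" if "?q d = ?q d'" "s \<in> {0..1}" for s d d'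
  proof -
    have "(\<lambda>d. h (s, d)) d = (\<lambda>d. h (s, d)) d'"
    proof (rule real_class_invariant[OF _ that(1)])
      fix m n \<theta> x t assume a: "\<theta> \<in> simplex_cat m n" "x \<in> simplices X n" "t \<in> standard_simplex m"
      have "h (s, ((m, act X m n \<theta> x), t)) = ?q ((2*m+1, act X (2*m+1) (2*n+1) (double m n \<theta>) (\<Phi> n x)), simplex_join m t s)"
        by (simp add: h_def j_def natural[OF a(1,2), simplified])
      also have "\<dots> = ?q ((2*n+1, \<Phi> n x), simplex_push (2*m+1) (double m n \<theta>) (simplex_join m t s))"
        using that a by (intro real_class_act double_in_simplex_cat in_simp simplex_join_in) auto
      finally show "h (s, ((m, act X m n \<theta> x), t)) = h (s, ((n, x), simplex_push m \<theta> t))"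
        using simplex_push_double[OF a(1)] by (simp add: h_def j_def)
    qed
    then show ?thesis by simp
  qed
  \<comment> \<open>By \<open>inv\<close> every representative gives the same value, so
    \<open>H\<close> is the map induced by \<open>h\<close> on classes.\<close>
  define H where "H = (\<lambda>(s, c). h (s, SOME d. d \<in> topspace ?C \<and> ?q d = c))"
  have Hq: "H (s, ?q d) = h (s, d)" if "d \<in> topspace ?C" "s \<in> {0..1}" for s d
  proof -
    have "\<exists>d'. d' \<in> topspace ?C \<and> ?q d' = ?q d" using that by blast
    from someI_ex[OF this] have "?q (SOME d'. d' \<in> topspace ?C \<and> ?q d' = ?q d) = ?q d" by blast
    from inv[OF this that(2)] show ?thesis by (simp add: H_def)
  qed
  \<comment> \<open>A product of a quotient map with an identity need not be a quotient map. For the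
    interval it is one, because the interval is locally compact and Hausdorff; this gives the
    continuity of \<open>H\<close>.\<close>
  have "quotient_map (prod_topology unit_interval ?C) (prod_topology unit_interval (realization X)) (\<lambda>(s, d). (s, ?q d))"
  proof (rule quotient_map_prod_right[OF _ _ quotient_map_real_class])
    show "locally_compact_space unit_interval"
      by (intro compact_imp_locally_compact_space) (simp add: compact_space_subtopology)
    show "Hausdorff_space unit_interval \<or> regular_space unit_interval"
      by (simp add: Hausdorff_space_subtopology)
  qed
  moreover have "continuous_map (prod_topology unit_interval ?C) (realization X) (H \<circ> (\<lambda>(s, d). (s, ?q d)))"
    by (rule continuous_map_eq[OF hc]) (auto simp: Hq)
  ultimately have Hc: "continuous_map (prod_topology unit_interval (realization X)) (realization X) H"
    by (rule continuous_compose_quotient_map)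
  define p where "p = ?q ((0, z), \<lambda>i. if i = 0 then 1 else 0)"
  have "homotopic_with (\<lambda>x. True) (realization X) (realization X) id (\<lambda>c. p)"
  proof (subst homotopic_with, simp, intro exI[of _ H] conjI ballI Hc)
    fix c assume "c \<in> topspace (realization X)"
    then obtain n x t where c: "c = ?q ((n, x), t)" "((n, x), t) \<in> topspace ?C"
      unfolding topspace_realization by auto
    then have xt: "x \<in> simplices X n" "t \<in> standard_simplex n" by (auto simp: topspace_cells)
    have "H (0, c) = ?q ((2*n+1, \<Phi> n x), simplex_push n (front_face n) t)"
      using c xt by (simp add: Hq h_def j_def simplex_push_front_face)
    also have "\<dots> = ?q ((n, act X n (2*n+1) (front_face n) (\<Phi> n x)), t)"
      using xt by (intro real_class_act[symmetric] front_face_in_simplex_cat in_simp)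
    also have "\<dots> = id c" using frnt[OF xt(1)] c by simp
    finally show "H (0, c) = id c" .
    have "H (1, c) = ?q ((2*n+1, \<Phi> n x), simplex_push n (back_face n) t)"
      using c xt by (simp add: Hq h_def j_def simplex_push_back_face)
    also have "\<dots> = ?q ((n, act X n (2*n+1) (back_face n) (\<Phi> n x)), t)"
      using xt by (intro real_class_act[symmetric] back_face_in_simplex_cat in_simp)
    also have "\<dots> = ?q ((n, act X n 0 (\<lambda>i\<in>{..n}. 0) z), t)" using bck[OF xt(1)] by simp
    \<comment> \<open>The back face is degenerate, so gluing moves it to dimension 0, where every
      point becomes the vertex.\<close>
    also have "\<dots> = ?q ((0, z), simplex_push n (\<lambda>i\<in>{..n}. 0) t)"
      using xt z by (intro real_class_act) (auto simp: simplex_cat_def mono_on_def)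
    also have "\<dots> = p" using simplex_push_to_vertex[OF xt(2)] by (simp add: p_def)
    finally show "H (1, c) = p" .
  qed auto
  then show ?thesis unfolding contractible_space_def by blast
qed

subsection \<open>Contractible spaces are weakly contractible\<close>

text \<open>The cube is dilated about its centre by the factor \<open>1 + s\<close> and clipped to
  the cube again. At \<open>s = 1\<close> a coordinate of at most \<open>1/4\<close> becomes
  \<open>0\<close> and one of at least \<open>3/4\<close> becomes \<open>1\<close>.\<close>

definition cube_expand :: "nat \<Rightarrow> real \<Rightarrow> (nat \<Rightarrow> real) \<Rightarrow> nat \<Rightarrow> real" where
  "cube_expand n s t = (\<lambda>i\<in>{..<n}. max 0 (min 1 ((t i - 1/2) * (1 + s) + 1/2)))"

text \<open>Vanishes on the boundary and is 1 where all coordinates lie between \<open>1/4\<close>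
  and \<open>3/4\<close>. The constant 4 fits the clipping of \<open>cube_expand\<close> at time
  1.\<close>

definition cube_bump :: "nat \<Rightarrow> (nat \<Rightarrow> real) \<Rightarrow> real" where
  "cube_bump n t = (\<Prod>i<n. min 1 (4 * min (t i) (1 - t i)))"

lemma topspace_cube: "topspace (cube n) = (\<Pi>\<^sub>E i\<in>{..<n}. {0..1})"
  by (simp add: cube_def)

lemma cube_expand_0: "t \<in> topspace (cube n) \<Longrightarrow> cube_expand n 0 t = t"
  by (fastforce simp: cube_expand_def topspace_cube PiE_iff extensional_def)

lemma cube_expand_boundary:
  assumes "t \<in> cube_boundary n" "0 \<le> s" shows "cube_expand n s t \<in> cube_boundary n"
proof -
  obtain i where i: "i < n" "t i = 0 \<or> t i = 1" using assms by (auto simp: cube_boundary_def)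
  then have "cube_expand n s t i = 0 \<or> cube_expand n s t i = 1" using assms(2) by (auto simp: cube_expand_def field_simps)
  moreover have "cube_expand n s t \<in> topspace (cube n)" by (auto simp: cube_expand_def topspace_cube)
  ultimately show ?thesis using i by (auto simp: cube_boundary_def)
qed

lemma cube_bump_range:
  assumes "t \<in> topspace (cube n)" shows "0 \<le> cube_bump n t" "cube_bump n t \<le> 1"
proof -
  have "0 \<le> t i \<and> t i \<le> 1" if "i < n" for i using assms that by (auto simp: topspace_cube PiE_iff)
  then show "0 \<le> cube_bump n t" "cube_bump n t \<le> 1"
    unfolding cube_bump_def by (auto intro!: prod_nonneg prod_le_1)
qed

lemma cube_bump_boundary: "t \<in> cube_boundary n \<Longrightarrow> cube_bump n t = 0"
  unfolding cube_bump_def cube_boundary_def by (auto simp: prod_zero_iff intro!: bexI)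

text \<open>If the bump is not 1, some coordinate lies outside the middle interval, and the dilation
  by 2 clips it to 0 or 1. So an expanded spheroid is at the base point wherever the contraction is
  slowed down.\<close>

lemma cube_bump_or_expand_boundary:
  assumes "t \<in> topspace (cube n)" shows "cube_bump n t = 1 \<or> cube_expand n 1 t \<in> cube_boundary n"
proof (cases "\<forall>i<n. 1/4 \<le> t i \<and> t i \<le> 3/4")
  case True then show ?thesis unfolding cube_bump_def by (intro disjI1 prod.neutral) (auto simp: min_def)
next
  case False
  then obtain i where i: "i < n" "t i < 1/4 \<or> 3/4 < t i" by force
  then have "cube_expand n 1 t i = 0 \<or> cube_expand n 1 t i = 1" by (auto simp: cube_expand_def field_simps)
  moreover have "cube_expand n 1 t \<in> topspace (cube n)" by (auto simp: cube_expand_def topspace_cube)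
  ultimately show ?thesis using i by (auto simp: cube_boundary_def)
qed

lemma continuous_cube_coordinate: "i < n \<Longrightarrow> continuous_map (cube n) euclideanreal (\<lambda>t. t i)"
  unfolding cube_def using continuous_map_product_projection[of i "{..<n}" "\<lambda>i. unit_interval"]
  by (auto intro: continuous_map_into_fulltopology)

lemma continuous_cube_bump: "continuous_map (cube n) unit_interval (cube_bump n)"
proof (rule continuous_map_into_subtopology)
  show "continuous_map (cube n) euclideanreal (cube_bump n)"
    unfolding cube_bump_def[abs_def]
    by (intro continuous_map_prod continuous_map_real_min continuous_map_real_mult continuous_map_diff
        continuous_cube_coordinate continuous_map_const[THEN iffD2] disjI2) auto
qed (use cube_bump_range in auto)

lemma continuous_cube_expand:
  "continuous_map (prod_topology unit_interval (cube n)) (cube n) (\<lambda>p. cube_expand n (fst p) (snd p))"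
proof -
  let ?P = "prod_topology unit_interval (cube n)"
  have c: "continuous_map ?P euclideanreal (\<lambda>p. snd p i)" if "i < n" for i
    using continuous_map_compose[OF continuous_map_snd continuous_cube_coordinate[OF that]] by (simp add: o_def)
  have f: "continuous_map ?P euclideanreal fst"
    using continuous_map_fst continuous_map_into_fulltopology by blast
  show ?thesis
    unfolding cube_def[of n] continuous_map_componentwise
  proof (intro conjI ballI)
    show "(\<lambda>p. cube_expand n (fst p) (snd p)) ` topspace (prod_topology unit_interval (product_topology (\<lambda>i. unit_interval) {..<n}))
        \<subseteq> extensional {..<n}" by (auto simp: cube_expand_def)
    fix k assume k: "k \<in> {..<n}"
    have "continuous_map ?P unit_interval (\<lambda>p. cube_expand n (fst p) (snd p) k)"
    proof (rule continuous_map_into_subtopology)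
      show "continuous_map ?P euclideanreal (\<lambda>p. cube_expand n (fst p) (snd p) k)"
        unfolding cube_expand_def using k
        by simp (intro continuous_map_real_max continuous_map_real_min continuous_map_real_mult continuous_map_diff
            continuous_map_add c f continuous_map_const[THEN iffD2] disjI2; simp)
    qed (use k in \<open>auto simp: cube_expand_def\<close>)
    then show "continuous_map (prod_topology unit_interval (product_topology (\<lambda>i. unit_interval) {..<n})) unit_interval
        (\<lambda>p. cube_expand n (fst p) (snd p) k)" by (simp add: cube_def)
  qed
qed

lemma cube_boundary_subset: "cube_boundary n \<subseteq> topspace (cube n)"
  by (auto simp: cube_boundary_def)

text \<open>A free contraction moves the base point along a path \<open>\<gamma>\<close>. After \<open>g\<close> has been made constant
  near the boundary, the contraction is slowed down there, which leaves a map that factors through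
  \<open>\<gamma>\<close>.\<close>

lemma contractible_spheroid_trivial:
  assumes X: "contractible_space X" and x: "x \<in> topspace X" and g: "g \<in> spheroids n X x"
  shows "homotopic_with (\<lambda>u. u ` cube_boundary n \<subseteq> {x}) (cube n) X g (\<lambda>t. x)"
proof -
  let ?P = "\<lambda>u. u ` cube_boundary n \<subseteq> {x}"
  let ?IC = "prod_topology unit_interval (cube n)"
  have P_cong: "?P h \<longleftrightarrow> ?P k" if "\<And>t. t \<in> topspace (cube n) \<Longrightarrow> h t = k t" for h k
    using that cube_boundary_subset[of n] by (force simp: image_subset_iff)
  have gc: "continuous_map (cube n) X g" and gb: "\<And>t. t \<in> cube_boundary n \<Longrightarrow> g t = x"
    using g by (auto simp: spheroids_def)
  obtain a H where Hc: "continuous_map (prod_topology unit_interval X) X H"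
    and H0: "\<And>y. H (0, y) = y" and H1: "\<And>y. H (1, y) = a"
    using X by (auto simp: contractible_space_def homotopic_with_def)
  have fc: "continuous_map ?IC unit_interval fst" and sc: "continuous_map ?IC (cube n) snd"
    by (simp_all add: continuous_map_fst continuous_map_snd)
  have bc: "continuous_map ?IC unit_interval (\<lambda>p. cube_bump n (snd p))"
    using continuous_map_compose[OF sc continuous_cube_bump] by (simp add: o_def)
  have toR: "continuous_map ?IC euclideanreal f" if "continuous_map ?IC unit_interval f" for f
    using that continuous_map_into_fulltopology by blast
  define g1 where "g1 = (\<lambda>t. g (cube_expand n 1 t))"
  have g1c: "continuous_map (cube n) X g1"
  proof -
    have "continuous_map (cube n) ?IC (\<lambda>t. (1, t))" by (intro continuous_map_pairedI) auto
    from continuous_map_compose[OF continuous_map_compose[OF this continuous_cube_expand] gc]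
    show ?thesis by (simp add: g1_def o_def)
  qed
  have s1: "homotopic_with ?P (cube n) X g g1"
  proof (subst homotopic_with[OF P_cong], simp, intro exI[of _ "\<lambda>p. g (cube_expand n (fst p) (snd p))"] conjI ballI)
    show "continuous_map ?IC X (\<lambda>p. g (cube_expand n (fst p) (snd p)))"
      using continuous_map_compose[OF continuous_cube_expand gc] by (simp add: o_def)
  qed (auto simp: cube_expand_0 g1_def gb cube_expand_boundary)
  define w where "w = (\<lambda>t. H (cube_bump n t, x))"
  have s2: "homotopic_with ?P (cube n) X g1 w"
  proof (subst homotopic_with[OF P_cong], simp,
      intro exI[of _ "\<lambda>p. H (min (fst p) (cube_bump n (snd p)), g1 (snd p))"] conjI ballI)
    have "continuous_map ?IC unit_interval (\<lambda>p. min (fst p) (cube_bump n (snd p)))"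
    proof (rule continuous_map_into_subtopology)
      show "continuous_map ?IC euclideanreal (\<lambda>p. min (fst p) (cube_bump n (snd p)))"
        by (rule continuous_map_real_min[OF toR[OF fc] toR[OF bc]])
    qed (auto simp: min_def cube_bump_range)
    moreover have "continuous_map ?IC X (\<lambda>p. g1 (snd p))"
      using continuous_map_compose[OF sc g1c] by (simp add: o_def)
    ultimately have "continuous_map ?IC (prod_topology unit_interval X) (\<lambda>p. (min (fst p) (cube_bump n (snd p)), g1 (snd p)))"
      by (rule continuous_map_pairedI)
    from continuous_map_compose[OF this Hc]
    show "continuous_map ?IC X (\<lambda>p. H (min (fst p) (cube_bump n (snd p)), g1 (snd p)))" by (simp add: o_def)
  next
    fix t assume t: "t \<in> topspace (cube n)"
    then show "H (min (fst (0, t)) (cube_bump n (snd (0, t))), g1 (snd (0, t))) = g1 t"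
      using cube_bump_range[OF t] H0 by simp
    \<comment> \<open>Where the bump is 1 both sides are the end point \<open>a\<close> of the
      contraction; elsewhere \<open>g1 t\<close> is the base point \<open>x\<close>.\<close>
    show "H (min (fst (1, t)) (cube_bump n (snd (1, t))), g1 (snd (1, t))) = w t"
      using cube_bump_range[OF t] cube_bump_or_expand_boundary[OF t] gb H1 by (auto simp: w_def g1_def)
  next
    fix s :: real assume "s \<in> {0..1}"
    then show "?P (\<lambda>t. H (min (fst (s, t)) (cube_bump n (snd (s, t))), g1 (snd (s, t))))"
      by (auto simp: cube_bump_boundary H0 g1_def gb cube_expand_boundary)
  qed
  \<comment> \<open>The map \<open>w\<close> only runs along the path of \<open>x\<close> under the
    contraction, so shrinking the time to 0 pulls it back to \<open>x\<close>. On the boundary the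
    time is 0 throughout.\<close>
  have s3: "homotopic_with ?P (cube n) X w (\<lambda>t. x)"
  proof (subst homotopic_with[OF P_cong], simp,
      intro exI[of _ "\<lambda>p. H ((1 - fst p) * cube_bump n (snd p), x)"] conjI ballI)
    have "continuous_map ?IC unit_interval (\<lambda>p. (1 - fst p) * cube_bump n (snd p))"
    proof (rule continuous_map_into_subtopology)
      show "continuous_map ?IC euclideanreal (\<lambda>p. (1 - fst p) * cube_bump n (snd p))"
        by (intro continuous_map_real_mult[OF _ toR[OF bc]] continuous_map_diff[OF _ toR[OF fc]]) simp
    qed (auto intro!: mult_le_one mult_nonneg_nonneg cube_bump_range)
    then have "continuous_map ?IC (prod_topology unit_interval X) (\<lambda>p. ((1 - fst p) * cube_bump n (snd p), x))"
      using x by (intro continuous_map_pairedI) auto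
    from continuous_map_compose[OF this Hc]
    show "continuous_map ?IC X (\<lambda>p. H ((1 - fst p) * cube_bump n (snd p), x))" by (simp add: o_def)
  qed (auto simp: w_def H0 cube_bump_boundary)
  show ?thesis using s1 s2 s3 homotopic_with_trans by blast
qed

lemma contractible_homotopy_set:
  assumes "contractible_space X" "x \<in> topspace X"
  shows "homotopy_set n X x = {spheroid_class n X x (\<lambda>t. x)}"
proof -
  let ?P = "\<lambda>u. u ` cube_boundary n \<subseteq> {x}"
  have "spheroid_class n X x g = spheroid_class n X x (\<lambda>t. x)" if "g \<in> spheroids n X x" for g
    unfolding spheroid_class_def
  proof (rule Collect_cong, rule iffI)
    let ?c = "\<lambda>t. x"
    note t = contractible_spheroid_trivial[OF assms that]
    fix h
    show "homotopic_with ?P (cube n) X ?c h" if "homotopic_with ?P (cube n) X g h"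
      by (rule homotopic_with_trans[OF homotopic_with_symD[OF t] that])
    show "homotopic_with ?P (cube n) X g h" if "homotopic_with ?P (cube n) X ?c h"
      by (rule homotopic_with_trans[OF t that])
  qed
  moreover have "(\<lambda>t. x) \<in> spheroids n X x" using assms by (auto simp: spheroids_def)
  ultimately show ?thesis unfolding homotopy_set_def by blast
qed

text \<open>Path components and homotopy sets are singletons on both sides, so any map is bijective
  on them once the unions that describe the induced maps are seen to be the unique classes of the
  target.\<close>

lemma weak_homotopy_equivalence_contractible:
  assumes X: "contractible_space X" and Y: "contractible_space Y"
    and ne: "topspace X \<noteq> {}" and f: "continuous_map X Y f"
  shows "weak_homotopy_equivalence X Y f"
  unfolding weak_homotopy_equivalence_def
proof (intro conjI f allI impI ballI)
  have fx: "f x \<in> topspace Y" if "x \<in> topspace X" for x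
    using f that by (auto simp: continuous_map_def)
  have Yp: "path_component_of_set Y y = topspace Y" if "y \<in> topspace Y" for y
    using contractible_imp_path_connected_space[OF Y] that
    by (simp add: path_connected_space_path_component_set)
  have "topspace Y \<noteq> {}" using ne fx by blast
  then have cY: "path_components_of Y = {topspace Y}"
    using contractible_imp_path_connected_space[OF Y] by (subst path_components_of_eq_singleton) auto
  have cX: "path_components_of X = {topspace X}"
    using ne contractible_imp_path_connected_space[OF X] by (subst path_components_of_eq_singleton) auto
  have "(\<Union>x\<in>topspace X. path_component_of_set Y (f x)) = topspace Y"
    using ne fx Yp by blast
  then show "bij_betw (\<lambda>C. \<Union>x\<in>C. path_component_of_set Y (f x)) (path_components_of X) (path_components_of Y)"
    unfolding cX cY by (simp add: bij_betw_def)
next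
  fix n :: nat and x assume x: "x \<in> topspace X"
  then have y: "f x \<in> topspace Y" using f by (auto simp: continuous_map_def)
  let ?c = "\<lambda>t. x" and ?P = "\<lambda>u. u ` cube_boundary n \<subseteq> {x}"
  have sX: "g \<in> spheroids n X x" if "g \<in> spheroid_class n X x ?c" for g
    using that homotopic_with_imp_property[of ?P "cube n" X ?c g] homotopic_with_imp_continuous_maps[of ?P "cube n" X ?c g]
    by (auto simp: spheroid_class_def spheroids_def)
  have eq: "spheroid_class n Y (f x) h = spheroid_class n Y (f x) (\<lambda>t. f x)" if "h \<in> spheroids n Y (f x)" for h
    using that contractible_homotopy_set[OF Y y, of n] unfolding homotopy_set_def by blast
  have "f \<circ> g \<in> spheroids n Y (f x)" if "g \<in> spheroids n X x" for g
    using that continuous_map_compose[OF _ f] by (auto simp: spheroids_def)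
  moreover have "?c \<in> spheroid_class n X x ?c"
    using x by (auto simp: spheroid_class_def homotopic_with_refl)
  ultimately have "(\<Union>g\<in>spheroid_class n X x ?c. spheroid_class n Y (f x) (f \<circ> g)) = spheroid_class n Y (f x) (\<lambda>t. f x)"
    using sX eq by blast
  then show "bij_betw (\<lambda>c. \<Union>g\<in>c. spheroid_class n Y (f x) (f \<circ> g)) (homotopy_set n X x) (homotopy_set n Y (f x))"
    unfolding contractible_homotopy_set[OF X x] contractible_homotopy_set[OF Y y] by (simp add: bij_betw_def)
qed

lemma simplicial_set_point: "simplicial_set point_sset"
  by (simp add: simplicial_set_def point_sset_def)

lemma vertex_in_standard_simplex: "(\<lambda>i. if i = 0 then 1 else 0) \<in> standard_simplex n"
  by (auto simp: standard_simplex_def)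

text \<open>Every simplex of the point is the degeneracy of its vertex, so gluing moves all points
  to the single point of dimension 0.\<close>

lemma topspace_realization_point: "\<exists>p. topspace (realization point_sset) = {p}"
proof -
  define e where "e = (\<lambda>i::nat. if i = 0 then 1 else 0 :: real)"
  define p where "p = real_class point_sset ((0, ()), e)"
  have *: "real_class point_sset ((n, u), t) = p" if "t \<in> standard_simplex n" for n u t
    using real_class_act[of "\<lambda>i\<in>{..n}. 0" n 0 "()" point_sset t] that simplex_push_to_vertex[OF that]
    by (simp add: simplex_cat_def mono_on_def point_sset_def p_def e_def)
  have "real_class point_sset d = p" if "d \<in> topspace (cells point_sset)" for d
  proof -
    obtain n u t where "d = ((n, u), t)" by (metis surj_pair)
    then show ?thesis using that by (simp only: topspace_cells *)
  qed
  moreover have "((0, ()), e) \<in> topspace (cells point_sset)"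
    using vertex_in_standard_simplex by (simp add: topspace_cells point_sset_def e_def)
  ultimately have "real_class point_sset ` topspace (cells point_sset) = {p}" by blast
  then show ?thesis unfolding topspace_realization by blast
qed

lemma contractible_ssetI:
  assumes X: "simplicial_set X" and c: "contractible_space (realization X)" and ne: "simplices X 0 \<noteq> {}"
  shows "contractible_sset X"
  unfolding contractible_sset_def weak_equivalence_def
proof
  show "simplicial_map X point_sset (\<lambda>n x. ())"
    using X simplicial_set_point by (simp add: simplicial_map_def point_sset_def)
  obtain p where p: "topspace (realization point_sset) = {p}" using topspace_realization_point by blast
  let ?f = "realization_map point_sset (\<lambda>n x. ()) :: 'a cell_point set \<Rightarrow> _"
  have f: "?f c = p" if c: "c \<in> topspace (realization X)" for c
  proof -
    obtain d where d: "d \<in> topspace (cells X)" "c = real_class X d" using c unfolding topspace_realization by blast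
    have "real_class point_sset ((n, ()), t) = p" if "t \<in> standard_simplex n" for n t
      using p that unfolding topspace_realization by (force simp: topspace_cells point_sset_def)
    \<comment> \<open>\<open>realization_map\<close> is a union over the members of a class, so each
      member must be a genuine point of a cell. Gluing stays among these, since \<open>act\<close>
      preserves simplices and \<open>simplex_push\<close> preserves standard simplices.\<close>
    moreover have "t \<in> standard_simplex n" if "((n, x), t) \<in> c" for n x t
    proof -
      have "(d, ((n, x), t)) \<in> (glue X \<union> (glue X)\<inverse>)\<^sup>*" using that d by (simp add: real_class_def)
      then have "((n, x), t) \<in> topspace (cells X)"
      proof (induction rule: rtrancl_induct)
        case (step y z)
        then show ?case using X
          by (auto simp: glue_def topspace_cells simplicial_set_def simplex_cat_def intro!: simplex_push_in)
      qed (rule d)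
      then show ?thesis by (simp add: topspace_cells)
    qed
    moreover have "d \<in> c" using d by (simp add: real_class_def)
    ultimately show ?thesis unfolding realization_map_def by (cases d) force
  qed
  show "weak_homotopy_equivalence (realization X) (realization point_sset) ?f"
  proof (rule weak_homotopy_equivalence_contractible[OF c])
    have "homotopic_with (\<lambda>x. True) (realization point_sset) (realization point_sset) id (\<lambda>x. p)"
      by (rule homotopic_with_equal) (auto simp: p)
    then show "contractible_space (realization point_sset)" unfolding contractible_space_def by blast
    show "continuous_map (realization X) (realization point_sset) ?f"
      by (rule continuous_map_eq[of _ _ "\<lambda>c. p"]) (auto simp: f p)
    obtain x where "x \<in> simplices X 0" using ne by blast
    then have "((0, x), \<lambda>i. if i = 0 then 1 else 0) \<in> topspace (cells X)"
      using vertex_in_standard_simplex by (simp add: topspace_cells)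
    then show "topspace (realization X) \<noteq> {}" unfolding topspace_realization by blast
  qed
qed

section \<open>The rings of the algebraic simplices\<close>

text \<open>Applied to the additive monoid of a ring, this adds up coordinates fibre by fibre over
  the vertices of the target.\<close>

lemma (in comm_monoid) finprod_fibres:
  assumes "finite B" "finite C" "\<And>j. j \<in> C \<Longrightarrow> f j \<in> carrier G"
  shows "(\<Otimes>i\<in>B. \<Otimes>j\<in>{j \<in> C. h j = i}. f j) = (\<Otimes>j\<in>{j \<in> C. h j \<in> B}. f j)"
proof -
  have "(\<Otimes>j\<in>(\<Union>i\<in>B. {j \<in> C. h j = i}). f j) = (\<Otimes>i\<in>B. \<Otimes>j\<in>{j \<in> C. h j = i}. f j)"
    using assms by (intro finprod_UN_disjoint) (auto simp: pairwise_def disjnt_def)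
  moreover have "(\<Union>i\<in>B. {j \<in> C. h j = i}) = {j \<in> C. h j \<in> B}" by auto
  ultimately show ?thesis by simp
qed

lemma ring_hom_finsum:
  assumes h: "h \<in> ring_hom A B" and A: "ring A" and B: "ring B" and f: "\<And>i. i \<in> I \<Longrightarrow> f i \<in> carrier A"
  shows "h (\<Oplus>\<^bsub>A\<^esub>i\<in>I. f i) = (\<Oplus>\<^bsub>B\<^esub>i\<in>I. h (f i))"
proof -
  interpret A: ring A by (rule A)
  interpret B: ring B by (rule B)
  note hc = ring_hom_closed[OF h]
  show ?thesis
  proof (cases "finite I")
    case True
    then show ?thesis using f
    proof (induction I)
      case empty
      then show ?case using ring_hom_zero[OF h A B] by simp
    next
      case (insert i I)
      then show ?case
        using ring_hom_add[OF h, of "f i" "\<Oplus>\<^bsub>A\<^esub>i\<in>I. f i"] hc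
        by (simp add: A.finsum_insert B.finsum_insert Pi_iff A.finsum_closed)
    qed
  next
    \<comment> \<open>Over an infinite index set both sums are zero by convention.\<close>
    case False
    then show ?thesis using ring_hom_zero[OF h A B] by (simp add: A.finsum_infinite B.finsum_infinite)
  qed
qed

context base_ring
begin

abbreviation Pr where "Pr n \<equiv> mpoly_ring R {..n}"
abbreviation Sr where "Sr n \<equiv> simplex_ring R n"
abbreviation cls where "cls n \<equiv> simplex_class R n"

definition simplex_rel where
  "simplex_rel n = \<one>\<^bsub>Pr n\<^esub> \<ominus>\<^bsub>Pr n\<^esub> (\<Oplus>\<^bsub>Pr n\<^esub>i\<in>{..n}. indexed_var i)"

lemma simplex_rel_closed: "simplex_rel n \<in> carrier (Pr n)"
proof -
  interpret P: cring "Pr n" by (rule mpoly_cring)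
  show ?thesis unfolding simplex_rel_def by (intro P.minus_closed P.one_closed P.finsum_closed) (auto intro: mpoly_var_closed)
qed

lemma simplex_ideal_eq: "simplex_ideal R n = cgenideal (Pr n) (simplex_rel n)"
  by (simp add: simplex_ideal_def simplex_rel_def Let_def)

lemma ideal_simplex_ideal: "ideal (simplex_ideal R n) (Pr n)"
  unfolding simplex_ideal_eq by (rule cring.cgenideal_ideal[OF mpoly_cring simplex_rel_closed])

lemma simplex_ring_cring: "cring (Sr n)"
  unfolding simplex_ring_def by (rule ideal.quotient_is_cring[OF ideal_simplex_ideal mpoly_cring])

lemma cls_hom: "cls n \<in> ring_hom (Pr n) (Sr n)"
proof -
  have "cls n = (+>\<^bsub>Pr n\<^esub>) (simplex_ideal R n)" by (simp add: fun_eq_iff simplex_class_def)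
  then show ?thesis unfolding simplex_ring_def using ideal.rcos_ring_hom[OF ideal_simplex_ideal] by simp
qed

lemma cls_cases:
  assumes "c \<in> carrier (Sr n)" obtains f where "f \<in> carrier (Pr n)" "c = cls n f"
  using assms unfolding simplex_ring_def simplex_class_def FactRing_def A_RCOSETS_def' by auto

definition sconst where "sconst n c = cls n (indexed_const c)"
definition scoord where "scoord n i = cls n (indexed_var i)"

text \<open>Sums over sets of vertices are stable under pullback, whereas a single coordinate pulls
  back to the sum over a fibre.\<close>

definition coord_sum where "coord_sum n B = (\<Oplus>\<^bsub>Sr n\<^esub>i\<in>B. scoord n i)"

lemma sconst_hom: "sconst n \<in> ring_hom R (Sr n)"
  using ring_hom_trans[OF indexed_const_hom cls_hom] by (simp add: sconst_def[abs_def] o_def)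

lemma scoord_closed: "i \<le> n \<Longrightarrow> scoord n i \<in> carrier (Sr n)"
  unfolding scoord_def by (rule ring_hom_closed[OF cls_hom mpoly_var_closed]) simp

lemma coord_sum_closed: "B \<subseteq> {..n} \<Longrightarrow> coord_sum n B \<in> carrier (Sr n)"
proof -
  assume B: "B \<subseteq> {..n}"
  interpret S: cring "Sr n" by (rule simplex_ring_cring)
  show ?thesis unfolding coord_sum_def using B by (intro S.finsum_closed) (auto intro: scoord_closed)
qed

lemma coord_sum_empty: "coord_sum n {} = \<zero>\<^bsub>Sr n\<^esub>"
proof -
  interpret S: cring "Sr n" by (rule simplex_ring_cring)
  show ?thesis by (simp add: coord_sum_def)
qed

lemma coord_sum_singleton: "i \<le> n \<Longrightarrow> coord_sum n {i} = scoord n i"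
proof -
  interpret S: cring "Sr n" by (rule simplex_ring_cring)
  show "i \<le> n \<Longrightarrow> ?thesis" using scoord_closed[of i n] by (simp add: coord_sum_def S.finsum_insert)
qed

lemma coord_sum_all: "coord_sum n {..n} = \<one>\<^bsub>Sr n\<^esub>"
proof -
  interpret P: cring "Pr n" by (rule mpoly_cring)
  interpret S: cring "Sr n" by (rule simplex_ring_cring)
  interpret I: ideal "simplex_ideal R n" "Pr n" by (rule ideal_simplex_ideal)
  let ?s = "\<Oplus>\<^bsub>Pr n\<^esub>i\<in>{..n}. indexed_var i"
  have s: "?s \<in> carrier (Pr n)" by (intro P.finsum_closed) (auto intro: mpoly_var_closed)
  have "simplex_rel n \<in> simplex_ideal R n"
    unfolding simplex_ideal_eq by (rule P.cgenideal_self[OF simplex_rel_closed])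
  then have z: "cls n (simplex_rel n) = \<zero>\<^bsub>Sr n\<^esub>"
    unfolding simplex_class_def simplex_ring_def FactRing_def by (simp add: I.a_rcos_const)
  have "\<one>\<^bsub>Pr n\<^esub> = simplex_rel n \<oplus>\<^bsub>Pr n\<^esub> ?s"
    unfolding simplex_rel_def using s by (simp add: P.minus_eq P.a_assoc P.l_neg)
  then have "cls n \<one>\<^bsub>Pr n\<^esub> = cls n (simplex_rel n) \<oplus>\<^bsub>Sr n\<^esub> cls n ?s"
    using ring_hom_add[OF cls_hom simplex_rel_closed s] by simp
  then have "\<one>\<^bsub>Sr n\<^esub> = cls n ?s"
    unfolding z using ring_hom_one[OF cls_hom] ring_hom_closed[OF cls_hom s] by simp
  then show ?thesis
    using ring_hom_finsum[OF cls_hom P.ring_axioms S.ring_axioms, where f = indexed_var and I = "{..n}"] mpoly_var_closed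
    by (simp add: coord_sum_def scoord_def)
qed

lemma simplex_hom_eqI:
  assumes F: "F \<in> ring_hom (Sr n) S" and G: "G \<in> ring_hom (Sr n) S"
    and c: "\<And>c. c \<in> carrier R \<Longrightarrow> F (sconst n c) = G (sconst n c)"
    and v: "\<And>i. i \<le> n \<Longrightarrow> F (scoord n i) = G (scoord n i)"
    and x: "x \<in> carrier (Sr n)"
  shows "F x = G x"
proof -
  obtain f where f: "f \<in> carrier (Pr n)" "x = cls n f" using cls_cases[OF x] .
  have "(F \<circ> cls n) f = (G \<circ> cls n) f"
    by (rule mpoly_hom_eqI[OF ring_hom_trans[OF cls_hom F] ring_hom_trans[OF cls_hom G] _ _ f(1)])
      (use c v in \<open>auto simp: sconst_def scoord_def\<close>)
  then show ?thesis by (simp add: f)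
qed

end

section \<open>Ring homomorphisms induced by maps of vertices\<close>

locale simplex_morphism = base_ring R for R :: "'k ring" (structure) +
  fixes m n :: nat and \<theta> assumes th: "\<theta> \<in> {..m} \<rightarrow> {..n}"
begin

abbreviation fibre where "fibre B \<equiv> {j. j \<le> m \<and> \<theta> j \<in> B}"

lemma coord_sum_fibres:
  assumes "finite B" shows "(\<Oplus>\<^bsub>Sr m\<^esub>i\<in>B. coord_sum m (fibre {i})) = coord_sum m (fibre B)"
proof -
  interpret S: cring "Sr m" by (rule simplex_ring_cring)
  have "(\<Oplus>\<^bsub>Sr m\<^esub>i\<in>B. \<Oplus>\<^bsub>Sr m\<^esub>j\<in>{j \<in> {..m}. \<theta> j = i}. scoord m j) = (\<Oplus>\<^bsub>Sr m\<^esub>j\<in>{j \<in> {..m}. \<theta> j \<in> B}. scoord m j)"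
    using assms by (intro S.add.finprod_fibres) (auto intro: scoord_closed)
  then show ?thesis by (simp add: coord_sum_def)
qed

definition fibre_sum where "fibre_sum i = coord_sum m (fibre {i})"

lemma fibre_sum_closed: "fibre_sum i \<in> carrier (Sr m)"
  unfolding fibre_sum_def by (rule coord_sum_closed) auto

sublocale E: mpoly_evaluation R "Sr m" "sconst m" fibre_sum "{..n}"
  by (intro mpoly_evaluation.intro mpoly_evaluation_axioms.intro base_ring_axioms simplex_ring_cring sconst_hom fibre_sum_closed)

text \<open>The fibres of \<open>\<theta>\<close> partition the vertices of the source, so the sum
  of all \<open>X\<^sub>i\<close> evaluates to the sum of all coordinates, which is 1. Hence the
  generator of the ideal evaluates to zero.\<close>

lemma ev_simplex_ideal: "f \<in> simplex_ideal R n \<Longrightarrow> E.ev f = \<zero>\<^bsub>Sr m\<^esub>"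
proof -
  interpret P: cring "Pr n" by (rule mpoly_cring)
  let ?s = "\<Oplus>\<^bsub>Pr n\<^esub>i\<in>{..n}. indexed_var i"
  have s: "?s \<in> carrier (Pr n)" by (intro P.finsum_closed) (auto intro: mpoly_var_closed)
  have "E.ev ?s = (\<Oplus>\<^bsub>Sr m\<^esub>i\<in>{..n}. E.ev (indexed_var i))"
    by (rule ring_hom_finsum[OF E.ev_hom P.ring_axioms E.S.ring_axioms]) (auto intro: mpoly_var_closed)
  also have "\<dots> = (\<Oplus>\<^bsub>Sr m\<^esub>i\<in>{..n}. coord_sum m (fibre {i}))"
    unfolding fibre_sum_def[symmetric] by (intro E.S.finsum_cong') (auto simp: E.ev_var fibre_sum_closed)
  also have "\<dots> = coord_sum m (fibre {..n})" by (rule coord_sum_fibres) simp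
  also have "fibre {..n} = {..m}" using th by auto
  finally have es: "E.ev ?s = \<one>\<^bsub>Sr m\<^esub>" by (simp add: coord_sum_all)
  have "simplex_rel n \<oplus>\<^bsub>Pr n\<^esub> ?s = \<one>\<^bsub>Pr n\<^esub>"
    unfolding simplex_rel_def using s by (simp add: P.minus_eq P.a_assoc P.l_neg)
  then have e: "E.ev (simplex_rel n) \<oplus>\<^bsub>Sr m\<^esub> \<one>\<^bsub>Sr m\<^esub> = \<one>\<^bsub>Sr m\<^esub>"
    using ring_hom_add[OF E.ev_hom simplex_rel_closed s] ring_hom_one[OF E.ev_hom] es by simp
  have r: "E.ev (simplex_rel n) = \<zero>\<^bsub>Sr m\<^esub>"
  proof -
    have c: "E.ev (simplex_rel n) \<in> carrier (Sr m)" by (rule ring_hom_closed[OF E.ev_hom simplex_rel_closed])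
    then have "E.ev (simplex_rel n) = (E.ev (simplex_rel n) \<oplus>\<^bsub>Sr m\<^esub> \<one>\<^bsub>Sr m\<^esub>) \<oplus>\<^bsub>Sr m\<^esub> (\<ominus>\<^bsub>Sr m\<^esub> \<one>\<^bsub>Sr m\<^esub>)"
      by (simp add: E.S.a_assoc E.S.r_neg)
    also have "\<dots> = \<zero>\<^bsub>Sr m\<^esub>" unfolding e by (simp add: E.S.r_neg)
    finally show ?thesis .
  qed
  assume "f \<in> simplex_ideal R n"
  then obtain p where "p \<in> carrier (Pr n)" "f = p \<otimes>\<^bsub>Pr n\<^esub> simplex_rel n"
    unfolding simplex_ideal_eq cgenideal_def by blast
  then show ?thesis
    using ring_hom_mult[OF E.ev_hom _ simplex_rel_closed] r ring_hom_closed[OF E.ev_hom] by simp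
qed

abbreviation smap where "smap \<equiv> simplex_ring_map R m n \<theta>"

text \<open>\<open>simplex_ring_map\<close> extracts the element of the image of a coset. The image
  is a singleton because evaluation vanishes on the ideal.\<close>

lemma smap_cls:
  assumes f: "f \<in> carrier (Pr n)" shows "smap (cls n f) = E.ev f"
proof -
  interpret P: cring "Pr n" by (rule mpoly_cring)
  interpret I: ideal "simplex_ideal R n" "Pr n" by (rule ideal_simplex_ideal)
  have "E.ev g = E.ev f" if g: "g \<in> cls n f" for g
  proof -
    obtain h where h: "h \<in> simplex_ideal R n" "g = h \<oplus>\<^bsub>Pr n\<^esub> f"
      using g unfolding simplex_class_def a_r_coset_def' by auto
    then show ?thesis
      using E.ev_add[OF I.Icarr[OF h(1)] f] ev_simplex_ideal[OF h(1)] E.ev_closed[OF f] by simp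
  qed
  moreover have "f \<in> cls n f" unfolding simplex_class_def by (rule I.a_rcos_self[OF f])
  ultimately have "E.ev ` cls n f = {E.ev f}" by blast
  moreover have "smap (cls n f) = the_elem (E.ev ` cls n f)"
  proof -
    have "fibre_sum = (\<lambda>i. \<Oplus>\<^bsub>Sr m\<^esub>j\<in>{j. j \<le> m \<and> \<theta> j = i}. cls m (indexed_var j))"
      by (simp add: fun_eq_iff fibre_sum_def coord_sum_def scoord_def)
    moreover have "sconst m = (\<lambda>c. cls m (indexed_const c))" by (simp add: fun_eq_iff sconst_def)
    ultimately show ?thesis by (simp add: simplex_ring_map_def Let_def)
  qed
  ultimately show ?thesis by simp
qed

lemma smap_hom: "smap \<in> ring_hom (Sr n) (Sr m)"
proof -
  interpret P: cring "Pr n" by (rule mpoly_cring)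
  note ch = ring_hom_mult[OF cls_hom, symmetric] ring_hom_add[OF cls_hom, symmetric]
  show ?thesis
  proof (rule ring_hom_memI)
    fix x assume "x \<in> carrier (Sr n)"
    then obtain f where f: "f \<in> carrier (Pr n)" "x = cls n f" by (elim cls_cases)
    then show "smap x \<in> carrier (Sr m)" by (simp add: smap_cls E.ev_closed)
    fix y assume "y \<in> carrier (Sr n)"
    then obtain g where g: "g \<in> carrier (Pr n)" "y = cls n g" by (elim cls_cases)
    show "smap (x \<otimes>\<^bsub>Sr n\<^esub> y) = smap x \<otimes>\<^bsub>Sr m\<^esub> smap y" "smap (x \<oplus>\<^bsub>Sr n\<^esub> y) = smap x \<oplus>\<^bsub>Sr m\<^esub> smap y"
      using f g by (simp_all add: ch smap_cls ring_hom_mult[OF E.ev_hom] ring_hom_add[OF E.ev_hom])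
  next
    show "smap \<one>\<^bsub>Sr n\<^esub> = \<one>\<^bsub>Sr m\<^esub>"
      using smap_cls[OF P.one_closed] by (simp add: ring_hom_one[OF cls_hom] ring_hom_one[OF E.ev_hom])
  qed
qed

lemma smap_sconst: "c \<in> carrier R \<Longrightarrow> smap (sconst n c) = sconst m c"
  using smap_cls[OF mpoly_const_closed, of c] E.ev_const[of c] by (simp add: sconst_def)

lemma smap_scoord: "i \<le> n \<Longrightarrow> smap (scoord n i) = coord_sum m (fibre {i})"
  unfolding scoord_def fibre_sum_def[symmetric] using smap_cls[OF mpoly_var_closed, of i] E.ev_var[of i] by simp

lemma smap_coord_sum:
  assumes B: "B \<subseteq> {..n}" shows "smap (coord_sum n B) = coord_sum m (fibre B)"
proof -
  interpret Sn: cring "Sr n" by (rule simplex_ring_cring)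
  have "smap (coord_sum n B) = (\<Oplus>\<^bsub>Sr m\<^esub>i\<in>B. smap (scoord n i))"
    unfolding coord_sum_def using B
    by (intro ring_hom_finsum[OF smap_hom Sn.ring_axioms E.S.ring_axioms]) (auto intro: scoord_closed)
  also have "\<dots> = (\<Oplus>\<^bsub>Sr m\<^esub>i\<in>B. coord_sum m (fibre {i}))"
    using B by (intro E.S.finsum_cong') (auto simp: smap_scoord intro: coord_sum_closed)
  also have "\<dots> = coord_sum m (fibre B)" by (rule coord_sum_fibres[OF finite_subset[OF B]]) simp
  finally show ?thesis .
qed

sublocale M: affine_morphism "Sr n" "Sr m" smap
  by (intro affine_morphism.intro affine_morphism_axioms.intro simplex_ring_cring smap_hom)

end

context base_ring
begin

text \<open>Both sides are ring homomorphisms and fix the scalars. On a coordinate the claim is that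
  the preimage under \<open>\<eta>\<close> of a fibre of \<open>\<theta>\<close> is a fibre of the
  composite.\<close>

lemma smap_comp:
  assumes th: "\<theta> \<in> {..m} \<rightarrow> {..n}" and et: "\<eta> \<in> {..l} \<rightarrow> {..m}" and x: "x \<in> carrier (Sr n)"
  shows "simplex_ring_map R l m \<eta> (simplex_ring_map R m n \<theta> x) = simplex_ring_map R l n (compose {..l} \<theta> \<eta>) x"
proof -
  interpret T: simplex_morphism R m n \<theta> by unfold_locales (rule th)
  interpret H: simplex_morphism R l m \<eta> by unfold_locales (rule et)
  interpret C: simplex_morphism R l n "compose {..l} \<theta> \<eta>"
    by unfold_locales (rule funcset_compose[OF et th])
  have "(H.smap \<circ> T.smap) x = C.smap x"
  proof (rule simplex_hom_eqI[OF ring_hom_trans[OF T.smap_hom H.smap_hom] C.smap_hom _ _ x])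
    show "(H.smap \<circ> T.smap) (sconst n c) = C.smap (sconst n c)" if "c \<in> carrier R" for c
      using that by (simp add: T.smap_sconst H.smap_sconst C.smap_sconst)
    fix i assume i: "i \<le> n"
    have "H.smap (coord_sum m (T.fibre {i})) = coord_sum l (H.fibre (T.fibre {i}))"
      by (rule H.smap_coord_sum) auto
    also have "H.fibre (T.fibre {i}) = C.fibre {i}" using et by (auto simp: compose_def)
    finally show "(H.smap \<circ> T.smap) (scoord n i) = C.smap (scoord n i)"
      using i by (simp add: T.smap_scoord C.smap_scoord)
  qed
  then show ?thesis by simp
qed

lemma smap_id:
  assumes x: "x \<in> carrier (Sr n)" shows "simplex_ring_map R n n (\<lambda>i\<in>{..n}. i) x = x"
proof -
  interpret T: simplex_morphism R n n "\<lambda>i\<in>{..n}. i" by unfold_locales auto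
  have id: "id \<in> ring_hom (Sr n) (Sr n)" by (rule ring_hom_memI) auto
  have "T.smap x = id x"
  proof (rule simplex_hom_eqI[OF T.smap_hom id _ _ x])
    fix i assume i: "i \<le> n"
    then have "T.fibre {i} = {i}" by auto
    then show "T.smap (scoord n i) = id (scoord n i)"
      using i by (simp only: T.smap_scoord coord_sum_singleton id_apply)
  qed (simp add: T.smap_sconst)
  then show ?thesis by simp
qed

abbreviation Simp where "Simp n \<equiv> alg_simplex R n"

lemma Simp_eq: "Simp n = kSpec R (Sr n) (sconst n)"
  by (simp add: alg_simplex_def sconst_def[abs_def])

lemma Simp_local: "local_kspace R (Simp n)"
proof -
  interpret S: affine_morphism R "Sr n" "sconst n"
    by (intro affine_morphism.intro affine_morphism_axioms.intro simplex_ring_cring sconst_hom cring_axioms)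
  show ?thesis
    by (simp add: Simp_eq local_kspace_def kSpec_def S.B.local_presheaf_Spec S.Spec_map_lrs_hom)
qed

end

section \<open>Products with the algebraic simplices\<close>

locale simplex_products = base_ring K for K :: "'k ring" (structure) +
  fixes P :: "('p, 's, 'k) simplex_products" and U :: "('p, 's, 'k) kscheme"
  assumes U: "is_kscheme K U" and prod: "\<And>n. is_kproduct K U (alg_simplex K n) (P U n)"
begin

abbreviation T where "T n \<equiv> apex (P U n)"
abbreviation p1 where "p1 n \<equiv> pr1 (P U n)"
abbreviation p2 where "p2 n \<equiv> pr2 (P U n)"
abbreviation \<tau> where "\<tau> m n \<theta> \<equiv> times_simplex_map K P U m n \<theta>"
abbreviation gl where "gl n \<equiv> topspace (pts (und (T n)))"
abbreviation Fn where "Fn n \<equiv> sec (und (T n)) (gl n)"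
abbreviation GS where "GS n a \<equiv> cring.gsec (Sr n) a"
abbreviation TS where "TS n \<equiv> topspace (zariski (Sr n))"

lemma T_kscheme: "is_kscheme K (T n)"
  and p1_khom: "p1 n \<in> khom K (T n) U"
  and p2_khom: "p2 n \<in> khom K (T n) (Simp n)"
  using prod by (auto simp: is_kproduct_def)

sublocale TK: kscheme_over K "T n" for n
  by unfold_locales (rule T_kscheme)

sublocale TS: kscheme_to_affine K "Sr n" "T m" "sconst n" for n m
  by (intro kscheme_to_affine.intro kscheme_to_affine_axioms.intro base_ring_axioms simplex_ring_cring T_kscheme sconst_hom)

text \<open>The universal property speaks about test schemes on the types of the product. The
  products \<open>T m\<close> are such schemes, and they are the sources of all structure
  maps.\<close>

lemma prod_unique:
  assumes "f \<in> khom K (T m) U" "g \<in> khom K (T m) (Simp n)"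
  shows "\<exists>!h. h \<in> khom K (T m) (T n) \<and> kcomp (T m) (T n) U (p1 n) h = f \<and> kcomp (T m) (T n) (Simp n) (p2 n) h = g"
  using prod[of n] T_kscheme assms unfolding is_kproduct_def by blast

lemma T_local: "local_kspace K (T n)"
  by (rule is_kscheme_local_kspace[OF T_kscheme])

lemma U_local: "local_kspace K U"
  by (rule is_kscheme_local_kspace[OF U])

abbreviation smp where "smp m n \<theta> \<equiv> alg_simplex_map K m n \<theta>"

context
  fixes m n :: nat and \<theta> assumes th: "\<theta> \<in> {..m} \<rightarrow> {..n}"
begin

interpretation M: simplex_morphism K m n \<theta> by unfold_locales (rule th)

lemma smp_lrs_hom: "smp m n \<theta> \<in> lrs_hom (Spec (Sr m)) (Spec (Sr n))"
  unfolding alg_simplex_map_def by (rule M.M.Spec_map_lrs_hom)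

lemma smp_gsec: "a \<in> carrier (Sr n) \<Longrightarrow> on_sec (smp m n \<theta>) (TS n) (GS n a) = GS m (simplex_ring_map K m n \<theta> a)"
  unfolding alg_simplex_map_def by (rule M.M.Spec_map_gsec)

text \<open>Moves a question about morphisms to an algebraic simplex into its ring: composition with
  \<open>alg_simplex_map\<close> becomes application of \<open>simplex_ring_map\<close>.\<close>

lemma comp_smp_gsec:
  assumes u: "u \<in> presheaf_hom (und X) (Spec (Sr m))" and a: "a \<in> carrier (Sr n)"
  shows "on_sec (kcomp X (Simp m) (Simp n) (smp m n \<theta>) u) (TS n) (GS n a) = on_sec u (TS m) (GS m (simplex_ring_map K m n \<theta> a))"
  using rs_comp_global[OF u lrs_hom_presheaf_hom[OF smp_lrs_hom], unfolded TS.A.sec_Spec(1,7) TS.A.sec_Spec(7),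
      OF TS.A.gsec_closed[OF a]]
  by (simp add: smp_gsec[OF a] Simp_eq kSpec_def)

text \<open>By \<open>khom_affine_iff\<close> compatibility with the structure morphisms has to be
  checked on scalars only, and \<open>simplex_ring_map\<close> sends scalars to scalars.\<close>

lemma comp_smp_khom:
  assumes "u \<in> khom K (T l) (Simp m)"
  shows "kcomp (T l) (Simp m) (Simp n) (smp m n \<theta>) u \<in> khom K (T l) (Simp n)"
proof -
  have u: "u \<in> khom K (T l) (kSpec K (Sr m) (sconst m))" using assms by (simp add: Simp_eq)
  then have ul: "u \<in> lrs_hom (und (T l)) (Spec (Sr m))" by (simp add: TS.khom_affine_iff)
  have "kcomp (T l) (Simp m) (Simp n) (smp m n \<theta>) u \<in> lrs_hom (und (T l)) (Spec (Sr n))"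
    using lrs_hom_comp[OF TS.XA.local_presheaf_X TS.A.local_presheaf_Spec TS.A.local_presheaf_Spec ul smp_lrs_hom]
    by (simp add: Simp_eq kSpec_def)
  moreover have "on_sec (kcomp (T l) (Simp m) (Simp n) (smp m n \<theta>) u) (TS n) (GS n (sconst n c))
      = on_sec (str (T l)) (topspace (zariski K)) (gsec c)" if c: "c \<in> carrier K" for c
    using comp_smp_gsec[OF lrs_hom_presheaf_hom[OF ul], of "sconst n c"] ring_hom_closed[OF sconst_hom c] c u
    by (simp add: M.smap_sconst TS.khom_affine_iff)
  ultimately show ?thesis by (simp add: Simp_eq TS.khom_affine_iff)
qed

lemma times_simplex_map:
  shows "\<tau> m n \<theta> \<in> khom K (T m) (T n)"
    and "kcomp (T m) (T n) U (p1 n) (\<tau> m n \<theta>) = p1 m"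
    and "kcomp (T m) (T n) (Simp n) (p2 n) (\<tau> m n \<theta>) = kcomp (T m) (Simp m) (Simp n) (smp m n \<theta>) (p2 m)"
  using theI'[OF prod_unique[OF p1_khom comp_smp_khom[OF p2_khom]]]
  unfolding times_simplex_map_def pairing_def by auto

end

lemma times_simplex_map_eqI:
  assumes th: "\<theta> \<in> {..m} \<rightarrow> {..n}" and h: "h \<in> khom K (T m) (T n)"
    and "kcomp (T m) (T n) U (p1 n) h = p1 m"
    and "kcomp (T m) (T n) (Simp n) (p2 n) h = kcomp (T m) (Simp m) (Simp n) (smp m n \<theta>) (p2 m)"
  shows "h = \<tau> m n \<theta>"
  using prod_unique[OF p1_khom comp_smp_khom[OF th p2_khom]] times_simplex_map[OF th] assms by blast

lemma p2_presheaf: "p2 n \<in> presheaf_hom (und (T n)) (Spec (Sr n))"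
  using khom_presheaf_hom[OF p2_khom] by (simp add: Simp_eq kSpec_def)

text \<open>The two maps into the product are compared after the projections. The first projection
  needs only associativity; the second has an affine target, where elements of \<open>Sr n\<close>
  decide and the claim is \<open>smap_comp\<close>.\<close>

lemma times_simplex_map_comp:
  assumes th: "\<theta> \<in> {..m} \<rightarrow> {..n}" and et: "\<eta> \<in> {..l} \<rightarrow> {..m}"
  shows "kcomp (T l) (T m) (T n) (\<tau> m n \<theta>) (\<tau> l m \<eta>) = \<tau> l n (compose {..l} \<theta> \<eta>)"
proof (rule times_simplex_map_eqI)
  note t = times_simplex_map[OF th] and e = times_simplex_map[OF et]
  have te: "compose {..l} \<theta> \<eta> \<in> {..l} \<rightarrow> {..n}" by (rule funcset_compose[OF et th])
  show "compose {..l} \<theta> \<eta> \<in> {..l} \<rightarrow> {..n}" by (rule te)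
  show "kcomp (T l) (T m) (T n) (\<tau> m n \<theta>) (\<tau> l m \<eta>) \<in> khom K (T l) (T n)"
    by (rule khom_comp[OF cring_axioms T_local T_local T_local e(1) t(1)])
  show "kcomp (T l) (T n) U (p1 n) (kcomp (T l) (T m) (T n) (\<tau> m n \<theta>) (\<tau> l m \<eta>)) = p1 l"
    unfolding kcomp_assoc[OF U_local T_local e(1) t(1) p1_khom] t(2) by (rule e(2))
  have "kcomp (T l) (T n) (Simp n) (p2 n) (kcomp (T l) (T m) (T n) (\<tau> m n \<theta>) (\<tau> l m \<eta>))
      = kcomp (T l) (T m) (Simp n) (kcomp (T m) (Simp m) (Simp n) (smp m n \<theta>) (p2 m)) (\<tau> l m \<eta>)"
    unfolding kcomp_assoc[OF Simp_local T_local e(1) t(1) p2_khom] t(3) by (rule refl)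
  also have "\<dots> = kcomp (T l) (Simp l) (Simp n) (smp l n (compose {..l} \<theta> \<eta>)) (p2 l)"
  proof (rule TS.khom_affine_eqI[where n = n and m = l])
    show "kcomp (T l) (Simp l) (Simp n) (smp l n (compose {..l} \<theta> \<eta>)) (p2 l) \<in> khom K (T l) (kSpec K (Sr n) (sconst n))"
      using comp_smp_khom[OF te p2_khom] by (simp add: Simp_eq)
    show "kcomp (T l) (T m) (Simp n) (kcomp (T m) (Simp m) (Simp n) (smp m n \<theta>) (p2 m)) (\<tau> l m \<eta>)
        \<in> khom K (T l) (kSpec K (Sr n) (sconst n))"
      using khom_comp[OF cring_axioms T_local T_local Simp_local e(1) comp_smp_khom[OF th p2_khom]] by (simp add: Simp_eq)
    fix a assume a: "a \<in> carrier (Sr n)"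
    let ?b = "simplex_ring_map K m n \<theta> a"
    interpret M: simplex_morphism K m n \<theta> by unfold_locales (rule th)
    have b: "?b \<in> carrier (Sr m)" by (rule ring_hom_closed[OF M.smap_hom a])
    have v: "kcomp (T m) (Simp m) (Simp n) (smp m n \<theta>) (p2 m) \<in> presheaf_hom (und (T m)) (Spec (Sr n))"
      using khom_presheaf_hom[OF comp_smp_khom[OF th p2_khom]] by (simp add: Simp_eq kSpec_def)
    have "on_sec (kcomp (T l) (T m) (Simp n) (kcomp (T m) (Simp m) (Simp n) (smp m n \<theta>) (p2 m)) (\<tau> l m \<eta>)) (TS n) (GS n a)
        = on_sec (\<tau> l m \<eta>) (gl m) (on_sec (kcomp (T m) (Simp m) (Simp n) (smp m n \<theta>) (p2 m)) (TS n) (GS n a))"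
      using rs_comp_global[OF khom_presheaf_hom[OF e(1)] v, unfolded TS.A.sec_Spec(1,7), OF TS.A.gsec_closed[OF a]]
      by (simp add: Simp_eq kSpec_def)
    also have "\<dots> = on_sec (\<tau> l m \<eta>) (gl m) (on_sec (p2 m) (TS m) (GS m ?b))"
      by (simp add: comp_smp_gsec[OF th p2_presheaf a])
    also have "\<dots> = on_sec (kcomp (T l) (T m) (Simp m) (p2 m) (\<tau> l m \<eta>)) (TS m) (GS m ?b)"
      using rs_comp_global[OF khom_presheaf_hom[OF e(1)] p2_presheaf, unfolded TS.A.sec_Spec(1,7), OF TS.A.gsec_closed[OF b]]
      by (simp add: Simp_eq kSpec_def)
    also have "\<dots> = on_sec (p2 l) (TS l) (GS l (simplex_ring_map K l m \<eta> ?b))"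
      unfolding e(3) by (rule comp_smp_gsec[OF et p2_presheaf b])
    also have "\<dots> = on_sec (kcomp (T l) (Simp l) (Simp n) (smp l n (compose {..l} \<theta> \<eta>)) (p2 l)) (TS n) (GS n a)"
      unfolding comp_smp_gsec[OF te p2_presheaf a] smap_comp[OF th et a] by (rule refl)
    finally show "on_sec (kcomp (T l) (T m) (Simp n) (kcomp (T m) (Simp m) (Simp n) (smp m n \<theta>) (p2 m)) (\<tau> l m \<eta>)) (TS n) (GS n a)
        = on_sec (kcomp (T l) (Simp l) (Simp n) (smp l n (compose {..l} \<theta> \<eta>)) (p2 l)) (TS n) (GS n a)" .
  qed
  finally show "kcomp (T l) (T n) (Simp n) (p2 n) (kcomp (T l) (T m) (T n) (\<tau> m n \<theta>) (\<tau> l m \<eta>))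
      = kcomp (T l) (Simp l) (Simp n) (smp l n (compose {..l} \<theta> \<eta>)) (p2 l)" .
qed

lemma times_simplex_map_id: "\<tau> n n (\<lambda>i\<in>{..n}. i) = rs_id (und (T n))"
proof (rule times_simplex_map_eqI[symmetric])
  show i: "(\<lambda>i\<in>{..n}. i) \<in> {..n} \<rightarrow> {..n}" by auto
  show "rs_id (und (T n)) \<in> khom K (T n) (T n)" by (rule khom_id[OF cring_axioms T_local])
  have X: "local_presheaf (und (T n))" using T_local by (simp add: local_kspace_def)
  show "kcomp (T n) (T n) U (p1 n) (rs_id (und (T n))) = p1 n"
    by (rule rs_comp_id_right[OF X local_kspace_presheaf[OF U_local] khom_presheaf_hom[OF p1_khom]])
  have "p2 n = kcomp (T n) (Simp n) (Simp n) (smp n n (\<lambda>i\<in>{..n}. i)) (p2 n)"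
  proof (rule TS.khom_affine_eqI[where n = n and m = n])
    show "p2 n \<in> khom K (T n) (kSpec K (Sr n) (sconst n))" using p2_khom by (simp add: Simp_eq)
    show "kcomp (T n) (Simp n) (Simp n) (smp n n (\<lambda>i\<in>{..n}. i)) (p2 n) \<in> khom K (T n) (kSpec K (Sr n) (sconst n))"
      using comp_smp_khom[OF i p2_khom] by (simp add: Simp_eq)
    fix a assume a: "a \<in> carrier (Sr n)"
    show "on_sec (p2 n) (TS n) (GS n a) = on_sec (kcomp (T n) (Simp n) (Simp n) (smp n n (\<lambda>i\<in>{..n}. i)) (p2 n)) (TS n) (GS n a)"
      unfolding comp_smp_gsec[OF i p2_presheaf a] smap_id[OF a] by (rule refl)
  qed
  then show "kcomp (T n) (T n) (Simp n) (p2 n) (rs_id (und (T n))) = kcomp (T n) (Simp n) (Simp n) (smp n n (\<lambda>i\<in>{..n}. i)) (p2 n)"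
    using rs_comp_id_right[OF X local_kspace_presheaf[OF Simp_local] khom_presheaf_hom[OF p2_khom]] by simp
qed

section \<open>Partial sums of coordinates as functions on the products\<close>

definition weight where "weight n B = on_sec (p2 n) (TS n) (GS n (coord_sum n B))"

lemma p2_pullback_hom: "(\<lambda>a. on_sec (p2 n) (TS n) (GS n a)) \<in> ring_hom (Sr n) (Fn n)"
  using TS.pullback_hom[of "p2 n" n n] p2_khom by (simp add: Simp_eq)

lemma weight_closed: "B \<subseteq> {..n} \<Longrightarrow> weight n B \<in> carrier (Fn n)"
  unfolding weight_def using ring_hom_closed[OF p2_pullback_hom coord_sum_closed] by simp

lemma weight_all: "weight n {..n} = \<one>\<^bsub>Fn n\<^esub>"
  unfolding weight_def coord_sum_all using ring_hom_one[OF p2_pullback_hom] by simp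

lemma weight_empty: "weight n {} = \<zero>\<^bsub>Fn n\<^esub>"
proof -
  interpret O: cring "Fn n" by (rule TK.L.XA.sec_cring) simp
  show ?thesis
    unfolding weight_def coord_sum_empty
    using ring_hom_zero[OF p2_pullback_hom TS.A.ring_axioms O.ring_axioms] by simp
qed

text \<open>With \<open>weight_all\<close> and \<open>weight_empty\<close> this shows that the
  function is 1 on the face spanned by the vertices in \<open>B\<close> and 0 on the opposite
  face.\<close>

lemma weight_pullback:
  assumes th: "\<theta> \<in> {..m} \<rightarrow> {..n}" and B: "B \<subseteq> {..n}"
  shows "on_sec (\<tau> m n \<theta>) (gl n) (weight n B) = weight m {j. j \<le> m \<and> \<theta> j \<in> B}"
proof -
  interpret M: simplex_morphism K m n \<theta> by unfold_locales (rule th)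
  note t = times_simplex_map[OF th] and c = coord_sum_closed[OF B]
  have "on_sec (\<tau> m n \<theta>) (gl n) (weight n B) = on_sec (kcomp (T m) (T n) (Simp n) (p2 n) (\<tau> m n \<theta>)) (TS n) (GS n (coord_sum n B))"
    unfolding weight_def
    using rs_comp_global[OF khom_presheaf_hom[OF t(1)] p2_presheaf, unfolded TS.A.sec_Spec(1,7), OF TS.A.gsec_closed[OF c]]
    by (simp add: Simp_eq kSpec_def)
  also have "\<dots> = on_sec (p2 m) (TS m) (GS m (simplex_ring_map K m n \<theta> (coord_sum n B)))"
    unfolding t(3) by (rule comp_smp_gsec[OF th p2_presheaf c])
  also have "\<dots> = weight m {j. j \<le> m \<and> \<theta> j \<in> B}"
    unfolding M.smap_coord_sum[OF B] weight_def by (rule refl)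
  finally show ?thesis .
qed

section \<open>The simplicial set of functions on the products and its contraction\<close>

abbreviation Xs where "Xs \<equiv> sSet_Sm K P U (affine_line K)"

lemma Xs_simps:
  "simplices Xs n = khom K (T n) (affine_line K)"
  "act Xs m n \<theta> f = kcomp (T m) (T n) (affine_line K) f (\<tau> m n \<theta>)"
  by (simp_all add: sSet_Sm_def)

lemma line_local: "local_kspace K (affine_line K)"
  using TK.L.Y_local by (simp add: TK.line_eq)

lemma act_closed:
  "\<theta> \<in> {..m} \<rightarrow> {..n} \<Longrightarrow> f \<in> simplices Xs n \<Longrightarrow> act Xs m n \<theta> f \<in> simplices Xs m"
  unfolding Xs_simps by (rule khom_comp[OF cring_axioms T_local T_local line_local times_simplex_map(1)])

lemma act_act:
  assumes th: "\<theta> \<in> {..m} \<rightarrow> {..n}" and et: "\<eta> \<in> {..l} \<rightarrow> {..m}" and f: "f \<in> simplices Xs n"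
  shows "act Xs l m \<eta> (act Xs m n \<theta> f) = act Xs l n (compose {..l} \<theta> \<eta>) f"
  using f unfolding Xs_simps times_simplex_map_comp[OF th et, symmetric]
  by (intro kcomp_assoc[OF line_local T_local, symmetric] times_simplex_map(1) th et)

lemma act_id: "f \<in> simplices Xs n \<Longrightarrow> act Xs n n (\<lambda>i\<in>{..n}. i) f = f"
  unfolding Xs_simps times_simplex_map_id
  using T_local by (intro rs_comp_id_right local_kspace_presheaf[OF line_local] khom_presheaf_hom) (simp_all add: local_kspace_def)

lemma simplicial_set_Xs: "simplicial_set Xs"
  unfolding simplicial_set_def
proof (intro conjI allI ballI)
  fix m n \<theta> f assume "\<theta> \<in> simplex_cat m n" "f \<in> simplices Xs n"
  then show "act Xs m n \<theta> f \<in> simplices Xs m" by (intro act_closed) (auto simp: simplex_cat_def)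
next
  fix n f assume "f \<in> simplices Xs n"
  then show "act Xs n n (\<lambda>i\<in>{..n}. i) f = f" by (rule act_id)
next
  fix l m n \<eta> \<theta> f assume "\<eta> \<in> simplex_cat l m" "\<theta> \<in> simplex_cat m n" "f \<in> simplices Xs n"
  then show "act Xs l m \<eta> (act Xs m n \<theta> f) = act Xs l n (compose {..l} \<theta> \<eta>) f"
    by (intro act_act) (auto simp: simplex_cat_def)
qed

lemma line_fun_act:
  "\<theta> \<in> {..m} \<rightarrow> {..n} \<Longrightarrow> f \<in> simplices Xs n \<Longrightarrow>
    line_fun K (act Xs m n \<theta> f) = on_sec (\<tau> m n \<theta>) (gl n) (line_fun K f)"
  unfolding Xs_simps by (rule TK.line_fun_comp[OF times_simplex_map(1)])

lemma pullback_ring_hom: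
  "\<theta> \<in> {..m} \<rightarrow> {..n} \<Longrightarrow> on_sec (\<tau> m n \<theta>) (gl n) \<in> ring_hom (Fn n) (Fn m)"
  by (rule global_hom[OF khom_presheaf_hom[OF times_simplex_map(1)]])

text \<open>On coordinates this is x + y. For \<open>n > 0\<close> the vertex \<open>n\<close> goes
  to \<open>n\<close> and \<open>n+1\<close> to \<open>0\<close>, so the map lies outside
  \<open>simplex_cat\<close>; \<open>act\<close> is nevertheless defined on it through the algebraic
  simplices.\<close>

definition fold_map :: "nat \<Rightarrow> nat \<Rightarrow> nat" where "fold_map n = (\<lambda>i\<in>{..2*n+1}. if i \<le> n then i else i - (n+1))"

lemma fold_map_in: "fold_map n \<in> {..2*n+1} \<rightarrow> {..n}"
  by (auto simp: fold_map_def)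

text \<open>In coordinates \<open>x\<^sub>0, \<dots>, x\<^sub>n, y\<^sub>0, \<dots>, y\<^sub>n\<close> this is \<open>(\<Sum> x\<^sub>i) \<cdot> f (x + y)\<close>.\<close>

definition extend where
  "extend n f = (SOME g. g \<in> simplices Xs (2*n+1) \<and>
     line_fun K g = weight (2*n+1) {..n} \<otimes>\<^bsub>Fn (2*n+1)\<^esub> line_fun K (act Xs (2*n+1) n (fold_map n) f))"

lemma line_fun_closed: "f \<in> simplices Xs n \<Longrightarrow> line_fun K f \<in> carrier (Fn n)"
  unfolding Xs_simps by (rule TK.line_fun_closed)

lemma sec_cring: "cring (Fn n)"
  by (rule TK.L.XA.sec_cring) simp

lemma extend:
  assumes f: "f \<in> simplices Xs n"
  shows "extend n f \<in> simplices Xs (2*n+1)"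
    and "line_fun K (extend n f) =
      weight (2*n+1) {..n} \<otimes>\<^bsub>Fn (2*n+1)\<^esub> line_fun K (act Xs (2*n+1) n (fold_map n) f)"
proof -
  interpret O: cring "Fn (2*n+1)" by (rule sec_cring)
  have "weight (2*n+1) {..n} \<otimes>\<^bsub>Fn (2*n+1)\<^esub> line_fun K (act Xs (2*n+1) n (fold_map n) f)
      \<in> carrier (Fn (2*n+1))"
    by (intro O.m_closed weight_closed line_fun_closed act_closed fold_map_in f) auto
  from TK.line_hom_exists[OF this] have "\<exists>g. g \<in> simplices Xs (2*n+1) \<and> line_fun K g = weight (2*n+1) {..n}
      \<otimes>\<^bsub>Fn (2*n+1)\<^esub> line_fun K (act Xs (2*n+1) n (fold_map n) f)"
    unfolding Xs_simps by metis
  from someI_ex[OF this] show "extend n f \<in> simplices Xs (2*n+1)"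
    "line_fun K (extend n f) =
      weight (2*n+1) {..n} \<otimes>\<^bsub>Fn (2*n+1)\<^esub> line_fun K (act Xs (2*n+1) n (fold_map n) f)"
    unfolding extend_def by blast+
qed

text \<open>The weight restricts to the sum of the coordinates of those vertices that land in the
  first copy, and \<open>f\<close> is pulled back along the folded map. The two faces and naturality
  are the cases \<open>front_face n\<close>, \<open>back_face n\<close> and
  \<open>double m n \<theta>\<close>.\<close>

lemma line_fun_act_extend:
  assumes th: "\<theta> \<in> {..m} \<rightarrow> {..2*n+1}" and f: "f \<in> simplices Xs n"
  shows "line_fun K (act Xs m (2*n+1) \<theta> (extend n f)) =
    weight m {j. j \<le> m \<and> \<theta> j \<le> n} \<otimes>\<^bsub>Fn m\<^esub> line_fun K (act Xs m n (compose {..m} (fold_map n) \<theta>) f)"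
proof -
  note a = act_closed[OF fold_map_in f]
  have "line_fun K (act Xs m (2*n+1) \<theta> (extend n f)) =
      on_sec (\<tau> m (2*n+1) \<theta>) (gl (2*n+1)) (weight (2*n+1) {..n}) \<otimes>\<^bsub>Fn m\<^esub>
      on_sec (\<tau> m (2*n+1) \<theta>) (gl (2*n+1)) (line_fun K (act Xs (2*n+1) n (fold_map n) f))"
    unfolding line_fun_act[OF th extend(1)[OF f]] extend(2)[OF f]
    by (intro ring_hom_mult[OF pullback_ring_hom[OF th]] weight_closed line_fun_closed a) auto
  also have "on_sec (\<tau> m (2*n+1) \<theta>) (gl (2*n+1)) (line_fun K (act Xs (2*n+1) n (fold_map n) f))
      = line_fun K (act Xs m n (compose {..m} (fold_map n) \<theta>) f)"
    unfolding line_fun_act[OF th a, symmetric] act_act[OF fold_map_in th f] by (rule refl)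
  also have "on_sec (\<tau> m (2*n+1) \<theta>) (gl (2*n+1)) (weight (2*n+1) {..n}) = weight m {j. j \<le> m \<and> \<theta> j \<in> {..n}}"
    by (rule weight_pullback[OF th]) auto
  finally show ?thesis by simp
qed

lemma simplex_eqI: "f \<in> simplices Xs n \<Longrightarrow> g \<in> simplices Xs n \<Longrightarrow> line_fun K f = line_fun K g \<Longrightarrow> f = g"
  unfolding Xs_simps by (rule TK.line_hom_eqI)

lemma contractible_Xs: "contractible_sset Xs"
proof -
  interpret O0: cring "Fn 0" by (rule sec_cring)
  obtain z where z: "z \<in> simplices Xs 0" "line_fun K z = \<zero>\<^bsub>Fn 0\<^esub>"
    using TK.line_hom_exists[OF O0.zero_closed] unfolding Xs_simps by metis
  have "contractible_space (realization Xs)"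
  proof (rule contractible_realization[OF simplicial_set_Xs, of extend z])
    fix n f assume f: "f \<in> simplices Xs n"
    interpret O: cring "Fn n" by (rule sec_cring)
    show "extend n f \<in> simplices Xs (2*n+1)" by (rule extend(1)[OF f])
    have fr: "front_face n \<in> {..n} \<rightarrow> {..2*n+1}" and bk: "back_face n \<in> {..n} \<rightarrow> {..2*n+1}"
      using front_face_in_simplex_cat back_face_in_simplex_cat by (auto simp: simplex_cat_def)
    show "act Xs n (2*n+1) (front_face n) (extend n f) = f"
    proof (rule simplex_eqI[OF act_closed[OF fr extend(1)[OF f]] f])
      \<comment> \<open>All vertices of this face lie in the first copy, so the weight is the sum of
        all coordinates, which is one, and folding is the identity.\<close>
      have "{j. j \<le> n \<and> front_face n j \<le> n} = {..n}" by (auto simp: front_face_def)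
      moreover have "compose {..n} (fold_map n) (front_face n) = (\<lambda>i\<in>{..n}. i)"
        by (auto simp: compose_def fold_map_def front_face_def)
      ultimately show "line_fun K (act Xs n (2*n+1) (front_face n) (extend n f)) = line_fun K f"
        unfolding line_fun_act_extend[OF fr f] using line_fun_closed[OF f] by (simp add: weight_all act_id[OF f])
    qed
    have c: "(\<lambda>i\<in>{..n}. 0) \<in> {..n} \<rightarrow> {..0::nat}" by auto
    show "act Xs n (2*n+1) (back_face n) (extend n f) = act Xs n 0 (\<lambda>i\<in>{..n}. 0) z"
    proof (rule simplex_eqI[OF act_closed[OF bk extend(1)[OF f]] act_closed[OF c z(1)]])
      \<comment> \<open>No vertex of this face lies in the first copy. The weight is an empty sum,
        so the function is zero, and so is every pullback of the function of
        \<open>z\<close>.\<close>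
      have e: "{j. j \<le> n \<and> back_face n j \<le> n} = {}" by (auto simp: back_face_def)
      have "line_fun K (act Xs n (2*n+1) (back_face n) (extend n f)) = \<zero>\<^bsub>Fn n\<^esub>"
        unfolding line_fun_act_extend[OF bk f] e weight_empty
        by (intro O.l_null line_fun_closed act_closed[OF _ f] funcset_compose[OF bk fold_map_in])
      also have "\<dots> = line_fun K (act Xs n 0 (\<lambda>i\<in>{..n}. 0) z)"
        unfolding line_fun_act[OF c z(1)] z(2)
        by (rule ring_hom_zero[OF pullback_ring_hom[OF c] O0.ring_axioms O.ring_axioms, symmetric])
      finally show "line_fun K (act Xs n (2*n+1) (back_face n) (extend n f)) = line_fun K (act Xs n 0 (\<lambda>i\<in>{..n}. 0) z)" .
    qed
  next
    fix m n \<theta> f assume th: "\<theta> \<in> simplex_cat m n" and f: "f \<in> simplices Xs n"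
    then have t: "\<theta> \<in> {..m} \<rightarrow> {..n}" by (auto simp: simplex_cat_def)
    have d: "double m n \<theta> \<in> {..2*m+1} \<rightarrow> {..2*n+1}"
      using double_in_simplex_cat[OF th] by (auto simp: simplex_cat_def)
    note tf = act_closed[OF t f]
    show "extend m (act Xs m n \<theta> f) = act Xs (2*m+1) (2*n+1) (double m n \<theta>) (extend n f)"
    proof (rule simplex_eqI[OF extend(1)[OF tf] act_closed[OF d extend(1)[OF f]]])
      \<comment> \<open>Both sides are the same product: \<open>double m n \<theta>\<close> respects
        the two copies, which gives equal weights, and folding after it is \<open>\<theta>\<close>
        after folding.\<close>
      have "{j. j \<le> 2*m+1 \<and> double m n \<theta> j \<le> n} = {..m}" using t by (auto simp: double_def split: if_splits)
      moreover have "compose {..2*m+1} (fold_map n) (double m n \<theta>) = compose {..2*m+1} \<theta> (fold_map m)"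
        unfolding compose_def
      proof (rule restrict_ext)
        fix i assume i: "i \<in> {..2*m+1}"
        show "fold_map n (double m n \<theta> i) = \<theta> (fold_map m i)"
        proof (cases "i \<le> m")
          case True
          then have "\<theta> i \<le> n" using t by auto
          then show ?thesis using True by (simp add: fold_map_def double_def)
        next
          case False
          then have "\<theta> (i - (m+1)) \<le> n" using t i by auto
          then show ?thesis using False i by (simp add: fold_map_def double_def)
        qed
      qed
      ultimately show "line_fun K (extend m (act Xs m n \<theta> f)) = line_fun K (act Xs (2*m+1) (2*n+1) (double m n \<theta>) (extend n f))"
        unfolding extend(2)[OF tf] line_fun_act_extend[OF d f] act_act[OF t fold_map_in f] by simp
    qed
  qed (rule z(1))
  then show ?thesis by (rule contractible_ssetI[OF simplicial_set_Xs]) (use z in blast)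
qed

end

theorem corollary1p6:
  fixes K :: "'k ring"
    and P :: "('p, 's, 'k) simplex_products"
  assumes "field K"
    and "\<exists>e :: 'k list \<Rightarrow> 'p. inj e"
    and "\<exists>e :: 'k list \<Rightarrow> 's. inj e"
    and "simplex_product_choice K P"
  shows "objectwise_contractible K (represented_presheaf K P (affine_line K))"
  unfolding objectwise_contractible_def
proof
  interpret field K by fact
  fix U :: "('p, 's, 'k) kscheme" assume U: "U \<in> Sm K"
  interpret simplex_products K P U
    by unfold_locales (use U assms(4) in \<open>auto simp: Sm_def simplex_product_choice_def\<close>)
  show "contractible_sset (on_objs (represented_presheaf K P (affine_line K)) U)"
    using contractible_Xs by (simp add: represented_presheaf_def)
qed

end
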